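(* Let $E$ be a second countable topological graph. There is a bijection between the rays of non-zero extremal harmonic measures on $\partial E$ concentrated on $\mathcal C$ and equivalence classes of summable loops $\alpha$ in $E$. The ray corresponding to such a loop $\alpha$ is of the form $\{r\cdot\nu\;|\;r>0\}$, where $$\nu=\sum_{\beta\in E_\alpha^*}\delta_{\beta\alpha^\infty}.$$
   Context: A topological graph $E=(E^0,E^1,r,s)$ consists of locally compact Hausdorff spaces $E^0$, $E^1$, a local homeomorphism $s:E^1\to E^0$ and a continuous map $r:E^1\to E^0$; it is second countable if $E^0$ and $E^1$ are. For $n\ge1$, $E^n$ is the set of paths $\alpha=\alpha_1\cdots\alpha_n$ of edges with $s(\alpha_i)=r(\alpha_{i+1})$, topologised as a subspace of $\prod_{i=1}^nE^1$; vertices are paths of length $0$; $|\alpha|$ is the length. $E^*=\bigsqcup_{n\ge0}E^n$ (disjoint union topology), and $E^\infty$ is the set of infinite paths $\alpha_1\alpha_2\cdots$ with $s(\alpha_i)=r(\alpha_{i+1})$, $|\alpha|=\infty$. One extends $r(\alpha)=r(\alpha_1)$, $s(\alpha)=s(\alpha_{|\alpha|})$ (finite paths), $r(v)=s(v)=v$ for vertices. $E^0_{reg}$ is the set of $v\in E^0$ having an open neighbourhood $W$ with $\overline W$ compact, $r^{-1}(\overline W)\subseteq E^1$ compact and $r(r^{-1}(W))=W$; $E^0_{sng}=E^0\setminus E^0_{reg}$; $E^*_{sng}=\{\alpha\in E^*: s(\alpha)\in E^0_{sng}\}$. As a set the boundary path space is $\partial E=E^*_{sng}\sqcup E^\infty$.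 For $S\subseteq E^*$, $Z(S)=\{\alpha\in\partial E: r(\alpha)\in S\text{ or }\alpha_1\cdots\alpha_n\in S\text{ for some }1\le n\le|\alpha|\}$. The sets $Z(U)\setminus Z(K)$ ($U\subseteq E^*$ open, $K\subseteq E^*$ compact) form a basis of a locally compact Hausdorff topology on $\partial E$. The shift $\sigma:\partial E\setminus E^0\to\partial E$ removes the first edge ($\sigma(\alpha)=s(\alpha_1)$ if $|\alpha|=1$); it is a local homeomorphism. Loops. A loop is a path $\alpha\in E^*$ with $|\alpha|\ge1$ and $s(\alpha)=r(\alpha)$; then $\alpha^\infty=\alpha\alpha\alpha\cdots\in E^\infty$. $E_\alpha^*=\{\beta\in E^*: s(\beta)=r(\alpha),\ \beta\text{ is not of the form }\beta=\beta'\alpha\}$ (here $\beta'$ may have length $0$), and $VE_\alpha^*=\{\beta\in E_\alpha^*: r(\beta)\in V\}$ for $V\subseteq E^0$. A loop $\alpha$ is summable if (a) $\alpha\ne\gamma^n$ for any loop $\gamma\in E^*$ and any $n\ge2$, and (b') for any $w\in E^0$ there is an open neighbourhood $V_w\subseteq E^0$ of $w$ with $|V_wE_\alpha^*|<\infty$. Two loops $\alpha,\beta$ are equivalent if $\beta=\alpha_{k+1}\cdots\alpha_{|\alpha|}\alpha_1\cdots\alpha_k$ for some $k$. $\mathcal C$ is the set of eventually cyclic paths, i.e. of all $\beta\alpha^\infty\in E^\infty$ with $\alpha$ a loop and $\beta\in E^*$ with $s(\beta)=r(\alpha)$; it is a Borel subset of $\partial E$. Measures. An invariant measure on $\partial E$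 is a regular (i.e. finite on compact sets) Borel measure $\nu$ with $\nu(\sigma(A))=\nu(A)$ for all Borel $A\subseteq\partial E\setminus E^0$ on which $\sigma$ is injective. It is extremal if any decomposition $\nu=\nu_1+\nu_2$ into invariant measures satisfies $\nu_1,\nu_2\in\{\lambda\nu:\lambda\ge0\}$. It is concentrated on a Borel set $B$ if $\nu(\partial E\setminus B)=0$, and harmonic if it is concentrated on $E^\infty$. A ray of measures is a set of the form $\{r\nu: r>0\}$. $\delta_x$ is the Dirac measure at $x$. *)

theory Defs
  imports "HOL-Analysis.Analysis" "HOL-Probability.Giry_Monad" "HOL-Library.Extended_Nat"
begin

section \<open>Topological graphs\<close>

record ('v, 'e) tgraph =
  vtop :: "'v topology"
  etop :: "'e topology"
  rmap :: "'e \<Rightarrow> 'v"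
  smap :: "'e \<Rightarrow> 'v"

definition local_homeomorphism_map :: "'a topology \<Rightarrow> 'b topology \<Rightarrow> ('a \<Rightarrow> 'b) \<Rightarrow> bool" where
  "local_homeomorphism_map X Y f \<longleftrightarrow>
     (\<forall>x\<in>topspace X. \<exists>U. openin X U \<and> x \<in> U \<and> openin Y (f ` U) \<and>
        homeomorphic_map (subtopology X U) (subtopology Y (f ` U)) f)"

definition topological_graph :: "('v, 'e) tgraph \<Rightarrow> bool" where
  "topological_graph E \<longleftrightarrow>
     locally_compact_space (vtop E) \<and> Hausdorff_space (vtop E) \<and>
     locally_compact_space (etop E) \<and> Hausdorff_space (etop E) \<and>
     local_homeomorphism_map (etop E) (vtop E) (smap E) \<and>
     continuous_map (etop E) (vtop E) (rmap E)"

definition second_countable_graph :: "('v, 'e) tgraph \<Rightarrow> bool" where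
  "second_countable_graph E \<longleftrightarrow> second_countable (vtop E) \<and> second_countable (etop E)"

definition regular_vertices :: "('v, 'e) tgraph \<Rightarrow> 'v set" where
  "regular_vertices E =
     {v \<in> topspace (vtop E). \<exists>W. openin (vtop E) W \<and> v \<in> W \<and>
        compactin (vtop E) (vtop E closure_of W) \<and>
        compactin (etop E) {e \<in> topspace (etop E). rmap E e \<in> vtop E closure_of W} \<and>
        rmap E ` {e \<in> topspace (etop E). rmap E e \<in> W} = W}"

definition singular_vertices :: "('v, 'e) tgraph \<Rightarrow> 'v set" where
  "singular_vertices E = topspace (vtop E) - regular_vertices E"


section \<open>Paths\<close>

text \<open>A vertex is a path of length 0; \<open>Edges xs\<close> represents a path of length at least 1, so
  \<open>xs\<close> is nonempty for every element of the path spaces below. The type contains junk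
  values; the path spaces are the sets \<open>paths_of_length\<close>, \<open>finite_paths\<close> and \<open>infinite_paths\<close>.
  Infinite paths are indexed from 0.\<close>

datatype ('v, 'e) path = Vertex 'v | Edges "'e list" | InfPath "nat \<Rightarrow> 'e"

fun plen :: "('v, 'e) path \<Rightarrow> enat" where
  "plen (Vertex v) = 0"
| "plen (Edges xs) = enat (length xs)"
| "plen (InfPath f) = \<infinity>"

fun rng :: "('v, 'e) tgraph \<Rightarrow> ('v, 'e) path \<Rightarrow> 'v" where
  "rng E (Vertex v) = v"
| "rng E (Edges xs) = rmap E (hd xs)"
| "rng E (InfPath f) = rmap E (f 0)"

text \<open>The source of an infinite path is not a meaningful notion; it is left unspecified.\<close>

fun src :: "('v, 'e) tgraph \<Rightarrow> ('v, 'e) path \<Rightarrow> 'v" where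
  "src E (Vertex v) = v"
| "src E (Edges xs) = smap E (last xs)"
| "src E (InfPath f) = undefined"

definition paths_of_length :: "('v, 'e) tgraph \<Rightarrow> nat \<Rightarrow> ('v, 'e) path set" where
  "paths_of_length E n =
     (if n = 0 then Vertex ` topspace (vtop E)
      else {Edges xs | xs. length xs = n \<and> set xs \<subseteq> topspace (etop E) \<and>
              (\<forall>i. Suc i < n \<longrightarrow> smap E (xs ! i) = rmap E (xs ! Suc i))})"

definition finite_paths :: "('v, 'e) tgraph \<Rightarrow> ('v, 'e) path set" where
  "finite_paths E = (\<Union>n. paths_of_length E n)"

definition infinite_paths :: "('v, 'e) tgraph \<Rightarrow> ('v, 'e) path set" where
  "infinite_paths E =
     {InfPath f | f. \<forall>i. f i \<in> topspace (etop E) \<and> smap E (f i) = rmap E (f (Suc i))}"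

text \<open>Concatenation; the case of an infinite first argument is never used. It is only meaningful
  when the source of the first path is the range of the second.\<close>

fun pconcat :: "('v, 'e) path \<Rightarrow> ('v, 'e) path \<Rightarrow> ('v, 'e) path" where
  "pconcat (Vertex v) p = p"
| "pconcat (Edges xs) (Vertex v) = Edges xs"
| "pconcat (Edges xs) (Edges ys) = Edges (xs @ ys)"
| "pconcat (Edges xs) (InfPath f) =
     InfPath (\<lambda>i. if i < length xs then xs ! i else f (i - length xs))"
| "pconcat (InfPath f) p = InfPath f"

text \<open>The initial segment consisting of the first \<open>n\<close> edges, for \<open>1 \<le> n \<le> plen p\<close>.\<close>

fun pprefix :: "nat \<Rightarrow> ('v, 'e) path \<Rightarrow> ('v, 'e) path" where
  "pprefix n (Vertex v) = Vertex v"
| "pprefix n (Edges xs) = Edges (take n xs)"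
| "pprefix n (InfPath f) = Edges (map f [0..<n])"


section \<open>Topologies on the path spaces\<close>

text \<open>For \<open>n \<ge> 1\<close>, a path of length \<open>n\<close> is identified with an element of the \<open>n\<close>-fold product of
  the edge space, which the library realises as extensional functions on \<open>{..<n}\<close>.\<close>

definition path_topology :: "('v, 'e) tgraph \<Rightarrow> nat \<Rightarrow> ('v, 'e) path topology" where
  "path_topology E n =
     (if n = 0 then pullback_topology (paths_of_length E 0) (rng E) (vtop E)
      else pullback_topology (paths_of_length E n)
             (\<lambda>p. case p of Edges xs \<Rightarrow> restrict (\<lambda>i. xs ! i) {..<n} | _ \<Rightarrow> undefined)
             (product_topology (\<lambda>_. etop E) {..<n}))"

text \<open>The disjoint union topology.\<close>

definition finite_path_topology :: "('v, 'e) tgraph \<Rightarrow> ('v, 'e) path topology" where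
  "finite_path_topology E =
     topology (\<lambda>U. U \<subseteq> finite_paths E \<and>
                   (\<forall>n. openin (path_topology E n) (U \<inter> paths_of_length E n)))"

lemma openin_finite_path_topology:
  "openin (finite_path_topology E) U \<longleftrightarrow>
     U \<subseteq> finite_paths E \<and> (\<forall>n. openin (path_topology E n) (U \<inter> paths_of_length E n))"
proof -
  have "istopology (\<lambda>U. U \<subseteq> finite_paths E \<and>
          (\<forall>n. openin (path_topology E n) (U \<inter> paths_of_length E n)))"
    unfolding istopology_def
  proof (intro conjI allI impI)
    fix S T n
    assume S: "S \<subseteq> finite_paths E \<and> (\<forall>n. openin (path_topology E n) (S \<inter> paths_of_length E n))"
      and T: "T \<subseteq> finite_paths E \<and> (\<forall>n. openin (path_topology E n) (T \<inter> paths_of_length E n))"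
    show "S \<inter> T \<subseteq> finite_paths E" using S by blast
    have "S \<inter> T \<inter> paths_of_length E n = (S \<inter> paths_of_length E n) \<inter> (T \<inter> paths_of_length E n)"
      by blast
    then show "openin (path_topology E n) (S \<inter> T \<inter> paths_of_length E n)"
      using S T by (simp add: openin_Int)
  next
    fix \<K> n
    assume K: "\<forall>K\<in>\<K>. K \<subseteq> finite_paths E \<and> (\<forall>n. openin (path_topology E n) (K \<inter> paths_of_length E n))"
    show "\<Union>\<K> \<subseteq> finite_paths E" using K by blast
    have "\<Union>\<K> \<inter> paths_of_length E n = (\<Union>K\<in>\<K>. K \<inter> paths_of_length E n)" by blast
    moreover have "openin (path_topology E n) (\<Union>K\<in>\<K>. K \<inter> paths_of_length E n)"
      using K by (intro openin_Union) blast
    ultimately show "openin (path_topology E n) (\<Union>\<K> \<inter> paths_of_length E n)"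
      by simp
  qed
  then show ?thesis
    by (simp add: finite_path_topology_def topology_inverse')
qed


section \<open>The boundary path space\<close>

definition boundary_paths :: "('v, 'e) tgraph \<Rightarrow> ('v, 'e) path set" where
  "boundary_paths E =
     {p \<in> finite_paths E. src E p \<in> singular_vertices E} \<union> infinite_paths E"

definition cylinder :: "('v, 'e) tgraph \<Rightarrow> ('v, 'e) path set \<Rightarrow> ('v, 'e) path set" where
  "cylinder E S =
     {p \<in> boundary_paths E.
        Vertex (rng E p) \<in> S \<or> (\<exists>n\<ge>1. enat n \<le> plen p \<and> pprefix n p \<in> S)}"

definition boundary_topology :: "('v, 'e) tgraph \<Rightarrow> ('v, 'e) path topology" where
  "boundary_topology E =
     topology_generated_by
       {cylinder E U - cylinder E K | U K.
          openin (finite_path_topology E) U \<and> compactin (finite_path_topology E) K}"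

text \<open>The shift map is meant for boundary paths of positive length; the value on vertices is
  irrelevant.\<close>

fun shift :: "('v, 'e) tgraph \<Rightarrow> ('v, 'e) path \<Rightarrow> ('v, 'e) path" where
  "shift E (Vertex v) = Vertex v"
| "shift E (Edges xs) = (if length xs = 1 then Vertex (smap E (hd xs)) else Edges (tl xs))"
| "shift E (InfPath f) = InfPath (\<lambda>i. f (Suc i))"


section \<open>Loops\<close>

definition is_loop :: "('v, 'e) tgraph \<Rightarrow> ('v, 'e) path \<Rightarrow> bool" where
  "is_loop E a \<longleftrightarrow> a \<in> finite_paths E \<and> plen a \<ge> 1 \<and> src E a = rng E a"

fun loop_power :: "('v, 'e) tgraph \<Rightarrow> ('v, 'e) path \<Rightarrow> nat \<Rightarrow> ('v, 'e) path" where
  "loop_power E a 0 = Vertex (rng E a)"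
| "loop_power E a (Suc n) = pconcat a (loop_power E a n)"

text \<open>The infinite path \<open>aaa\<dots>\<close>; only used for loops, which are of the form \<open>Edges xs\<close>.\<close>

fun loop_infinity :: "('v, 'e) path \<Rightarrow> ('v, 'e) path" where
  "loop_infinity (Edges xs) = InfPath (\<lambda>i. xs ! (i mod length xs))"
| "loop_infinity p = undefined"

text \<open>The paths ending at the base point of \<open>a\<close> that do not end with a full turn around \<open>a\<close>.\<close>

definition approach_paths :: "('v, 'e) tgraph \<Rightarrow> ('v, 'e) path \<Rightarrow> ('v, 'e) path set" where
  "approach_paths E a =
     {b \<in> finite_paths E. src E b = rng E a \<and>
        \<not> (\<exists>b'\<in>finite_paths E. src E b' = rng E a \<and> b = pconcat b' a)}"

definition summable_loop :: "('v, 'e) tgraph \<Rightarrow> ('v, 'e) path \<Rightarrow> bool" where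
  "summable_loop E a \<longleftrightarrow>
     is_loop E a \<and>
     (\<forall>c n. is_loop E c \<and> n \<ge> 2 \<longrightarrow> a \<noteq> loop_power E c n) \<and>
     (\<forall>w\<in>topspace (vtop E). \<exists>V. openin (vtop E) V \<and> w \<in> V \<and>
        finite {b \<in> approach_paths E a. rng E b \<in> V})"

definition loop_equiv :: "('v, 'e) tgraph \<Rightarrow> (('v, 'e) path \<times> ('v, 'e) path) set" where
  "loop_equiv E =
     {(a, b). is_loop E a \<and> is_loop E b \<and>
        (\<exists>xs k. a = Edges xs \<and> k \<le> length xs \<and> b = Edges (drop k xs @ take k xs))}"

definition eventually_cyclic :: "('v, 'e) tgraph \<Rightarrow> ('v, 'e) path set" where
  "eventually_cyclic E =
     {pconcat b (loop_infinity a) | a b. is_loop E a \<and> b \<in> finite_paths E \<and> src E b = rng E a}"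


section \<open>Measures on the boundary path space\<close>

definition borel_of :: "'a topology \<Rightarrow> 'a measure" where
  "borel_of X = sigma (topspace X) {U. openin X U}"

definition invariant_measure :: "('v, 'e) tgraph \<Rightarrow> ('v, 'e) path measure \<Rightarrow> bool" where
  "invariant_measure E \<nu> \<longleftrightarrow>
     sets \<nu> = sets (borel_of (boundary_topology E)) \<and>
     (\<forall>K. compactin (boundary_topology E) K \<longrightarrow> emeasure \<nu> K < \<infinity>) \<and>
     (\<forall>A\<in>sets \<nu>. A \<subseteq> boundary_paths E - paths_of_length E 0 \<and> inj_on (shift E) A \<longrightarrow>
        emeasure \<nu> (shift E ` A) = emeasure \<nu> A)"

definition extremal_measure :: "('v, 'e) tgraph \<Rightarrow> ('v, 'e) path measure \<Rightarrow> bool" where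
  "extremal_measure E \<nu> \<longleftrightarrow>
     invariant_measure E \<nu> \<and>
     (\<forall>\<nu>1 \<nu>2. invariant_measure E \<nu>1 \<and> invariant_measure E \<nu>2 \<and>
        (\<forall>A\<in>sets \<nu>. emeasure \<nu> A = emeasure \<nu>1 A + emeasure \<nu>2 A) \<longrightarrow>
        {\<nu>1, \<nu>2} \<subseteq> {scale_measure (ennreal c) \<nu> | c. c \<ge> 0})"

definition concentrated_on :: "'a measure \<Rightarrow> 'a set \<Rightarrow> bool" where
  "concentrated_on \<nu> B \<longleftrightarrow> B \<in> sets \<nu> \<and> emeasure \<nu> (space \<nu> - B) = 0"

definition harmonic_measure :: "('v, 'e) tgraph \<Rightarrow> ('v, 'e) path measure \<Rightarrow> bool" where
  "harmonic_measure E \<nu> \<longleftrightarrow> invariant_measure E \<nu> \<and> concentrated_on \<nu> (infinite_paths E)"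

definition measure_ray :: "'a measure \<Rightarrow> 'a measure set" where
  "measure_ray \<nu> = {scale_measure (ennreal c) \<nu> | c. c > 0}"

definition cyclic_extremal_rays :: "('v, 'e) tgraph \<Rightarrow> ('v, 'e) path measure set set" where
  "cyclic_extremal_rays E =
     {measure_ray \<nu> | \<nu>. emeasure \<nu> (space \<nu>) \<noteq> 0 \<and> extremal_measure E \<nu> \<and>
        harmonic_measure E \<nu> \<and> concentrated_on \<nu> (eventually_cyclic E)}"

text \<open>The sum over \<open>i \<in> I\<close> of the Dirac measures at \<open>x i\<close>, on the sigma-algebra of \<open>M\<close>; the
  index set may be infinite and repeated points are counted with multiplicity.\<close>

definition dirac_sum :: "'a measure \<Rightarrow> ('i \<Rightarrow> 'a) \<Rightarrow> 'i set \<Rightarrow> 'a measure" where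
  "dirac_sum M x I =
     measure_of (space M) (sets M) (\<lambda>A. \<Sum>\<^sub>\<infinity>i\<in>I. emeasure (return M (x i)) A)"

lemma emeasure_dirac_sum:
  assumes "A \<in> sets M"
  shows "emeasure (dirac_sum M x I) A = (\<Sum>\<^sub>\<infinity>i\<in>I. emeasure (return M (x i)) A)"
proof -
  define \<F> where "\<F> = {F. finite F \<and> F \<subseteq> I}"
  have inf: "(\<Sum>\<^sub>\<infinity>i\<in>I. f i) = (SUP F\<in>\<F>. sum f F)" for f :: "'b \<Rightarrow> ennreal"
    unfolding \<F>_def by (rule infsumI, rule nonneg_has_sum_complete) simp
  have "countably_additive (sets M) (\<lambda>A. \<Sum>\<^sub>\<infinity>i\<in>I. emeasure (return M (x i)) A)"
    unfolding countably_additive_def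
  proof (intro allI impI)
    fix B :: "nat \<Rightarrow> 'a set"
    assume B: "range B \<subseteq> sets M" "disjoint_family B"
    have "(\<Sum>n. \<Sum>\<^sub>\<infinity>i\<in>I. emeasure (return M (x i)) (B n)) =
          (\<Sum>n. SUP F\<in>\<F>. \<Sum>i\<in>F. emeasure (return M (x i)) (B n))"
      by (simp add: inf)
    also have "\<dots> = (SUP F\<in>\<F>. \<Sum>n. \<Sum>i\<in>F. emeasure (return M (x i)) (B n))"
    proof (rule ennreal_suminf_SUP_eq_directed)
      fix N F G assume "F \<in> \<F>" "G \<in> \<F>"
      then show "\<exists>H\<in>\<F>. \<forall>n\<in>N. (\<Sum>i\<in>F. emeasure (return M (x i)) (B n)) \<le> (\<Sum>i\<in>H. emeasure (return M (x i)) (B n)) \<and>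
                   (\<Sum>i\<in>G. emeasure (return M (x i)) (B n)) \<le> (\<Sum>i\<in>H. emeasure (return M (x i)) (B n))"
        by (intro bexI[of _ "F \<union> G"]) (auto simp: \<F>_def intro!: sum_mono2)
    qed
    also have "\<dots> = (SUP F\<in>\<F>. \<Sum>i\<in>F. \<Sum>n. emeasure (return M (x i)) (B n))"
      by (intro SUP_cong refl suminf_sum) auto
    also have "\<dots> = (SUP F\<in>\<F>. \<Sum>i\<in>F. emeasure (return M (x i)) (\<Union>n. B n))"
      using B by (intro SUP_cong refl sum.cong suminf_emeasure) auto
    finally show "(\<Sum>n. \<Sum>\<^sub>\<infinity>i\<in>I. emeasure (return M (x i)) (B n)) =
                  (\<Sum>\<^sub>\<infinity>i\<in>I. emeasure (return M (x i)) (\<Union>n. B n))"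
      by (simp add: inf)
  qed
  moreover have "sets (dirac_sum M x I) = sets M"
    by (simp add: dirac_sum_def)
  ultimately show ?thesis
    by (intro emeasure_measure_of[OF dirac_sum_def])
       (auto simp: assms positive_def sets.space_closed)
qed

definition loop_measure :: "('v, 'e) tgraph \<Rightarrow> ('v, 'e) path \<Rightarrow> ('v, 'e) path measure" where
  "loop_measure E a =
     dirac_sum (borel_of (boundary_topology E)) (\<lambda>b. pconcat b (loop_infinity a)) (approach_paths E a)"

end

theory Submission
  imports Defs
begin

text \<open>For a loop \<open>\<alpha>\<close> without proper root, \<open>\<beta> \<mapsto> \<beta>\<alpha>\<^sup>\<infinity>\<close> maps \<open>E\<^sub>\<alpha>\<^sup>*\<close> bijectively onto the
  countable shift orbit \<open>O\<^sub>\<alpha>\<close> of \<open>\<alpha>\<^sup>\<infinity>\<close>, so \<open>\<nu>\<close> is the counting measure of \<open>O\<^sub>\<alpha>\<close>. An invariant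
  measure concentrated on \<open>O\<^sub>\<alpha>\<close> is constant on points, hence a multiple of \<open>\<nu>\<close>; this gives
  extremality. Conversely, an extremal measure satisfies a zero-one law for shift-invariant Borel
  sets. Applying it to the saturations of the periodic points in the members of a countable
  point-separating family shows that an extremal measure concentrated on the eventually cyclic
  paths lives on one orbit \<open>O\<^sub>\<alpha>\<close>. Summability of \<open>\<alpha>\<close> is finiteness on compact sets, because the
  boundary paths with range in a compact set of vertices form a compact set. The shift maps Borel
  sets to Borel sets since the Borel sets are generated by the coordinates.\<close>

section \<open>Ultrafilters and compactness\<close>

text \<open>A topological graph may have uncountably many loops, so an extremal measure on the
  eventually cyclic paths could a priori give measure zero to every single orbit, and summing over
  orbits says nothing. Hence the detour through countably many invariant sets: once their null parts
  are discarded, two surviving paths must end in the same cycle, since a member of the family that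
  meets one cycle but not the other would have a saturation containing one path and not the other.
  The second obstacle is the topology. A boundary path that ends can be a limit of longer paths
  whose next edges leave every compact set, so having no edge at a given index is a Borel condition
  but in general not an open one, and no countable base can be read off from the sets
  \<open>cylinder E U - cylinder E K\<close>. For measurability it is enough to refine the open sets
  by countably many Borel sets. Compactness is treated with ultrafilters because they decide, index
  by index, whether the edges converge.\<close>

definition ultra :: "'a filter \<Rightarrow> bool" where
  "ultra F \<longleftrightarrow> F \<noteq> bot \<and> (\<forall>P. eventually P F \<or> eventually (\<lambda>x. \<not> P x) F)"

lemma ultra_not_eventually: "ultra F \<Longrightarrow> \<not> eventually P F \<longleftrightarrow> eventually (\<lambda>x. \<not> P x) F"
  unfolding ultra_def using eventually_conj[of P F "\<lambda>x. \<not> P x"]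
  by (auto simp: trivial_limit_def)

text \<open>Used to fix one length: an ultrafilter cannot spread over the finitely many lengths that
  occur in a compact set of finite paths.\<close>

lemma ultra_disj_finite:
  assumes "ultra F" "finite I" "eventually (\<lambda>x. \<exists>i\<in>I. P i x) F"
  shows "\<exists>i\<in>I. eventually (P i) F"
proof (rule ccontr)
  assume "\<not> ?thesis"
  then have "\<forall>i\<in>I. eventually (\<lambda>x. \<not> P i x) F"
    using ultra_not_eventually[OF assms(1)] by blast
  then have "eventually (\<lambda>x. \<forall>i\<in>I. \<not> P i x) F"
    using assms(2) by (simp add: eventually_ball_finite)
  then have "eventually (\<lambda>x. \<not> (\<exists>i\<in>I. P i x)) F"
    by simp
  with assms(3) ultra_not_eventually[OF assms(1)] show False
    by blast
qed

text \<open>Zorn's lemma for the proper filters below \<open>F\<close>, ordered downwards. The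
  infimum of a nonempty chain is proper because the chain is directed, so an event holds eventually
  along the infimum only if it does along some member.\<close>

lemma ultra_exists:
  assumes "F \<noteq> bot"
  shows "\<exists>G\<le>F. ultra G"
proof -
  define A where "A = {G. G \<le> F \<and> G \<noteq> bot}"
  have "\<exists>m\<in>A. \<forall>a\<in>A. m \<ge> a \<longrightarrow> a = m"
  proof (rule predicate_Zorn)
    show "partial_order_on A (relation_of (\<ge>) A)"
      by (rule partial_order_on_relation_ofI) auto
  next
    fix C assume C: "C \<in> Chains (relation_of (\<ge>) A)"
    have CA: "C \<subseteq> A" and tot: "\<And>a b. a \<in> C \<Longrightarrow> b \<in> C \<Longrightarrow> a \<le> b \<or> b \<le> a"
      using C by (auto simp: Chains_def relation_of_def)
    show "\<exists>u\<in>A. \<forall>a\<in>C. a \<ge> u"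
    proof (cases "C = {}")
      case True
      then show ?thesis using assms by (auto simp: A_def)
    next
      case False
      have directed: "\<exists>x\<in>C. x \<le> inf a b" if "a \<in> C" "b \<in> C" for a b
        using tot[OF that] that by (meson inf.boundedI order_refl)
      have "Inf C \<noteq> bot"
      proof
        assume "Inf C = bot"
        then have "eventually (\<lambda>_. False) (Inf C)" by simp
        then obtain b where "b \<in> C" "eventually (\<lambda>_. False) b"
          using eventually_Inf_base[OF False directed, of "\<lambda>_. False"] by auto
        then show False using CA by (auto simp: A_def trivial_limit_def)
      qed
      moreover have "Inf C \<le> F"
      proof -
        obtain c where "c \<in> C" using False by blast
        then show ?thesis using CA by (auto simp: A_def intro: Inf_lower2)
      qed
      ultimately have "Inf C \<in> A" by (simp add: A_def)
      then show ?thesis by (auto intro!: bexI[of _ "Inf C"] Inf_lower)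
    qed
  qed
  then obtain G where G: "G \<le> F" "G \<noteq> bot" and max: "\<And>H. H \<le> G \<Longrightarrow> H \<noteq> bot \<Longrightarrow> H = G"
    unfolding A_def by (auto intro: order_trans)
  \<comment> \<open>Minimality of \<open>G\<close> leaves two options for its trace on the event
    \<open>P\<close>: the trace is improper, or it is all of \<open>G\<close>.\<close>
  have "eventually P G \<or> eventually (\<lambda>x. \<not> P x) G" for P
  proof (cases "inf G (principal {x. P x}) = bot")
    case True
    then have "eventually (\<lambda>_. False) (inf G (principal {x. P x}))" by simp
    then show ?thesis by (simp add: eventually_inf_principal)
  next
    case False
    then have "inf G (principal {x. P x}) = G" by (intro max) auto
    then have "G \<le> principal {x. P x}" by (metis inf_le2)
    then show ?thesis by (simp add: le_principal)
  qed
  with G show ?thesis by (auto simp: ultra_def)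
qed

text \<open>Otherwise every point of \<open>K\<close> has an open neighbourhood that
  \<open>f\<close> eventually avoids, because the ultrafilter decides, and finitely many of these
  neighbourhoods cover \<open>K\<close>.\<close>

lemma compactin_ultra_limit:
  assumes "compactin X K" "ultra F" "eventually (\<lambda>x. f x \<in> K) F"
  shows "\<exists>l\<in>K. limitin X f l F"
proof (rule ccontr)
  assume no: "\<not> ?thesis"
  have "\<exists>U. openin X U \<and> l \<in> U \<and> eventually (\<lambda>x. f x \<notin> U) F" if "l \<in> K" for l
  proof -
    have "l \<in> topspace X" using that assms(1) compactin_subset_topspace by blast
    with no that obtain U where "openin X U" "l \<in> U" "\<not> eventually (\<lambda>x. f x \<in> U) F"
      by (auto simp: limitin_def)
    then show ?thesis using ultra_not_eventually[OF assms(2)] by blast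
  qed
  then obtain U where U: "\<And>l. l \<in> K \<Longrightarrow> openin X (U l) \<and> l \<in> U l \<and> eventually (\<lambda>x. f x \<notin> U l) F"
    by metis
  then have "Ball (U ` K) (openin X)" "K \<subseteq> \<Union>(U ` K)" by auto
  then obtain \<F> where F: "finite \<F>" "\<F> \<subseteq> U ` K" "K \<subseteq> \<Union>\<F>"
    using assms(1) unfolding compactin_def by blast
  have "eventually (\<lambda>x. \<forall>W\<in>\<F>. f x \<notin> W) F"
    using F U by (intro eventually_ball_finite) auto
  with assms(3) have "eventually (\<lambda>_. False) F"
    by eventually_elim (use F in blast)
  then show False using assms(2) by (simp add: ultra_def trivial_limit_def)
qed

lemma compactin_if_ultra_limits:
  assumes "K \<subseteq> topspace X"
    and lim: "\<And>F. ultra F \<Longrightarrow> eventually (\<lambda>x. x \<in> K) F \<Longrightarrow> \<exists>l\<in>K. limitin X (\<lambda>x. x) l F"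
  shows "compactin X K"
  unfolding compactin_def
proof (intro conjI allI impI)
  show "K \<subseteq> topspace X" by fact
  fix \<U> assume U: "Ball \<U> (openin X) \<and> K \<subseteq> \<Union>\<U>"
  show "\<exists>\<F>. finite \<F> \<and> \<F> \<subseteq> \<U> \<and> K \<subseteq> \<Union>\<F>"
  proof (rule ccontr)
    assume no: "\<nexists>\<F>. finite \<F> \<and> \<F> \<subseteq> \<U> \<and> K \<subseteq> \<Union>\<F>"
    \<comment> \<open>The complements in \<open>K\<close> of finite unions from the cover form a
      filter base. Without a finite subcover none of them is empty, and an ultrafilter below them
      avoids every member of the cover.\<close>
    define B where "B = (\<lambda>\<V>. principal (K - \<Union>\<V>)) ` {\<V>. finite \<V> \<and> \<V> \<subseteq> \<U>}"
    have ev: "eventually P (Inf B) \<longleftrightarrow> (\<exists>b\<in>B. eventually P b)" for P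
    proof (rule eventually_Inf_base)
      show "B \<noteq> {}" by (auto simp: B_def)
      fix F G assume "F \<in> B" "G \<in> B"
      then obtain \<V> \<W> where "finite \<V>" "\<V> \<subseteq> \<U>" "F = principal (K - \<Union>\<V>)"
        "finite \<W>" "\<W> \<subseteq> \<U>" "G = principal (K - \<Union>\<W>)" by (auto simp: B_def)
      then show "\<exists>x\<in>B. x \<le> inf F G"
        by (intro bexI[of _ "principal (K - \<Union>(\<V> \<union> \<W>))"])
          (auto simp: B_def simp del: Union_Un_distrib intro!: imageI)
    qed
    have "Inf B \<noteq> bot"
    proof
      assume "Inf B = bot"
      then obtain b where b: "b \<in> B" "eventually (\<lambda>_. False) b" using ev[of "\<lambda>_. False"] by auto
      then obtain \<V> where \<V>: "finite \<V>" "\<V> \<subseteq> \<U>" and "b = principal (K - \<Union>\<V>)"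
        by (auto simp: B_def)
      then have "K \<subseteq> \<Union>\<V>" using b(2) by (auto simp: eventually_principal)
      with \<V> no show False by blast
    qed
    then obtain G where G: "G \<le> Inf B" "ultra G" using ultra_exists by blast
    have *: "eventually (\<lambda>x. x \<in> K - \<Union>\<V>) G" if "finite \<V>" "\<V> \<subseteq> \<U>" for \<V>
    proof (rule filter_leD[OF G(1)])
      show "eventually (\<lambda>x. x \<in> K - \<Union>\<V>) (Inf B)"
        unfolding ev using that
        by (intro bexI[of _ "principal (K - \<Union>\<V>)"]) (auto simp: B_def eventually_principal)
    qed
    have "eventually (\<lambda>x. x \<in> K) G" using *[of "{}"] by simp
    then obtain l where l: "l \<in> K" "limitin X (\<lambda>x. x) l G" using lim G(2) by blast
    then obtain W where W: "W \<in> \<U>" "l \<in> W" using U by blast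
    then have "eventually (\<lambda>x. x \<in> W) G" using l U by (auto simp: limitin_def)
    moreover have "eventually (\<lambda>x. x \<in> K - \<Union>{W}) G" using W by (intro *) auto
    ultimately have "eventually (\<lambda>_. False) G" by eventually_elim auto
    then show False using G(2) by (simp add: ultra_def trivial_limit_def)
  qed
qed

section \<open>Loops and periodic paths\<close>

fun pedge :: "nat \<Rightarrow> ('v, 'e) path \<Rightarrow> 'e" where
  "pedge i (Edges xs) = xs ! i"
| "pedge i (InfPath f) = f i"
| "pedge i (Vertex v) = undefined"

text \<open>\<open>pprefix 0\<close> returns the junk value \<open>Edges []\<close> on paths of positive length; here the initial
  segment of length 0 is the range.\<close>

definition trunc :: "('v, 'e) tgraph \<Rightarrow> nat \<Rightarrow> ('v, 'e) path \<Rightarrow> ('v, 'e) path" where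
  "trunc E n p = (if n = 0 then Vertex (rng E p) else pprefix n p)"

definition all_paths :: "('v, 'e) tgraph \<Rightarrow> ('v, 'e) path set" where
  "all_paths E = finite_paths E \<union> infinite_paths E"

text \<open>The two offsets are independent: this is tail equivalence with lag, the orbit
  equivalence relation of the shift.\<close>

definition seq_orbit :: "('v, 'e) tgraph \<Rightarrow> (nat \<Rightarrow> 'e) \<Rightarrow> ('v, 'e) path set" where
  "seq_orbit E f = {InfPath g | g. InfPath g \<in> infinite_paths E \<and> (\<exists>m k. \<forall>i. g (i + m) = f (i + k))}"

lemma boundary_subset_all_paths: "boundary_paths E \<subseteq> all_paths E"
  by (auto simp: boundary_paths_def all_paths_def)

lemma infinite_subset_boundary: "infinite_paths E \<subseteq> boundary_paths E"
  by (auto simp: boundary_paths_def)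

lemma InfPath_in_infinite_paths:
  "InfPath f \<in> infinite_paths E \<longleftrightarrow>
     (\<forall>i. f i \<in> topspace (etop E) \<and> smap E (f i) = rmap E (f (Suc i)))"
  by (auto simp: infinite_paths_def)

lemma infinite_pathsE:
  assumes "p \<in> infinite_paths E"
  obtains f where "p = InfPath f" "\<And>i. f i \<in> topspace (etop E)" "\<And>i. smap E (f i) = rmap E (f (Suc i))"
  using assms by (auto simp: infinite_paths_def)

lemma Vertex_in_finite_paths: "Vertex v \<in> finite_paths E \<longleftrightarrow> v \<in> topspace (vtop E)"
  by (auto simp: finite_paths_def paths_of_length_def split: if_splits)

lemma Edges_in_paths_of_length:
  "Edges xs \<in> paths_of_length E n \<longleftrightarrow> n \<noteq> 0 \<and> length xs = n \<and> set xs \<subseteq> topspace (etop E) \<and>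
     (\<forall>i. Suc i < n \<longrightarrow> smap E (xs ! i) = rmap E (xs ! Suc i))"
  by (auto simp: paths_of_length_def)

lemma Edges_in_finite_paths:
  "Edges xs \<in> finite_paths E \<longleftrightarrow> xs \<noteq> [] \<and> set xs \<subseteq> topspace (etop E) \<and>
     (\<forall>i. Suc i < length xs \<longrightarrow> smap E (xs ! i) = rmap E (xs ! Suc i))"
  by (auto simp: finite_paths_def Edges_in_paths_of_length)

lemma InfPath_notin_finite_paths [simp]: "InfPath f \<notin> finite_paths E"
  by (auto simp: finite_paths_def paths_of_length_def split: if_splits)

lemma Vertex_notin_infinite_paths [simp]: "Vertex v \<notin> infinite_paths E"
  and Edges_notin_infinite_paths [simp]: "Edges xs \<notin> infinite_paths E"
  by (auto simp: infinite_paths_def)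

lemma plen_paths_of_length: "p \<in> paths_of_length E n \<Longrightarrow> plen p = enat n"
  by (auto simp: paths_of_length_def zero_enat_def split: if_splits)

lemma paths_of_length_disjoint:
  "p \<in> paths_of_length E n \<Longrightarrow> p \<in> paths_of_length E m \<Longrightarrow> n = m"
  by (metis plen_paths_of_length enat.inject)

lemma infinite_iff_plen: "p \<in> all_paths E \<Longrightarrow> p \<in> infinite_paths E \<longleftrightarrow> plen p = \<infinity>"
  by (cases p) (auto simp: all_paths_def infinite_paths_def)

lemma pedge_in_topspace:
  assumes "p \<in> all_paths E" "enat i < plen p"
  shows "pedge i p \<in> topspace (etop E)"
  using assms by (cases p) (auto simp: all_paths_def Edges_in_finite_paths InfPath_in_infinite_paths zero_enat_def)

lemma smap_pedge:
  assumes "p \<in> all_paths E" "enat (Suc i) < plen p"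
  shows "smap E (pedge i p) = rmap E (pedge (Suc i) p)"
  using assms by (cases p) (auto simp: all_paths_def Edges_in_finite_paths InfPath_in_infinite_paths zero_enat_def)

lemma rng_eq_rmap_pedge: "p \<in> all_paths E \<Longrightarrow> 0 < plen p \<Longrightarrow> rng E p = rmap E (pedge 0 p)"
  by (cases p) (auto simp: all_paths_def Edges_in_finite_paths hd_conv_nth)

lemma pedge_trunc: "enat n \<le> plen p \<Longrightarrow> i < n \<Longrightarrow> pedge i (trunc E n p) = pedge i p"
  by (cases p) (auto simp: trunc_def zero_enat_def)

text \<open>With \<open>trunc\<close>, the vertex clause of a cylinder becomes the case
  \<open>n = 0\<close>, so that membership is one statement about initial segments.\<close>

lemma cylinder_eq: "cylinder E S = {p \<in> boundary_paths E. \<exists>n. enat n \<le> plen p \<and> trunc E n p \<in> S}"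
proof -
  have "(Vertex (rng E p) \<in> S \<or> (\<exists>n\<ge>1. enat n \<le> plen p \<and> pprefix n p \<in> S)) \<longleftrightarrow>
    (\<exists>n. enat n \<le> plen p \<and> trunc E n p \<in> S)" (is "?L \<longleftrightarrow> ?R") for p
  proof
    assume ?L then show ?R
      by (metis trunc_def zero_enat_def zero_le not_one_le_zero)
  next
    assume ?R then show ?L
      by (metis trunc_def One_nat_def Suc_leI neq0_conv)
  qed
  then show ?thesis by (simp add: cylinder_def)
qed

lemma paths_of_length_eqI:
  assumes "p \<in> paths_of_length E n" "q \<in> paths_of_length E n" "n \<noteq> 0"
    "\<And>i. i < n \<Longrightarrow> pedge i p = pedge i q"
  shows "p = q"
  using assms by (auto simp: paths_of_length_def intro: nth_equalityI)

lemma paths_of_length_0_eqI: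
  assumes "p \<in> paths_of_length E 0" "q \<in> paths_of_length E 0" "rng E p = rng E q"
  shows "p = q"
  using assms by (auto simp: paths_of_length_def)

section \<open>Loops, powers of loops and periods\<close>

lemma is_loop_cases:
  assumes "is_loop E a"
  obtains xs where "a = Edges xs" "xs \<noteq> []"
  using assms by (cases a) (auto simp: is_loop_def Edges_in_finite_paths)

text \<open>Index arithmetic modulo the length absorbs the closing condition: the passage from the
  last edge back to the first is one more instance of composability.\<close>

lemma is_loop_Edges:
  "is_loop E (Edges xs) \<longleftrightarrow> xs \<noteq> [] \<and> set xs \<subseteq> topspace (etop E) \<and>
     (\<forall>i. smap E (xs ! (i mod length xs)) = rmap E (xs ! (Suc i mod length xs)))"
proof (cases "xs = []")
  case True
  then show ?thesis by (simp add: is_loop_def Edges_in_finite_paths)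
next
  case False
  let ?n = "length xs"
  have n: "?n > 0" using False by simp
  have "(\<forall>i. Suc i < ?n \<longrightarrow> smap E (xs ! i) = rmap E (xs ! Suc i)) \<and> smap E (last xs) = rmap E (hd xs) \<longleftrightarrow>
     (\<forall>i. smap E (xs ! (i mod ?n)) = rmap E (xs ! (Suc i mod ?n)))" (is "?L \<longleftrightarrow> ?R")
  proof
    assume L: ?L
    show ?R
    proof
      fix i
      have "i mod ?n < ?n" using n by simp
      then consider "Suc (i mod ?n) < ?n" | "Suc (i mod ?n) = ?n" by linarith
      then show "smap E (xs ! (i mod ?n)) = rmap E (xs ! (Suc i mod ?n))"
      proof cases
        case 1
        then have "Suc i mod ?n = Suc (i mod ?n)" by (simp add: mod_Suc)
        then show ?thesis using L 1 by simp
      next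
        case 2
        then have "Suc i mod ?n = 0" "i mod ?n = ?n - 1" by (simp_all add: mod_Suc)
        then show ?thesis using L False by (simp add: last_conv_nth hd_conv_nth)
      qed
    qed
  next
    assume R: ?R
    have "smap E (xs ! i) = rmap E (xs ! Suc i)" if "Suc i < ?n" for i
      using R[rule_format, of i] that by simp
    moreover have "smap E (last xs) = rmap E (hd xs)"
      using R[rule_format, of "?n - 1"] False n by (simp add: last_conv_nth hd_conv_nth)
    ultimately show ?L by blast
  qed
  then show ?thesis using False
    by (auto simp: is_loop_def Edges_in_finite_paths one_enat_def Suc_le_eq)
qed

lemma loop_infinity_in_infinite_paths:
  assumes "is_loop E a"
  shows "loop_infinity a \<in> infinite_paths E"
proof -
  obtain xs where a: "a = Edges xs" "xs \<noteq> []" using assms is_loop_cases by blast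
  then show ?thesis using assms
    by (auto simp: is_loop_Edges InfPath_in_infinite_paths subset_iff)
qed

lemma nth_concat_replicate:
  assumes "i < k * length ys"
  shows "concat (replicate k ys) ! i = ys ! (i mod length ys)"
  using assms
proof (induction k arbitrary: i)
  case (Suc k)
  then show ?case
    by (cases "i < length ys") (auto simp: nth_append le_mod_geq)
qed simp

lemma loop_power_Edges:
  "n \<ge> 1 \<Longrightarrow> loop_power E (Edges ys) n = Edges (concat (replicate n ys))"
proof (induction n)
  case (Suc n)
  then show ?case by (cases n) auto
qed simp

lemma periodic_mult:
  fixes f :: "nat \<Rightarrow> 'a"
  assumes "\<And>i. f (i + p) = f i"
  shows "f (i + k * p) = f i"
proof (induction k)
  case (Suc k)
  have "f (i + Suc k * p) = f ((i + k * p) + p)" by (simp add: algebra_simps)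
  then show ?case using assms Suc by simp
qed simp

lemma periodic_mod:
  fixes f :: "nat \<Rightarrow> 'a"
  assumes "\<And>i. f (i + p) = f i"
  shows "f (i mod p) = f i"
  using periodic_mult[of f p "i mod p" "i div p"] assms by simp

text \<open>The sequence of the repeated loop has the periods \<open>m\<close> and
  \<open>length xs\<close>, hence also their gcd. Were the gcd a proper divisor of
  \<open>length xs\<close>, the loop would be a proper power of its initial segment of that
  length.\<close>

lemma primitive_period_dvd:
  assumes loop: "is_loop E (Edges xs)"
    and prim: "\<forall>c n. is_loop E c \<and> n \<ge> 2 \<longrightarrow> Edges xs \<noteq> loop_power E c n"
    and per: "\<And>i. xs ! ((i + m) mod length xs) = xs ! (i mod length xs)"
  shows "length xs dvd m"
proof (cases "m = 0")
  case False
  define n where "n = length xs"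
  define f where "f i = xs ! (i mod n)" for i
  define d where "d = gcd m n"
  have n: "n > 0" using loop by (auto simp: is_loop_Edges n_def)
  have fm: "f (i + m) = f i" for i using per by (simp add: f_def n_def)
  have fn: "f (i + n) = f i" for i by (simp add: f_def)
  have d: "d > 0" "d dvd n" using n by (simp_all add: d_def)
  \<comment> \<open>Bezout over the naturals: \<open>x\<close> steps of size \<open>m\<close> equal
    \<open>y\<close> steps of size \<open>n\<close> and one of size \<open>d\<close>. It requires a
    non-zero \<open>m\<close>, whence the outer case distinction.\<close>
  obtain x y where xy: "m * x = n * y + d" using bezout_nat[OF False, of n] by (auto simp: d_def)
  have fd: "f (i + d) = f i" for i
  proof -
    have "f (i + d) = f (i + d + y * n)" using periodic_mult[of f n, OF fn] by simp
    also have "i + d + y * n = i + x * m" using xy by (simp add: algebra_simps)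
    also have "f \<dots> = f i" using periodic_mult[of f m, OF fm] by simp
    finally show ?thesis .
  qed
  obtain k where k: "n = k * d" using d by (metis dvd_def mult.commute)
  have "k = 1"
  proof (rule ccontr)
    assume "k \<noteq> 1"
    moreover have "k \<noteq> 0" using k n by auto
    ultimately have k2: "k \<ge> 2" by simp
    define ys where "ys = take d xs"
    have dn: "d \<le> n" using d n by (simp add: dvd_imp_le)
    have len: "length ys = d" using dn by (simp add: ys_def n_def)
    have ys: "ys ! (i mod d) = f i" for i
    proof -
      have "i mod d < d" using d by simp
      then have "ys ! (i mod d) = f (i mod d)" using dn by (simp add: ys_def f_def)
      then show ?thesis using periodic_mod[of f d, OF fd] by simp
    qed
    have "is_loop E (Edges ys)"
      unfolding is_loop_Edges len ys
      using loop set_take_subset[of d xs] len d(1) by (auto simp: is_loop_Edges f_def n_def ys_def)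
    moreover have "xs = concat (replicate k ys)"
    proof (rule nth_equalityI)
      show *: "length xs = length (concat (replicate k ys))"
        using k by (simp add: len length_concat sum_list_replicate n_def)
      fix i assume "i < length xs"
      then show "xs ! i = concat (replicate k ys) ! i"
        using ys k by (simp add: nth_concat_replicate len f_def n_def)
    qed
    ultimately show False using prim k2 by (metis loop_power_Edges One_nat_def Suc_1 Suc_leD)
  qed
  then show ?thesis using k by (metis d_def gcd_dvd1 mult_1 n_def)
qed simp

text \<open>An offset into a periodic \<open>f\<close> can be removed by moving the cut in
  \<open>g\<close> further to the right.\<close>

lemma seq_orbit_loop_iff:
  assumes "\<And>i. f (i + n) = f i" "n > 0"
  shows "InfPath g \<in> seq_orbit E f \<longleftrightarrow> InfPath g \<in> infinite_paths E \<and> (\<exists>m. \<forall>i. g (i + m) = f i)"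
proof -
  have "\<exists>m. \<forall>i. g (i + m) = f i" if mk: "\<forall>i. g (i + m) = f (i + k)" for m k
  proof -
    \<comment> \<open>Going on for \<open>k * (n - 1)\<close> steps completes the offset
      \<open>k\<close> to \<open>k\<close> full periods.\<close>
    have "g (i + (k * (n - 1) + m)) = f i" for i
    proof -
      have "g (i + (k * (n - 1) + m)) = f (i + k * (n - 1) + k)"
        using mk by (metis add.assoc)
      also have "i + k * (n - 1) + k = i + k * n" using assms(2) by (cases n) auto
      finally show ?thesis using periodic_mult[of f n, OF assms(1)] by simp
    qed
    then show ?thesis by blast
  qed
  moreover have "\<exists>m k. \<forall>i. g (i + m) = f (i + k)" if "\<forall>i. g (i + m) = f i" for m
    using that by (metis add.right_neutral)
  ultimately show ?thesis
    unfolding seq_orbit_def by blast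
qed

section \<open>Paths that end in a loop, and the orbit of the loop\<close>

lemma trunc_InfPath:
  "trunc E m (InfPath g) = (if m = 0 then Vertex (rmap E (g 0)) else Edges (map g [0..<m]))"
  by (simp add: trunc_def)

lemma trunc_InfPath_in_finite_paths:
  assumes "InfPath g \<in> infinite_paths E" "rmap E (g 0) \<in> topspace (vtop E)"
  shows "trunc E m (InfPath g) \<in> finite_paths E"
  using assms
  by (auto simp: trunc_InfPath Vertex_in_finite_paths Edges_in_finite_paths InfPath_in_infinite_paths)

lemma src_trunc_InfPath:
  assumes "InfPath g \<in> infinite_paths E"
  shows "src E (trunc E m (InfPath g)) = rmap E (g m)"
  using assms by (cases m) (auto simp: trunc_InfPath InfPath_in_infinite_paths)

lemma pconcat_trunc_InfPath:
  assumes "\<And>i. g (i + m) = h i"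
  shows "pconcat (trunc E m (InfPath g)) (InfPath h) = InfPath g"
proof -
  have "h (i - m) = g i" if "\<not> i < m" for i using assms[of "i - m"] that by simp
  moreover have "h = g" if "m = 0" using assms that by (simp add: fun_eq_iff)
  ultimately show ?thesis by (auto simp: trunc_InfPath)
qed

lemma pconcat_InfPath_in_infinite_paths:
  assumes f: "InfPath f \<in> infinite_paths E"
    and b: "b \<in> finite_paths E" "src E b = rmap E (f 0)"
  shows "pconcat b (InfPath f) \<in> infinite_paths E"
proof (cases b)
  case (Vertex v)
  then show ?thesis using f by simp
next
  case (Edges ys)
  let ?g = "\<lambda>i. if i < length ys then ys ! i else f (i - length ys)"
  have ys: "ys \<noteq> []" "set ys \<subseteq> topspace (etop E)" "smap E (last ys) = rmap E (f 0)"
    "\<And>i. Suc i < length ys \<Longrightarrow> smap E (ys ! i) = rmap E (ys ! Suc i)"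
    using b Edges by (auto simp: Edges_in_finite_paths)
  have "?g i \<in> topspace (etop E) \<and> smap E (?g i) = rmap E (?g (Suc i))" for i
  proof (cases "Suc i" "length ys" rule: linorder_cases)
    case less then show ?thesis using ys by auto
  next
    case equal
    then have "ys ! i = last ys" using ys by (simp add: last_conv_nth flip: equal)
    then show ?thesis using ys equal by auto
  next
    case greater
    then have "Suc i - length ys = Suc (i - length ys)" by simp
    then show ?thesis using greater f by (simp add: InfPath_in_infinite_paths)
  qed
  then show ?thesis using Edges by (simp add: InfPath_in_infinite_paths)
next
  case (InfPath h)
  then show ?thesis using b by simp
qed

text \<open>Surjectivity: cut a path of the orbit at the first place after which it runs along the
  repeated loop. Injectivity: if two cuts of the same path differ, the difference of the lengths is
  a period, by primitivity a multiple of the loop length, and the longer segment ends with a full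
  turn, which \<open>approach_paths\<close> forbids.\<close>

lemma bij_betw_approach_paths:
  assumes loop: "is_loop E (Edges xs)"
    and prim: "\<forall>c n. is_loop E c \<and> n \<ge> 2 \<longrightarrow> Edges xs \<noteq> loop_power E c n"
    and edge_base: "\<And>e. e \<in> topspace (etop E) \<Longrightarrow> rmap E e \<in> topspace (vtop E)"
  defines "f \<equiv> \<lambda>i. xs ! (i mod length xs)"
  shows "bij_betw (\<lambda>b. pconcat b (InfPath f)) (approach_paths E (Edges xs)) (seq_orbit E f)"
proof -
  define n where "n = length xs"
  let ?a = "Edges xs :: ('a, 'b) path"
  have n: "n > 0" using loop by (auto simp: is_loop_Edges n_def)
  have fn: "f (i + n) = f i" for i by (simp add: f_def n_def)
  have fxs: "f i = xs ! i" if "i < n" for i using that by (simp add: f_def n_def)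
  have orb: "InfPath g \<in> seq_orbit E f \<longleftrightarrow> InfPath g \<in> infinite_paths E \<and> (\<exists>m. \<forall>i. g (i + m) = f i)" for g
    by (rule seq_orbit_loop_iff[of f n, OF fn n])
  have finf: "InfPath f \<in> infinite_paths E"
    using loop_infinity_in_infinite_paths[OF loop] by (simp add: f_def)
  have rng: "rng E ?a = rmap E (f 0)" using n by (simp add: fxs hd_conv_nth n_def)
  have base: "rng E ?a \<in> topspace (vtop E)"
    unfolding rng using edge_base finf by (simp add: InfPath_in_infinite_paths)
  have shape: "\<exists>ys. (b = Vertex (rng E ?a) \<and> ys = [] \<or> b = Edges ys \<and> ys \<noteq> []) \<and>
      pconcat b (InfPath f) = InfPath (\<lambda>i. if i < length ys then ys ! i else f (i - length ys))"
    if "b \<in> approach_paths E ?a" for b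
    using that by (cases b) (auto simp: approach_paths_def Edges_in_finite_paths)
  have into: "pconcat b (InfPath f) \<in> seq_orbit E f" if b: "b \<in> approach_paths E ?a" for b
  proof -
    have "pconcat b (InfPath f) \<in> infinite_paths E"
      using b rng by (intro pconcat_InfPath_in_infinite_paths finf) (auto simp: approach_paths_def)
    moreover obtain ys where "pconcat b (InfPath f) = InfPath (\<lambda>i. if i < length ys then ys ! i else f (i - length ys))"
      using shape[OF b] by blast
    ultimately show ?thesis
      by (auto simp: orb intro: exI[of _ "length ys"])
  qed
  have onto: "\<exists>b\<in>approach_paths E ?a. pconcat b (InfPath f) = p" if p: "p \<in> seq_orbit E f" for p
  proof -
    obtain g where g: "p = InfPath g" using p by (auto simp: seq_orbit_def)
    with p orb have ginf: "InfPath g \<in> infinite_paths E" and ex: "\<exists>m. \<forall>i. g (i + m) = f i" by auto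
    \<comment> \<open>Taking the least cut position is what keeps the initial segment from ending
      with a turn around the loop.\<close>
    define m where "m = (LEAST m. \<forall>i. g (i + m) = f i)"
    have m: "g (i + m) = f i" for i
      using LeastI_ex[OF ex] by (simp add: m_def)
    have least: "\<not> (\<forall>i. g (i + m') = f i)" if "m' < m" for m'
      using not_less_Least that by (auto simp: m_def)
    define b where "b = trunc E m (InfPath g :: ('a, 'b) path)"
    have eq: "pconcat b (InfPath f) = p"
      unfolding b_def g by (rule pconcat_trunc_InfPath) (rule m)
    have "rmap E (g 0) \<in> topspace (vtop E)"
      using ginf base rng m[of 0] edge_base by (cases m) (auto simp: InfPath_in_infinite_paths)
    then have bfin: "b \<in> finite_paths E"
      unfolding b_def by (rule trunc_InfPath_in_finite_paths[OF ginf])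
    have bsrc: "src E b = rng E ?a"
      using src_trunc_InfPath[OF ginf, of m] rng m[of 0] by (simp add: b_def)
    have "\<not> (\<exists>b'\<in>finite_paths E. src E b' = rng E ?a \<and> b = pconcat b' ?a)"
    proof
      assume "\<exists>b'\<in>finite_paths E. src E b' = rng E ?a \<and> b = pconcat b' ?a"
      then obtain b' where b': "b' \<in> finite_paths E" "b = pconcat b' ?a" by blast
      have "\<exists>zs. map g [0..<m] = zs @ xs \<and> m \<noteq> 0"
        using b' by (cases b') (auto simp: b_def trunc_InfPath split: if_splits)
      then obtain zs where zs: "map g [0..<m] = zs @ xs" by blast
      have len: "m = length zs + n" using arg_cong[OF zs, of length] by (simp add: n_def)
      \<comment> \<open>If the segment ended with a full turn, the cut could be moved back by
        \<open>n\<close>, to \<open>length zs\<close>.\<close>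
      have "g (i + length zs) = f i" for i
      proof (cases "i < n")
        case True
        have "g (i + length zs) = map g [0..<m] ! (i + length zs)" using True len by simp
        also have "\<dots> = f i" using True by (simp add: zs nth_append fxs)
        finally show ?thesis .
      next
        case False
        then have "i + length zs = (i - n) + m" using len by simp
        then have "g (i + length zs) = f (i - n)" using m by metis
        then show ?thesis using fn[of "i - n"] False by simp
      qed
      moreover have "length zs < m" using len n by simp
      ultimately show False using least by blast
    qed
    then have "b \<in> approach_paths E ?a" using bfin bsrc by (simp add: approach_paths_def)
    with eq show ?thesis by blast
  qed
  have inj: "b = b'" if b: "b \<in> approach_paths E ?a" and b': "b' \<in> approach_paths E ?a"
    and eq: "pconcat b (InfPath f) = pconcat b' (InfPath f)" for b b'
  proof -
    obtain ys where ys: "b = Vertex (rng E ?a) \<and> ys = [] \<or> b = Edges ys \<and> ys \<noteq> []"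
      "pconcat b (InfPath f) = InfPath (\<lambda>i. if i < length ys then ys ! i else f (i - length ys))"
      using shape[OF b] by blast
    obtain zs where zs: "b' = Vertex (rng E ?a) \<and> zs = [] \<or> b' = Edges zs \<and> zs \<noteq> []"
      "pconcat b' (InfPath f) = InfPath (\<lambda>i. if i < length zs then zs ! i else f (i - length zs))"
      using shape[OF b'] by blast
    have pt: "(if i < length ys then ys ! i else f (i - length ys)) =
      (if i < length zs then zs ! i else f (i - length zs))" for i
      using fun_cong[OF eq[unfolded ys(2) zs(2) path.inject], of i] .
    \<comment> \<open>Applied in both directions to get equal lengths. The list \<open>u\<close> may
      be empty, which stands for the base vertex as an approach path.\<close>
    have wlog: "length u \<ge> length w" 
      if c: "c \<in> approach_paths E ?a" "c = Edges w"
      and pt: "\<And>i. (if i < length u then u ! i else f (i - length u)) =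
      (if i < length w then w ! i else f (i - length w))"
      and u: "u = [] \<or> Edges u \<in> finite_paths E \<and> src E (Edges u) = rng E ?a" for u w c
    proof (rule ccontr)
      assume less: "\<not> length u \<ge> length w"
      define l where "l = length w - length u"
      have l: "l > 0" "length w = length u + l" using less by (auto simp: l_def)
      \<comment> \<open>Beyond both segments, the same path reads as \<open>f\<close> at positions
        that differ by \<open>l\<close>.\<close>
      have "f (i + l) = f i" for i
        using pt[of "i + length w"] l by simp
      then have "n dvd l"
        unfolding n_def by (intro primitive_period_dvd[OF loop prim]) (simp add: f_def)
      then obtain j where j: "l = n * j" by blast
      with l have "j > 0" by auto
      then have nl: "n \<le> l" using j by simp
      \<comment> \<open>Past the end of \<open>u\<close> the edges of \<open>w\<close> already run
        along the repeated loop; the last \<open>n\<close> of them form a full turn because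
        \<open>n\<close> divides \<open>l\<close>.\<close>
      have wn: "w ! i = f (i - length u)" if "length u \<le> i" "i < length w" for i
        using pt[of i] that by simp
      define v where "v = take (length w - n) w"
      have wv: "w = v @ xs"
      proof (rule nth_equalityI)
        show "length w = length (v @ xs)" using nl l by (simp add: v_def n_def)
        fix i assume i: "i < length w"
        show "w ! i = (v @ xs) ! i"
        proof (cases "i < length w - n")
          case True then show ?thesis by (simp add: v_def nth_append)
        next
          case False
          define t where "t = i - (length w - n)"
          have t: "t < n" using i False by (simp add: t_def)
          have it: "i = length u + (j - 1) * n + t"
          proof -
            have "(j - 1) * n + n = l" using j \<open>j > 0\<close> by (cases j) auto
            then show ?thesis using False l i by (simp add: t_def)
          qed
          have "w ! i = f (i - length u)" using wn i it by simp
          also have "i - length u = t + (j - 1) * n" using it by simp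
          also have "f \<dots> = f t" using periodic_mult[of f n, OF fn] by simp
          finally show ?thesis using t False fxs
            by (simp add: t_def v_def nth_append)
        qed
      qed
      have wfin: "Edges w \<in> finite_paths E" using c by (simp add: approach_paths_def)
      \<comment> \<open>If \<open>w\<close> is exactly one turn, the empty list remains, and it has
        to be read as the base vertex.\<close>
      define c' :: "('a, 'b) path" where "c' = (if v = [] then Vertex (rng E ?a) else Edges v)"
      have "c = pconcat c' ?a" using c wv by (simp add: c'_def)
      moreover have "c' \<in> finite_paths E \<and> src E c' = rng E ?a"
      proof (cases "v = []")
        case True
        then show ?thesis using base by (simp add: c'_def Vertex_in_finite_paths)
      next
        case False
        have "smap E (last v) = rmap E (hd xs)"
        proof -
          have "Suc (length v - 1) < length w" using False wv n by (simp add: n_def)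
          then have "smap E (w ! (length v - 1)) = rmap E (w ! Suc (length v - 1))"
            using wfin by (simp add: Edges_in_finite_paths)
          then show ?thesis using False wv n by (simp add: nth_append last_conv_nth hd_conv_nth n_def)
        qed
        moreover have "Edges v \<in> finite_paths E"
        proof -
          have "smap E (v ! i) = rmap E (v ! Suc i)" if "Suc i < length v" for i
          proof -
            have "smap E (w ! i) = rmap E (w ! Suc i)"
              using wfin that wv by (simp add: Edges_in_finite_paths)
            then show ?thesis using that by (simp add: wv nth_append)
          qed
          then show ?thesis using False wfin wv by (simp add: Edges_in_finite_paths)
        qed
        ultimately show ?thesis using False by (simp add: c'_def)
      qed
      ultimately show False using c(1) by (auto simp: approach_paths_def)
    qed
    have "length ys \<le> length zs"
      using wlog[of b ys zs] ys(1) zs(1) pt b b' by (cases "ys = []") (auto simp: approach_paths_def)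
    moreover have "length zs \<le> length ys"
      using wlog[of b' zs ys] ys(1) zs(1) pt[symmetric] b b' by (cases "zs = []") (auto simp: approach_paths_def)
    ultimately have len: "length ys = length zs" by simp
    have "ys = zs"
    proof (rule nth_equalityI[OF len])
      fix i assume "i < length ys" then show "ys ! i = zs ! i" using pt[of i] len by simp
    qed
    then show ?thesis using ys(1) zs(1) by auto
  qed
  show ?thesis
    unfolding bij_betw_def inj_on_def using into onto inj by (auto simp: image_iff)
qed

section \<open>Orbits of primitive loops and equivalence of loops\<close>

definition primitive_loop :: "('v, 'e) tgraph \<Rightarrow> ('v, 'e) path \<Rightarrow> bool" where
  "primitive_loop E a \<longleftrightarrow> is_loop E a \<and> (\<forall>c n. is_loop E c \<and> n \<ge> 2 \<longrightarrow> a \<noteq> loop_power E c n)"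

text \<open>The default \<open>{}\<close> never concerns a loop, since loops are always of the form
  \<open>Edges xs\<close>.\<close>

definition loop_orbit :: "('v, 'e) tgraph \<Rightarrow> ('v, 'e) path \<Rightarrow> ('v, 'e) path set" where
  "loop_orbit E a = (case a of Edges xs \<Rightarrow> seq_orbit E (\<lambda>i. xs ! (i mod length xs)) | _ \<Rightarrow> {})"

lemma loop_orbit_Edges [simp]: "loop_orbit E (Edges xs) = seq_orbit E (\<lambda>i. xs ! (i mod length xs))"
  by (simp add: loop_orbit_def)

text \<open>\<open>rotate\<close> accepts any number of steps and composes additively, so symmetry
  and transitivity become arithmetic; the bound on \<open>k\<close> in the definition is recovered
  by reducing modulo the length.\<close>

lemma loop_equiv_iff:
  "(a, b) \<in> loop_equiv E \<longleftrightarrow>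
     is_loop E a \<and> is_loop E b \<and> (\<exists>xs k. a = Edges xs \<and> b = Edges (rotate k xs))"
proof -
  have rot: "(\<exists>k\<le>length xs. ys = drop k xs @ take k xs) \<longleftrightarrow> (\<exists>k. ys = rotate k xs)" if "xs \<noteq> []" for xs ys :: "'b list"
  proof
    assume "\<exists>k\<le>length xs. ys = drop k xs @ take k xs"
    then obtain k where k: "k \<le> length xs" "ys = drop k xs @ take k xs" by blast
    then have "ys = rotate k xs"
      by (cases "k = length xs") (auto simp: rotate_drop_take)
    then show "\<exists>k. ys = rotate k xs" by blast
  next
    assume "\<exists>k. ys = rotate k xs"
    then obtain k where "ys = rotate k xs" by blast
    then show "\<exists>k\<le>length xs. ys = drop k xs @ take k xs"
      using that by (intro exI[of _ "k mod length xs"]) (auto simp: rotate_drop_take)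
  qed
  show ?thesis
  proof (cases "is_loop E a \<and> is_loop E b")
    case True
    then obtain xs ys where "a = Edges xs" "xs \<noteq> []" "b = Edges ys" by (meson is_loop_cases)
    with True rot[of xs ys] show ?thesis by (simp add: loop_equiv_def)
  next
    case False
    then show ?thesis by (auto simp: loop_equiv_def)
  qed
qed

lemma loop_equiv_sym: "(a, b) \<in> loop_equiv E \<Longrightarrow> (b, a) \<in> loop_equiv E"
proof -
  assume "(a, b) \<in> loop_equiv E"
  then obtain xs k where ab: "is_loop E a" "is_loop E b" "a = Edges xs" "b = Edges (rotate k xs)"
    by (auto simp: loop_equiv_iff)
  \<comment> \<open>Keeps the subtraction below exact: rotating by \<open>k * length xs - k\<close>
    completes the rotation by \<open>k\<close> to \<open>k\<close> full turns.\<close>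
  have "k \<le> k * length xs" using ab by (cases xs) (auto simp: is_loop_Edges)
  then have "rotate (k * length xs - k) (rotate k xs) = rotate (k * length xs) xs"
    by (simp add: rotate_rotate)
  also have "\<dots> = xs" using rotate_conv_mod[of "k * length xs" xs] by simp
  finally have "a = Edges (rotate (k * length xs - k) (rotate k xs))" using ab by simp
  then show ?thesis using ab by (auto simp: loop_equiv_iff)
qed

lemma loop_equiv_trans:
  "(a, b) \<in> loop_equiv E \<Longrightarrow> (b, c) \<in> loop_equiv E \<Longrightarrow> (a, c) \<in> loop_equiv E"
  unfolding loop_equiv_iff by (auto simp: rotate_rotate)

lemma loop_equiv_refl: "is_loop E a \<Longrightarrow> (a, a) \<in> loop_equiv E"
  unfolding loop_equiv_iff by (metis is_loop_cases rotate0 id_apply)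

lemma loop_equiv_Image_eq_iff:
  assumes "is_loop E a" "is_loop E b"
  shows "loop_equiv E `` {a} = loop_equiv E `` {b} \<longleftrightarrow> (a, b) \<in> loop_equiv E"
  using assms by (auto dest: loop_equiv_sym loop_equiv_trans loop_equiv_refl)

lemma loop_orbit_subset:
  assumes "(a, b) \<in> loop_equiv E"
  shows "loop_orbit E b \<subseteq> loop_orbit E a"
proof -
  obtain xs k where ab: "is_loop E a" "a = Edges xs" "b = Edges (rotate k xs)"
    using assms by (auto simp: loop_equiv_iff)
  then have n: "length xs > 0" by (auto simp: is_loop_Edges)
  have eq: "rotate k xs ! (i mod length xs) = xs ! ((i + k) mod length xs)" for i
    using n by (simp add: nth_rotate add.commute mod_simps)
  have "\<exists>m j. \<forall>i. g (i + m) = xs ! ((i + j) mod length xs)"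
    if "\<forall>i. g (i + m) = xs ! ((i + j + k) mod length xs)" for g m j
    using that by (metis add.assoc)
  then show ?thesis
    using ab unfolding loop_orbit_Edges seq_orbit_def length_rotate eq ab by blast
qed

lemma loop_orbit_cong: "(a, b) \<in> loop_equiv E \<Longrightarrow> loop_orbit E a = loop_orbit E b"
  using loop_orbit_subset loop_equiv_sym by blast

lemma loop_infinity_in_loop_orbit: "is_loop E a \<Longrightarrow> loop_infinity a \<in> loop_orbit E a"
proof -
  assume a: "is_loop E a"
  then obtain xs where "a = Edges xs" using is_loop_cases by blast
  then show ?thesis
    using loop_infinity_in_infinite_paths[OF a] unfolding seq_orbit_def
    by (auto simp: seq_orbit_def)
qed

text \<open>A period that is valid from position \<open>k\<close> on is valid everywhere, since full
  periods \<open>n\<close> move any position beyond \<open>k\<close>.\<close>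

lemma period_shift:
  fixes f :: "nat \<Rightarrow> 'a"
  assumes "\<And>i. f (i + n) = f i" "n > 0" "\<And>i. f (i + k + m) = f (i + k)"
  shows "f (i + m) = f i"
proof -
  have "f (i + m) = f (i + m + k * n)"
    using periodic_mult[of f n, OF assms(1)] by simp
  also have "i + m + k * n = (i + k * (n - 1)) + k + m" using assms(2) by (cases n) auto
  also have "f \<dots> = f (i + k * (n - 1) + k)" by (rule assms(3))
  also have "i + k * (n - 1) + k = i + k * n" using assms(2) by (cases n) auto
  finally show ?thesis using periodic_mult[of f n, OF assms(1)] by simp
qed

text \<open>A common tail makes the length of each loop a period of the other. Primitivity turns
  both facts into divisibilities, so the lengths agree, and the lag between the two sequences is
  then a rotation.\<close>

lemma loop_orbit_eq_imp_equiv: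
  assumes a: "primitive_loop E a" and b: "primitive_loop E b"
    and eq: "loop_orbit E a = loop_orbit E b"
  shows "(a, b) \<in> loop_equiv E"
proof -
  obtain xs ys where xs: "a = Edges xs" "xs \<noteq> []" and ys: "b = Edges ys" "ys \<noteq> []"
    using a b by (meson primitive_loop_def is_loop_cases)
  define f where "f i = xs ! (i mod length xs)" for i
  define h where "h i = ys ! (i mod length ys)" for i
  have per: "f (i + length xs) = f i" "h (i + length ys) = h i" for i
    by (simp_all add: f_def h_def)
  have "InfPath h \<in> loop_orbit E a"
    using loop_infinity_in_loop_orbit[of E b] b eq ys by (simp add: primitive_loop_def h_def[abs_def])
  then obtain m k where mk: "\<And>i. h (i + m) = f (i + k)"
    unfolding xs by (auto simp: seq_orbit_def f_def)
  have "f (i + k + length ys) = f (i + k)" for i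
    using mk[of i] mk[of "i + length ys"] per(2)[of "i + m"] by (simp add: ac_simps)
  then have "f (i + length ys) = f i" for i
    using period_shift[of f "length xs" k "length ys"] per(1) xs by simp
  then have d1: "length xs dvd length ys"
    using a by (intro primitive_period_dvd[of E]) (auto simp: primitive_loop_def xs f_def)
  have "h (i + m + length xs) = h (i + m)" for i
    using mk[of i] mk[of "i + length xs"] per(1)[of "i + k"] by (simp add: ac_simps)
  then have "h (i + length xs) = h i" for i
    using period_shift[of h "length ys" m "length xs"] per(2) ys by simp
  then have d2: "length ys dvd length xs"
    using b by (intro primitive_period_dvd[of E]) (auto simp: primitive_loop_def ys h_def)
  have len: "length xs = length ys" using d1 d2 by (rule dvd_antisym)
  \<comment> \<open>The lag from \<open>h\<close> to \<open>f\<close>: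
    \<open>m * (length ys - 1)\<close> further steps complete the offset \<open>m\<close> in
    \<open>h\<close> to full turns, and \<open>k\<close> is the offset in \<open>f\<close>.\<close>
  define j where "j = m * (length ys - 1) + k"
  have hf: "h i = f (i + j)" for i
  proof -
    have "h i = h (i + m * length ys)" using periodic_mult[of h "length ys", OF per(2)] by simp
    also have "i + m * length ys = (i + m * (length ys - 1)) + m" using ys by (cases "length ys") auto
    also have "h \<dots> = f (i + m * (length ys - 1) + k)" by (rule mk)
    finally show ?thesis by (simp add: j_def add.assoc)
  qed
  have "ys = rotate j xs"
  proof (rule nth_equalityI)
    fix i assume "i < length ys"
    then show "ys ! i = rotate j xs ! i"
      using hf[of i] len by (simp add: h_def f_def nth_rotate add.commute)
  qed (simp add: len)
  then show ?thesis using a b xs ys by (auto simp: loop_equiv_iff primitive_loop_def)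
qed

section \<open>Periodic and eventually cyclic sequences of edges\<close>

lemma periodic_path_loop:
  assumes inf: "InfPath f \<in> infinite_paths E" and p: "p > 0" "\<And>i. f (i + p) = f i"
  shows "is_loop E (Edges (map f [0..<p]))" "loop_infinity (Edges (map f [0..<p])) = InfPath f"
proof -
  have len: "length (map f [0..<p]) = p" by simp
  have nth: "map f [0..<p] ! (i mod p) = f i" for i
  proof -
    have "i mod p < p" using p(1) by simp
    then show ?thesis using periodic_mod[of f p, OF p(2)] by simp
  qed
  show "is_loop E (Edges (map f [0..<p]))"
    unfolding is_loop_Edges len nth using inf p(1) by (auto simp: InfPath_in_infinite_paths)
  show "loop_infinity (Edges (map f [0..<p])) = InfPath f"
    unfolding loop_infinity.simps len nth ..
qed

text \<open>The loop is read off over the least positive period; a proper root would give a period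
  at most half as long.\<close>

lemma periodic_path_primitive_loop:
  assumes inf: "InfPath f \<in> infinite_paths E" and p: "p > 0" "\<And>i. f (i + p) = f i"
  shows "\<exists>a. primitive_loop E a \<and> loop_infinity a = InfPath f"
proof -
  define q where "q = (LEAST q. q > 0 \<and> (\<forall>i. f (i + q) = f i))"
  have "q > 0 \<and> (\<forall>i. f (i + q) = f i)"
    unfolding q_def using LeastI[of "\<lambda>q. q > 0 \<and> (\<forall>i. f (i + q) = f i)" p] p by blast
  then have q: "q > 0" "\<And>i. f (i + q) = f i" by auto
  define xs where "xs = map f [0..<q]"
  have lp: "is_loop E (Edges xs)" "loop_infinity (Edges xs) = InfPath f"
    unfolding xs_def by (rule periodic_path_loop[OF inf q])+
  have False if c: "is_loop E c" "n \<ge> 2" "Edges xs = loop_power E c n" for c n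
  proof -
    obtain ys where ys: "c = Edges ys" "ys \<noteq> []" using c is_loop_cases by blast
    have xs: "xs = concat (replicate n ys)" using c ys by (simp add: loop_power_Edges)
    have len: "q = n * length ys"
      using arg_cong[OF xs, of length] by (simp add: xs_def length_concat sum_list_replicate)
    have "f i = ys ! (i mod length ys)" for i
    proof -
      have "f i = f (i mod q)" using periodic_mod[of f q] q by simp
      also have "\<dots> = xs ! (i mod q)" using q by (simp add: xs_def)
      also have "\<dots> = ys ! (i mod q mod length ys)"
        unfolding xs using q len by (intro nth_concat_replicate) auto
      also have "i mod q mod length ys = i mod length ys" by (simp add: len mod_mod_cancel)
      finally show ?thesis .
    qed
    then have "length ys > 0 \<and> (\<forall>i. f (i + length ys) = f i)" using ys by simp
    then have "q \<le> length ys" unfolding q_def by (rule Least_le)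
    moreover have "2 * length ys \<le> q" unfolding len using c(2) by simp
    moreover have "length ys > 0" using ys by simp
    ultimately show False by linarith
  qed
  then have "primitive_loop E (Edges xs)" using lp(1) unfolding primitive_loop_def by blast
  then show ?thesis using lp(2) by blast
qed

text \<open>Expresses eventual cyclicity by coordinates, the form from which measurability is
  derived: \<open>m\<close> is the length of the initial segment and \<open>q\<close> that of the
  loop.\<close>

lemma eventually_cyclic_iff:
  assumes edge_base: "\<And>e. e \<in> topspace (etop E) \<Longrightarrow> rmap E e \<in> topspace (vtop E)"
  shows "p \<in> eventually_cyclic E \<longleftrightarrow>
    (\<exists>g m q. p = InfPath g \<and> InfPath g \<in> infinite_paths E \<and> q > 0 \<and> (\<forall>i\<ge>m. g (i + q) = g i))"
    (is "_ \<longleftrightarrow> ?R")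
proof
  assume "p \<in> eventually_cyclic E"
  then obtain a b where ab: "p = pconcat b (loop_infinity a)" "is_loop E a" "b \<in> finite_paths E"
    "src E b = rng E a" by (auto simp: eventually_cyclic_def)
  obtain xs where xs: "a = Edges xs" "xs \<noteq> []" using ab is_loop_cases by blast
  define f where "f i = xs ! (i mod length xs)" for i
  have la: "loop_infinity a = InfPath f" by (simp add: xs f_def[abs_def])
  have "InfPath f \<in> infinite_paths E"
    using loop_infinity_in_infinite_paths[OF ab(2)] unfolding la .
  moreover have "src E b = rmap E (f 0)"
    using ab(4) xs by (simp add: f_def hd_conv_nth)
  ultimately have "p \<in> infinite_paths E"
    unfolding ab(1) la using ab(3) by (intro pconcat_InfPath_in_infinite_paths)
  moreover have "\<exists>ys. p = InfPath (\<lambda>i. if i < length ys then ys ! i else f (i - length ys))"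
    using ab(1,3) unfolding la by (cases b) (auto intro: exI[of _ "[]"])
  then obtain ys where ys: "p = InfPath (\<lambda>i. if i < length ys then ys ! i else f (i - length ys))"
    by blast
  have "f (i + length xs - length ys) = f (i - length ys)" if "i \<ge> length ys" for i
  proof -
    have "i + length xs - length ys = (i - length ys) + length xs" using that by simp
    then show ?thesis by (simp add: f_def)
  qed
  ultimately show ?R
    using xs by (intro exI[of _ "\<lambda>i. if i < length ys then ys ! i else f (i - length ys)"]
        exI[of _ "length ys"] exI[of _ "length xs"]) (auto simp: ys)
next
  assume ?R
  then obtain g m q where g: "p = InfPath g" "InfPath g \<in> infinite_paths E" "q > 0"
    and per: "\<And>i. i \<ge> m \<Longrightarrow> g (i + q) = g i" by auto
  define f where "f i = g (i + m)" for i
  have "InfPath f \<in> infinite_paths E" using g by (simp add: f_def InfPath_in_infinite_paths)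
  moreover have "f (i + q) = f i" for i using per[of "i + m"] by (simp add: f_def ac_simps)
  ultimately have a: "is_loop E (Edges (map f [0..<q]))" "loop_infinity (Edges (map f [0..<q])) = InfPath f"
    using periodic_path_loop[of f E q] g by simp_all
  show "p \<in> eventually_cyclic E"
    unfolding eventually_cyclic_def
  proof (intro CollectI exI conjI)
    show "p = pconcat (trunc E m (InfPath g)) (loop_infinity (Edges (map f [0..<q])))"
      unfolding a(2) g(1) by (rule pconcat_trunc_InfPath[symmetric]) (simp add: f_def)
    show "trunc E m (InfPath g) \<in> finite_paths E"
      using g edge_base by (intro trunc_InfPath_in_finite_paths) (auto simp: InfPath_in_infinite_paths)
    show "src E (trunc E m (InfPath g)) = rng E (Edges (map f [0..<q]))"
      using g(3) by (simp add: src_trunc_InfPath[OF g(2)] f_def hd_map upt_rec[of 0])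
  qed (rule a)
qed

section \<open>Topologies on the path spaces\<close>

lemma topspace_path_topology: "topspace (path_topology E n) = paths_of_length E n"
proof (cases "n = 0")
  case True
  then show ?thesis
    by (auto simp: path_topology_def topspace_pullback_topology paths_of_length_def)
next
  case False
  then show ?thesis
    by (auto simp: path_topology_def topspace_pullback_topology topspace_product_topology
        paths_of_length_def PiE_iff subset_iff)
qed

lemma openin_path_topology_0:
  "openin (path_topology E 0) U \<longleftrightarrow> (\<exists>V. openin (vtop E) V \<and> U = Vertex ` V)"
proof -
  have "rng E -` V \<inter> paths_of_length E 0 = Vertex ` V" if "openin (vtop E) V" for V
    using openin_subset[OF that] by (auto simp: paths_of_length_def)
  then have "(\<exists>V. openin (vtop E) V \<and> U = rng E -` V \<inter> paths_of_length E 0) \<longleftrightarrow>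
      (\<exists>V. openin (vtop E) V \<and> U = Vertex ` V)"
    by metis
  then show ?thesis
    by (simp add: path_topology_def openin_pullback_topology)
qed

text \<open>Unfolds the pullback and the product topology once and for all into box neighbourhoods
  described by \<open>pedge\<close>; \<open>W\<close> is a total function that is read only below
  \<open>n\<close>.\<close>

lemma openin_path_topology_pos:
  assumes "n \<noteq> 0"
  shows "openin (path_topology E n) U \<longleftrightarrow> U \<subseteq> paths_of_length E n \<and>
    (\<forall>q\<in>U. \<exists>W. (\<forall>i<n. openin (etop E) (W i) \<and> pedge i q \<in> W i) \<and>
      (\<forall>q'\<in>paths_of_length E n. (\<forall>i<n. pedge i q' \<in> W i) \<longrightarrow> q' \<in> U))"
    (is "_ \<longleftrightarrow> _ \<and> (\<forall>q\<in>U. ?N q)")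
proof -
  define P where "P = product_topology (\<lambda>_. etop E) {..<n}"
  define \<phi> :: "('a, 'b) path \<Rightarrow> nat \<Rightarrow> 'b"
    where "\<phi> p = (case p of Edges xs \<Rightarrow> restrict (\<lambda>i. xs ! i) {..<n} | _ \<Rightarrow> undefined)" for p
  have \<phi>: "\<phi> p \<in> extensional {..<n}" "i < n \<Longrightarrow> \<phi> p i = pedge i p" if "p \<in> paths_of_length E n" for p i
    using that assms by (auto simp: \<phi>_def paths_of_length_def)
  have PiE: "\<phi> p \<in> Pi\<^sub>E {..<n} W \<longleftrightarrow> (\<forall>i<n. pedge i p \<in> W i)" if "p \<in> paths_of_length E n" for p W
    using \<phi>[OF that] by (auto simp: PiE_iff)
  have op: "openin (path_topology E n) U \<longleftrightarrow> (\<exists>T. openin P T \<and> U = \<phi> -` T \<inter> paths_of_length E n)" for U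
    using assms by (simp add: path_topology_def openin_pullback_topology P_def \<phi>_def[abs_def])
  show ?thesis
  proof
    assume U: "openin (path_topology E n) U"
    then obtain T where T: "openin P T" "U = \<phi> -` T \<inter> paths_of_length E n" using op by blast
    have "?N q" if "q \<in> U" for q
    proof -
      have "\<phi> q \<in> T" using T that by simp
      then obtain W where "\<forall>i\<in>{..<n}. openin (etop E) (W i)" "\<phi> q \<in> Pi\<^sub>E {..<n} W" "Pi\<^sub>E {..<n} W \<subseteq> T"
        using T(1)[unfolded P_def openin_product_topology_alt, rule_format, of "\<phi> q"] by blast
      moreover have "q \<in> paths_of_length E n" using T that by blast
      moreover have "q' \<in> U" if "q' \<in> paths_of_length E n" "\<forall>i<n. pedge i q' \<in> W i" for q'
        using PiE[OF that(1), of W] that \<open>Pi\<^sub>E {..<n} W \<subseteq> T\<close> T(2) by blast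
      ultimately show ?thesis using PiE[of q W] by (intro exI[of _ W]) auto
    qed
    then show "U \<subseteq> paths_of_length E n \<and> (\<forall>q\<in>U. ?N q)" using T by blast
  next
    assume R: "U \<subseteq> paths_of_length E n \<and> (\<forall>q\<in>U. ?N q)"
    show "openin (path_topology E n) U"
    proof (subst openin_subopen, rule ballI)
      fix q assume q: "q \<in> U"
      with R have "?N q" by simp
      then obtain W where W: "\<forall>i<n. openin (etop E) (W i) \<and> pedge i q \<in> W i"
        "\<forall>q'\<in>paths_of_length E n. (\<forall>i<n. pedge i q' \<in> W i) \<longrightarrow> q' \<in> U"
        by (elim exE conjE)
      have "openin P (Pi\<^sub>E {..<n} W)"
        unfolding P_def using W by (simp add: openin_PiE)
      then have "openin (path_topology E n) (\<phi> -` Pi\<^sub>E {..<n} W \<inter> paths_of_length E n)"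
        using op by blast
      moreover have "q \<in> \<phi> -` Pi\<^sub>E {..<n} W \<inter> paths_of_length E n"
      proof -
        have "q \<in> paths_of_length E n" using q R by blast
        with PiE[OF this, of W] W(1) show ?thesis by simp
      qed
      moreover have "\<phi> -` Pi\<^sub>E {..<n} W \<inter> paths_of_length E n \<subseteq> U"
      proof
        fix q' assume "q' \<in> \<phi> -` Pi\<^sub>E {..<n} W \<inter> paths_of_length E n"
        then have "q' \<in> paths_of_length E n" "\<phi> q' \<in> Pi\<^sub>E {..<n} W" by simp_all
        with PiE[OF this(1), of W] W(2) show "q' \<in> U" by simp
      qed
      ultimately show "\<exists>T. openin (path_topology E n) T \<and> q \<in> T \<and> T \<subseteq> U" by blast
    qed
  qed
qed

lemma openin_paths_of_length_iff:
  assumes "U \<subseteq> paths_of_length E n"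
  shows "openin (finite_path_topology E) U \<longleftrightarrow> openin (path_topology E n) U"
proof -
  have "U \<inter> paths_of_length E m = (if m = n then U else {})" for m
  proof (cases "m = n")
    case True
    then show ?thesis using assms by auto
  next
    case False
    then have "paths_of_length E n \<inter> paths_of_length E m = {}"
      by (metis disjoint_iff paths_of_length_disjoint)
    then show ?thesis using assms False by auto
  qed
  then show ?thesis
    using assms by (auto simp: openin_finite_path_topology finite_paths_def)
qed

lemma openin_paths_of_length: "openin (finite_path_topology E) (paths_of_length E n)"
  using openin_topspace[of "path_topology E n"]
  by (simp add: openin_paths_of_length_iff[OF order_refl] topspace_path_topology)

lemma topspace_finite_path_topology: "topspace (finite_path_topology E) = finite_paths E"
proof (rule subset_antisym)
  show "topspace (finite_path_topology E) \<subseteq> finite_paths E"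
    using openin_topspace openin_finite_path_topology by blast
  show "finite_paths E \<subseteq> topspace (finite_path_topology E)"
    unfolding finite_paths_def using openin_subset[OF openin_paths_of_length] by blast
qed

lemma openin_pedge:
  assumes "openin (etop E) U" "i < n"
  shows "openin (finite_path_topology E) {q \<in> paths_of_length E n. pedge i q \<in> U}"
proof -
  have sub: "pedge j q \<in> topspace (etop E)" if "q \<in> paths_of_length E n" "j < n" for q j
    using pedge_in_topspace[of q E j] plen_paths_of_length[OF that(1)] that
    by (auto simp: all_paths_def finite_paths_def)
  have "openin (path_topology E n) {q \<in> paths_of_length E n. pedge i q \<in> U}"
    using assms sub
    by (subst openin_path_topology_pos)
      (auto intro!: exI[of _ "\<lambda>j. if j = i then U else topspace (etop E)"])
  then show ?thesis by (subst openin_paths_of_length_iff[where n = n]) auto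
qed

lemma openin_Vertex_image:
  assumes "openin (vtop E) V"
  shows "openin (finite_path_topology E) (Vertex ` V)"
proof -
  have "Vertex ` V \<subseteq> paths_of_length E 0"
    using openin_subset[OF assms] by (auto simp: paths_of_length_def)
  then show ?thesis
    using assms by (subst openin_paths_of_length_iff[where n = 0]) (auto simp: openin_path_topology_0)
qed

text \<open>The paths of each fixed length form an open set, so finitely many of these sets cover
  \<open>K\<close>. This reduces the avoidance of the cylinder of a compact set to finitely many
  conditions.\<close>

lemma compactin_bounded_length:
  assumes "compactin (finite_path_topology E) K"
  shows "\<exists>N. \<forall>n. \<forall>q\<in>K. q \<in> paths_of_length E n \<longrightarrow> n < N"
proof -
  have "K \<subseteq> \<Union>(range (paths_of_length E))"
    using compactin_subset_topspace[OF assms]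
    by (auto simp: topspace_finite_path_topology finite_paths_def)
  moreover have "Ball (range (paths_of_length E)) (openin (finite_path_topology E))"
    by (simp add: openin_paths_of_length)
  ultimately obtain \<F> where F: "finite \<F>" "\<F> \<subseteq> range (paths_of_length E)" "K \<subseteq> \<Union>\<F>"
    using assms unfolding compactin_def by blast
  then obtain I where I: "finite I" "\<F> = paths_of_length E ` I"
    by (metis finite_subset_image)
  then obtain N where N: "\<And>i. i \<in> I \<Longrightarrow> i < N"
    by (metis finite_nat_set_iff_bounded)
  have "n < N" if q: "q \<in> K" "q \<in> paths_of_length E n" for n q
  proof -
    obtain i where i: "i \<in> I" "q \<in> paths_of_length E i"
      using subsetD[OF F(3) q(1)] unfolding I(2) by (elim UN_E)
    then have "n = i" using q(2) i(2) paths_of_length_disjoint[of q E n i] by simp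
    then show ?thesis using N i(1) by simp
  qed
  then show ?thesis by blast
qed

lemma Hausdorff_spaceE:
  assumes "Hausdorff_space X" "x \<in> topspace X" "y \<in> topspace X" "x \<noteq> y"
  obtains U V where "openin X U" "openin X V" "x \<in> U" "y \<in> V" "disjnt U V"
  using assms unfolding Hausdorff_space_def by metis

section \<open>Source and range maps of the graph\<close>

locale second_countable_topological_graph =
  fixes E :: "('v, 'e) tgraph"
  assumes topological: "topological_graph E"
    and second_countable: "second_countable_graph E"
begin

lemma Hausdorff_vtop: "Hausdorff_space (vtop E)"
  and Hausdorff_etop: "Hausdorff_space (etop E)"
  and continuous_rmap: "continuous_map (etop E) (vtop E) (rmap E)"
  using topological by (auto simp: topological_graph_def)

lemma rmap_in_topspace: "e \<in> topspace (etop E) \<Longrightarrow> rmap E e \<in> topspace (vtop E)"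
  using continuous_map_image_subset_topspace[OF continuous_rmap] by blast

text \<open>On a domain of the local homeomorphism, openness of images passes to all smaller open
  sets; charts can therefore be shrunk to members of a countable base.\<close>

lemma smap_locally_injective_open:
  assumes "e \<in> topspace (etop E)"
  shows "\<exists>U. openin (etop E) U \<and> e \<in> U \<and> inj_on (smap E) U \<and>
    (\<forall>U'\<subseteq>U. openin (etop E) U' \<longrightarrow> openin (vtop E) (smap E ` U'))"
proof -
  obtain U where U: "openin (etop E) U" "e \<in> U" "openin (vtop E) (smap E ` U)"
    "homeomorphic_map (subtopology (etop E) U) (subtopology (vtop E) (smap E ` U)) (smap E)"
    using topological assms unfolding topological_graph_def local_homeomorphism_map_def by meson
  have "topspace (subtopology (etop E) U) = U"
    using openin_subset[OF U(1)] by auto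
  then have inj: "inj_on (smap E) U"
    using homeomorphic_imp_injective_map[OF U(4)] by simp
  have "openin (vtop E) (smap E ` U')" if "U' \<subseteq> U" "openin (etop E) U'" for U'
  proof -
    have "openin (subtopology (etop E) U) U'"
      using that U(1) by (simp add: openin_open_subtopology)
    then have "openin (subtopology (vtop E) (smap E ` U)) (smap E ` U')"
      using homeomorphic_imp_open_map[OF U(4)] by (simp add: open_map_def)
    then show ?thesis using U(3) by (simp add: openin_open_subtopology)
  qed
  with U inj show ?thesis by blast
qed

lemma smap_in_topspace: "e \<in> topspace (etop E) \<Longrightarrow> smap E e \<in> topspace (vtop E)"
  using smap_locally_injective_open[of e] openin_subset by blast

lemma continuous_smap: "continuous_map (etop E) (vtop E) (smap E)"
  unfolding continuous_map_def
proof (intro conjI allI impI)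
  show "smap E \<in> topspace (etop E) \<rightarrow> topspace (vtop E)" using smap_in_topspace by blast
next
  fix V assume V: "openin (vtop E) V"
  show "openin (etop E) {e \<in> topspace (etop E). smap E e \<in> V}"
  proof (subst openin_subopen, rule ballI)
    fix e assume e: "e \<in> {e \<in> topspace (etop E). smap E e \<in> V}"
    then obtain U where U: "openin (etop E) U" "e \<in> U"
      "homeomorphic_map (subtopology (etop E) U) (subtopology (vtop E) (smap E ` U)) (smap E)"
      using topological unfolding topological_graph_def local_homeomorphism_map_def by blast
    have "continuous_map (subtopology (etop E) U) (vtop E) (smap E)"
      using homeomorphic_imp_continuous_map[OF U(3)] by (simp add: continuous_map_in_subtopology)
    then have "openin (subtopology (etop E) U) {x \<in> topspace (subtopology (etop E) U). smap E x \<in> V}"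
      using V by (simp only: continuous_map_def)
    then have "openin (etop E) {x \<in> topspace (subtopology (etop E) U). smap E x \<in> V}"
      using U(1) by (simp add: openin_open_subtopology)
    then show "\<exists>T. openin (etop E) T \<and> e \<in> T \<and> T \<subseteq> {e \<in> topspace (etop E). smap E e \<in> V}"
      using e U(2) by (intro exI[of _ "{x \<in> topspace (subtopology (etop E) U). smap E x \<in> V}"]) auto
  qed
qed

lemma rng_in_topspace: "p \<in> all_paths E \<Longrightarrow> rng E p \<in> topspace (vtop E)"
proof (cases p)
  case (Vertex v)
  assume "p \<in> all_paths E"
  with Vertex show ?thesis by (simp add: all_paths_def Vertex_in_finite_paths)
next
  case (Edges xs)
  assume "p \<in> all_paths E"
  with Edges show ?thesis
    by (auto simp: all_paths_def Edges_in_finite_paths intro!: rmap_in_topspace)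
next
  case (InfPath f)
  assume "p \<in> all_paths E"
  with InfPath show ?thesis
    by (auto simp: all_paths_def InfPath_in_infinite_paths intro!: rmap_in_topspace)
qed

lemma trunc_in_paths_of_length:
  assumes "p \<in> all_paths E" "enat n \<le> plen p"
  shows "trunc E n p \<in> paths_of_length E n"
proof (cases "n = 0")
  case True
  then show ?thesis using rng_in_topspace[OF assms(1)] by (simp add: trunc_def paths_of_length_def)
next
  case False
  show ?thesis
  proof (cases p)
    case (Vertex v)
    then show ?thesis using assms False by (simp add: zero_enat_def)
  next
    case (Edges xs)
    then show ?thesis using assms False set_take_subset[of n xs]
      by (auto simp: trunc_def Edges_in_paths_of_length all_paths_def Edges_in_finite_paths)
  next
    case (InfPath f)
    then show ?thesis using assms False
      by (auto simp: trunc_def Edges_in_paths_of_length all_paths_def InfPath_in_infinite_paths)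
  qed
qed

text \<open>Makes compact sets of finite paths closed and limits of initial segments unique.
  Different lengths are separated because each length is open, equal positive lengths at an edge
  where the paths differ.\<close>

lemma Hausdorff_finite_path_topology: "Hausdorff_space (finite_path_topology E)"
  unfolding Hausdorff_space_def topspace_finite_path_topology
proof (intro allI impI, elim conjE)
  fix p q :: "('v, 'e) path" assume p: "p \<in> finite_paths E" and q: "q \<in> finite_paths E" and ne: "p \<noteq> q"
  obtain n m where n: "p \<in> paths_of_length E n" and m: "q \<in> paths_of_length E m"
    using p q by (auto simp: finite_paths_def)
  have all: "p \<in> all_paths E" "q \<in> all_paths E" using p q by (auto simp: all_paths_def)
  let ?Q = "\<exists>U V. openin (finite_path_topology E) U \<and> openin (finite_path_topology E) V \<and>
      p \<in> U \<and> q \<in> V \<and> disjnt U V"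
  consider "n \<noteq> m" | "n = m" "n = 0" | "n = m" "n \<noteq> 0" by blast
  then show ?Q
  proof cases
    case 1
    then have "disjnt (paths_of_length E n) (paths_of_length E m)"
      by (metis disjnt_iff paths_of_length_disjoint)
    then show ?thesis using n m openin_paths_of_length by blast
  next
    case 2
    then have "rng E p \<noteq> rng E q" using n m ne paths_of_length_0_eqI by metis
    then obtain U V where UV: "openin (vtop E) U" "openin (vtop E) V" "rng E p \<in> U" "rng E q \<in> V" "disjnt U V"
      using Hausdorff_spaceE[OF Hausdorff_vtop rng_in_topspace[OF all(1)] rng_in_topspace[OF all(2)]] by blast
    moreover have "p = Vertex (rng E p)" "q = Vertex (rng E q)"
      using n m 2 by (auto simp: paths_of_length_def)
    ultimately show ?thesis
      using openin_Vertex_image[of E U] openin_Vertex_image[of E V]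
      by (intro exI[of _ "Vertex ` U"] exI[of _ "Vertex ` V"]) (auto simp: disjnt_def)
  next
    case 3
    then obtain i where i: "i < n" "pedge i p \<noteq> pedge i q"
      using paths_of_length_eqI[of p E n q] n m ne by blast
    have "pedge i p \<in> topspace (etop E)" "pedge i q \<in> topspace (etop E)"
      using all i(1) 3 plen_paths_of_length[OF n] plen_paths_of_length[OF m]
      by (auto intro!: pedge_in_topspace)
    then obtain U V where UV: "openin (etop E) U" "openin (etop E) V" "pedge i p \<in> U"
      "pedge i q \<in> V" "disjnt U V"
      using Hausdorff_spaceE[OF Hausdorff_etop] i(2) by metis
    then show ?thesis
      using openin_pedge[OF UV(1) i(1)] openin_pedge[OF UV(2) i(1)] n m 3
      by (intro exI[of _ "{q \<in> paths_of_length E n. pedge i q \<in> U}"]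
          exI[of _ "{q \<in> paths_of_length E n. pedge i q \<in> V}"]) (auto simp: disjnt_def)
  qed
qed

section \<open>Coordinate cylinders of boundary paths\<close>

definition edge_set :: "nat \<Rightarrow> 'e set \<Rightarrow> ('v, 'e) path set" where
  "edge_set i U = {p \<in> boundary_paths E. enat i < plen p \<and> pedge i p \<in> U}"

definition range_set :: "'v set \<Rightarrow> ('v, 'e) path set" where
  "range_set V = {p \<in> boundary_paths E. rng E p \<in> V}"

lemma boundary_all: "p \<in> boundary_paths E \<Longrightarrow> p \<in> all_paths E"
  using boundary_subset_all_paths by blast

lemma openin_boundary_cylinder:
  "openin (finite_path_topology E) U \<Longrightarrow> compactin (finite_path_topology E) K \<Longrightarrow>
     openin (boundary_topology E) (cylinder E U - cylinder E K)"
  unfolding boundary_topology_def by (rule topology_generated_by_Basis) blast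

lemma cylinder_paths:
  assumes "S \<subseteq> paths_of_length E n"
  shows "cylinder E S = {p \<in> boundary_paths E. enat n \<le> plen p \<and> trunc E n p \<in> S}"
proof -
  have "m = n" if "p \<in> boundary_paths E" "enat m \<le> plen p" "trunc E m p \<in> S" for p m
    using trunc_in_paths_of_length[OF boundary_all[OF that(1)] that(2)] that(3) assms
      paths_of_length_disjoint by blast
  then show ?thesis unfolding cylinder_eq by blast
qed

lemma openin_cylinder:
  assumes "openin (finite_path_topology E) U"
  shows "openin (boundary_topology E) (cylinder E U)"
proof -
  have "cylinder E {} = {}" by (simp add: cylinder_def)
  then show ?thesis using openin_boundary_cylinder[OF assms, of "{}"] by simp
qed

lemma edge_set_eq_cylinder:
  "edge_set i U = cylinder E {q \<in> paths_of_length E (Suc i). pedge i q \<in> U}"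
  by (subst cylinder_paths)
    (auto simp: edge_set_def pedge_trunc boundary_all Suc_ile_eq intro: trunc_in_paths_of_length)

lemma range_set_eq_cylinder:
  assumes "V \<subseteq> topspace (vtop E)"
  shows "range_set V = cylinder E (Vertex ` V)"
proof (subst cylinder_paths[of _ 0])
  show "Vertex ` V \<subseteq> paths_of_length E 0" using assms by (auto simp: paths_of_length_def)
qed (auto simp: range_set_def trunc_def zero_enat_def[symmetric])

lemma openin_edge_set:
  assumes "openin (etop E) U"
  shows "openin (boundary_topology E) (edge_set i U)"
  unfolding edge_set_eq_cylinder using assms by (intro openin_cylinder openin_pedge) auto

lemma openin_range_set:
  assumes "openin (vtop E) V"
  shows "openin (boundary_topology E) (range_set V)"
  using assms by (subst range_set_eq_cylinder) (auto dest: openin_subset intro!: openin_cylinder openin_Vertex_image)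

lemma topspace_boundary_topology: "topspace (boundary_topology E) = boundary_paths E"
proof
  show "topspace (boundary_topology E) \<subseteq> boundary_paths E"
    unfolding boundary_topology_def topology_generated_by_topspace
    by (auto simp: cylinder_def)
  have "range_set (topspace (vtop E)) = boundary_paths E"
    using rng_in_topspace boundary_all by (auto simp: range_set_def)
  then show "boundary_paths E \<subseteq> topspace (boundary_topology E)"
    using openin_subset[OF openin_range_set[OF openin_topspace]] by simp
qed

section \<open>Borel sets of the boundary path space\<close>

definition edge_base :: "'e set set" where
  "edge_base = (SOME \<B>. countable \<B> \<and> (\<forall>V\<in>\<B>. openin (etop E) V) \<and>
     (\<forall>U x. openin (etop E) U \<and> x \<in> U \<longrightarrow> (\<exists>V\<in>\<B>. x \<in> V \<and> V \<subseteq> U)))"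

definition vertex_base :: "'v set set" where
  "vertex_base = (SOME \<B>. countable \<B> \<and> (\<forall>V\<in>\<B>. openin (vtop E) V) \<and>
     (\<forall>U x. openin (vtop E) U \<and> x \<in> U \<longrightarrow> (\<exists>V\<in>\<B>. x \<in> V \<and> V \<subseteq> U)))"

lemma edge_base: "countable edge_base" "U \<in> edge_base \<Longrightarrow> openin (etop E) U"
    "openin (etop E) U \<Longrightarrow> x \<in> U \<Longrightarrow> \<exists>V\<in>edge_base. x \<in> V \<and> V \<subseteq> U"
  and vertex_base: "countable vertex_base" "V \<in> vertex_base \<Longrightarrow> openin (vtop E) V"
    "openin (vtop E) V \<Longrightarrow> v \<in> V \<Longrightarrow> \<exists>W\<in>vertex_base. v \<in> W \<and> W \<subseteq> V"
proof -
  have "second_countable (etop E)" "second_countable (vtop E)"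
    using second_countable by (auto simp: second_countable_graph_def)
  note * = this[unfolded second_countable_def]
  show "countable edge_base" "U \<in> edge_base \<Longrightarrow> openin (etop E) U"
    "openin (etop E) U \<Longrightarrow> x \<in> U \<Longrightarrow> \<exists>V\<in>edge_base. x \<in> V \<and> V \<subseteq> U"
    using someI_ex[OF *(1), folded edge_base_def] by blast+
  show "countable vertex_base" "V \<in> vertex_base \<Longrightarrow> openin (vtop E) V"
    "openin (vtop E) V \<Longrightarrow> v \<in> V \<Longrightarrow> \<exists>W\<in>vertex_base. v \<in> W \<and> W \<subseteq> V"
    using someI_ex[OF *(2), folded vertex_base_def] by blast+
qed

text \<open>The last family of sets is not open; together with the others it still yields a countable
  network, which is enough to see that the Borel sets are generated by the coordinates.\<close>

definition subnetwork :: "('v, 'e) path set set" where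
  "subnetwork = {edge_set i U | i U. U \<in> edge_base} \<union> range_set ` vertex_base \<union>
     range (\<lambda>i. boundary_paths E - edge_set i (topspace (etop E)))"

definition network :: "('v, 'e) path set set" where
  "network = {boundary_paths E \<inter> \<Inter>\<D> | \<D>. finite \<D> \<and> \<D> \<subseteq> subnetwork}"

lemma countable_network: "countable network"
proof -
  have "{edge_set i U | i U. U \<in> edge_base} = (\<lambda>(i, U). edge_set i U) ` (UNIV \<times> edge_base)"
    by auto
  then have "countable subnetwork"
    using edge_base(1) vertex_base(1) by (auto simp: subnetwork_def)
  then have "countable {\<D>. finite \<D> \<and> \<D> \<subseteq> subnetwork}"
    by (rule countable_Collect_finite_subset)
  moreover have "network = (\<lambda>\<D>. boundary_paths E \<inter> \<Inter>\<D>) ` {\<D>. finite \<D> \<and> \<D> \<subseteq> subnetwork}"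
    by (auto simp: network_def)
  ultimately show ?thesis by simp
qed

lemma network_Int: "A \<in> network \<Longrightarrow> B \<in> network \<Longrightarrow> A \<inter> B \<in> network"
proof -
  assume "A \<in> network" "B \<in> network"
  then obtain \<C> \<D> where "A = boundary_paths E \<inter> \<Inter>\<C>" "finite \<C>" "\<C> \<subseteq> subnetwork"
    "B = boundary_paths E \<inter> \<Inter>\<D>" "finite \<D>" "\<D> \<subseteq> subnetwork" by (auto simp: network_def)
  then show ?thesis
    unfolding network_def by (intro CollectI exI[of _ "\<C> \<union> \<D>"]) auto
qed

lemma subnetwork_in_network:
  assumes "A \<in> subnetwork"
  shows "A \<in> network"
proof -
  have "A \<subseteq> boundary_paths E"
    using assms by (auto simp: subnetwork_def edge_set_def range_set_def)
  then have "A = boundary_paths E \<inter> \<Inter>{A}" by auto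
  with assms show ?thesis unfolding network_def by blast
qed

lemma network_finite_INT:
  assumes "finite I" "x \<in> boundary_paths E"
    and "\<And>i. i \<in> I \<Longrightarrow> \<exists>B\<in>network. x \<in> B \<and> (\<forall>y\<in>B. P i y)"
  shows "\<exists>B\<in>network. x \<in> B \<and> (\<forall>y\<in>B. \<forall>i\<in>I. P i y)"
  using assms(1,3)
proof (induction I rule: finite_induct)
  case empty
  have "boundary_paths E \<inter> \<Inter>{} \<in> network" unfolding network_def by blast
  then show ?case using assms(2) by auto
next
  case (insert i I)
  have "\<exists>B\<in>network. x \<in> B \<and> (\<forall>y\<in>B. \<forall>i\<in>I. P i y)"
    by (rule insert.IH) (simp add: insert.prems)
  then obtain B where B: "B \<in> network" "x \<in> B" "\<forall>y\<in>B. \<forall>i\<in>I. P i y" by blast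
  obtain C where C: "C \<in> network" "x \<in> C" "\<forall>y\<in>C. P i y" using insert.prems[of i] by blast
  show ?case
    using B C network_Int[of B C] by (intro bexI[of _ "B \<inter> C"]) auto
qed

text \<open>A neighbourhood of the initial segment contains a box, so finitely many conditions on
  edges with values in the countable base suffice; for \<open>n = 0\<close> it is one condition on
  the range.\<close>

lemma network_nbhd:
  assumes x: "x \<in> boundary_paths E" and n: "enat n \<le> plen x"
    and U: "openin (finite_path_topology E) U" "trunc E n x \<in> U"
  shows "\<exists>B\<in>network. x \<in> B \<and> (\<forall>y\<in>B. enat n \<le> plen y \<and> trunc E n y \<in> U)"
proof -
  have Un: "openin (path_topology E n) (U \<inter> paths_of_length E n)"
    using U(1) by (simp add: openin_finite_path_topology)
  have tn: "trunc E n x \<in> U \<inter> paths_of_length E n"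
    using U(2) trunc_in_paths_of_length[OF boundary_all[OF x] n] by simp
  show ?thesis
  proof (cases "n = 0")
    case True
    then obtain V where V: "openin (vtop E) V" "U \<inter> paths_of_length E n = Vertex ` V"
      using Un openin_path_topology_0[of E "U \<inter> paths_of_length E n"] by auto
    have "rng E x \<in> V" using tn V(2) True by (auto simp: trunc_def)
    then obtain W where W: "W \<in> vertex_base" "rng E x \<in> W" "W \<subseteq> V" using vertex_base(3)[OF V(1)] by blast
    have "range_set W \<in> network" using W(1) by (intro subnetwork_in_network) (auto simp: subnetwork_def)
    moreover have "x \<in> range_set W" using x W(2) by (simp add: range_set_def)
    moreover have "enat n \<le> plen y \<and> trunc E n y \<in> U" if "y \<in> range_set W" for y
      using that W(3) V(2) True by (auto simp: range_set_def trunc_def zero_enat_def[symmetric])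
    ultimately show ?thesis by blast
  next
    case False
    obtain W where W: "\<forall>i<n. openin (etop E) (W i) \<and> pedge i (trunc E n x) \<in> W i"
      "\<forall>q\<in>paths_of_length E n. (\<forall>i<n. pedge i q \<in> W i) \<longrightarrow> q \<in> U \<inter> paths_of_length E n"
      using bspec[OF conjunct2[OF Un[unfolded openin_path_topology_pos[OF False]]] tn]
      by (elim exE conjE)
    have "\<exists>B\<in>network. x \<in> B \<and> (\<forall>y\<in>B. y \<in> boundary_paths E \<and> enat i < plen y \<and> pedge i y \<in> W i)"
      if i: "i \<in> {..<n}" for i
    proof -
      have "openin (etop E) (W i)" "pedge i x \<in> W i" using W(1) i n by (auto simp: pedge_trunc)
      then obtain V where V: "V \<in> edge_base" "pedge i x \<in> V" "V \<subseteq> W i"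
        using edge_base(3)[of "W i"] by blast
      have "edge_set i V \<in> network" using V(1) by (intro subnetwork_in_network) (auto simp: subnetwork_def)
      moreover have "enat i < plen x" using i n by (metis enat_ord_simps(2) lessThan_iff order_less_le_trans)
      then have "x \<in> edge_set i V" using x V(2) by (simp add: edge_set_def)
      ultimately show ?thesis using V(3) by (intro bexI[of _ "edge_set i V"]) (auto simp: edge_set_def)
    qed
    then obtain B where B: "B \<in> network" "x \<in> B"
      "\<forall>y\<in>B. \<forall>i\<in>{..<n}. y \<in> boundary_paths E \<and> enat i < plen y \<and> pedge i y \<in> W i"
      using network_finite_INT[OF _ x, of "{..<n}" "\<lambda>i y. y \<in> boundary_paths E \<and> enat i < plen y \<and> pedge i y \<in> W i"]
      by blast
    have "enat n \<le> plen y \<and> trunc E n y \<in> U" if y: "y \<in> B" for y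
    proof -
      have yi: "y \<in> boundary_paths E" "enat i < plen y" "pedge i y \<in> W i" if "i < n" for i
        using B(3) y that by auto
      \<comment> \<open>The edge of index \<open>n - 1\<close> exists, so \<open>y\<close> has
        length at least \<open>n\<close>.\<close>
      have len: "enat n \<le> plen y" using yi(2)[of "n - 1"] False by (cases n) (auto simp: Suc_ile_eq)
      then have "trunc E n y \<in> paths_of_length E n" "\<forall>i<n. pedge i (trunc E n y) \<in> W i"
        using yi False by (auto simp: pedge_trunc intro: trunc_in_paths_of_length boundary_all)
      then show ?thesis using W(2) len by blast
    qed
    then show ?thesis using B by blast
  qed
qed

text \<open>Only a basic set needs work: \<open>x\<close> lies in the first cylinder because of a
  single initial segment, and avoiding the cylinder of \<open>K\<close> concerns only the bounded
  range of lengths that occur in \<open>K\<close>.\<close>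

lemma network_open:
  assumes "openin (boundary_topology E) W" "x \<in> W"
  shows "\<exists>B\<in>network. x \<in> B \<and> B \<subseteq> W"
proof -
  have "generate_topology_on {cylinder E U - cylinder E K | U K.
          openin (finite_path_topology E) U \<and> compactin (finite_path_topology E) K} W"
    using assms(1) unfolding boundary_topology_def by (simp add: openin_topology_generated_by_iff)
  then show ?thesis using assms(2)
  proof (induction W)
    case Empty
    then show ?case by simp
  next
    case (Int A B)
    then obtain C D where "C \<in> network" "x \<in> C" "C \<subseteq> A" "D \<in> network" "x \<in> D" "D \<subseteq> B" by blast
    then show ?case using network_Int by (intro bexI[of _ "C \<inter> D"]) auto
  next
    case (UN K)
    then obtain A where A: "A \<in> K" "x \<in> A" by blast
    then obtain B where "B \<in> network" "x \<in> B" "B \<subseteq> A" using UN.IH[OF A] by blast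
    then show ?case using A(1) by (intro bexI[of _ B]) auto
  next
    case (Basis W)
    then obtain U K where W: "W = cylinder E U - cylinder E K"
      and U: "openin (finite_path_topology E) U" and K: "compactin (finite_path_topology E) K" by blast
    have xW: "x \<in> cylinder E U" "x \<notin> cylinder E K" using Basis.prems by (simp_all add: W)
    have x: "x \<in> boundary_paths E" using xW(1) by (simp add: cylinder_def)
    have xK: "trunc E n x \<notin> K" if "enat n \<le> plen x" for n
      using xW(2) x that by (auto simp: cylinder_eq)
    obtain k where k: "enat k \<le> plen x" "trunc E k x \<in> U"
      using xW(1) by (auto simp: cylinder_eq)
    obtain B1 where B1: "B1 \<in> network" "x \<in> B1" "\<forall>y\<in>B1. enat k \<le> plen y \<and> trunc E k y \<in> U"
      using network_nbhd[OF x k(1) U k(2)] by blast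
    have openV: "openin (finite_path_topology E) (finite_paths E - K)"
      using compactin_imp_closedin[OF Hausdorff_finite_path_topology K]
      by (simp add: closedin_def topspace_finite_path_topology)
    obtain N where N: "\<forall>n. \<forall>q\<in>K. q \<in> paths_of_length E n \<longrightarrow> n < N"
      using compactin_bounded_length[OF K] by blast
    \<comment> \<open>For \<open>n\<close> up to the length of \<open>x\<close>, the complement of
      the closed set \<open>K\<close> is a neighbourhood of the initial segment. For larger
      \<open>n\<close>, a non-open member of the subnetwork is used: its elements are too short to
      have an initial segment of length \<open>n\<close>.\<close>
    have avoid: "\<exists>B\<in>network. x \<in> B \<and> (\<forall>y\<in>B. y \<in> boundary_paths E \<and> (enat n \<le> plen y \<longrightarrow> trunc E n y \<notin> K))" for n
    proof (cases "enat n \<le> plen x")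
      case True
      have "trunc E n x \<in> finite_paths E - K"
        using xK[OF True] trunc_in_paths_of_length[OF boundary_all[OF x] True]
        by (auto simp: finite_paths_def)
      then obtain B where "B \<in> network" "x \<in> B" "\<forall>y\<in>B. enat n \<le> plen y \<and> trunc E n y \<in> finite_paths E - K"
        using network_nbhd[OF x True openV] by blast
      moreover have "B \<subseteq> boundary_paths E" using \<open>B \<in> network\<close> by (auto simp: network_def)
      ultimately show ?thesis by blast
    next
      case False
      then obtain m where m: "n = Suc m" by (cases n) (auto simp: zero_enat_def[symmetric])
      let ?B = "boundary_paths E - edge_set m (topspace (etop E))"
      have "?B \<in> network" by (intro subnetwork_in_network) (auto simp: subnetwork_def)
      moreover have "x \<in> ?B" using x False m by (auto simp: edge_set_def Suc_ile_eq)
      moreover have "\<not> enat n \<le> plen y" if "y \<in> ?B" for y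
        using that m pedge_in_topspace[OF boundary_all] by (auto simp: edge_set_def Suc_ile_eq)
      ultimately show ?thesis by (intro bexI[of _ ?B]) auto
    qed
    obtain B2 where B2: "B2 \<in> network" "x \<in> B2"
      "\<forall>y\<in>B2. \<forall>n\<in>{..N}. y \<in> boundary_paths E \<and> (enat n \<le> plen y \<longrightarrow> trunc E n y \<notin> K)"
      using network_finite_INT[where P = "\<lambda>n y. y \<in> boundary_paths E \<and> (enat n \<le> plen y \<longrightarrow> trunc E n y \<notin> K)",
          OF finite_atMost[of N] x avoid] by blast
    have "y \<in> W" if y: "y \<in> B1 \<inter> B2" for y
    proof -
      have yb: "y \<in> boundary_paths E" using B2(3) y by blast
      have "y \<notin> cylinder E K"
      proof
        assume "y \<in> cylinder E K"
        then obtain n where n: "enat n \<le> plen y" "trunc E n y \<in> K" by (auto simp: cylinder_eq)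
        then have "n < N" using N trunc_in_paths_of_length[OF boundary_all[OF yb] n(1)] by blast
        then show False using B2(3) n y by auto
      qed
      moreover have "y \<in> cylinder E U"
        using B1(3) y yb by (auto simp: cylinder_eq)
      ultimately show ?thesis by (simp add: W)
    qed
    then show ?case using B1 B2 network_Int by (intro bexI[of _ "B1 \<inter> B2"]) auto
  qed
qed

abbreviation M :: "('v, 'e) path measure" where
  "M \<equiv> borel_of (boundary_topology E)"

lemma sigma_opens:
  "space M = boundary_paths E"
  "sets M = sigma_sets (boundary_paths E) {U. openin (boundary_topology E) U}"
proof -
  have sub: "{U. openin (boundary_topology E) U} \<subseteq> Pow (boundary_paths E)"
    using openin_subset topspace_boundary_topology by blast
  show "space M = boundary_paths E"
    unfolding borel_of_def topspace_boundary_topology by (rule space_measure_of[OF sub])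
  show "sets M = sigma_sets (boundary_paths E) {U. openin (boundary_topology E) U}"
    unfolding borel_of_def topspace_boundary_topology by (rule sets_measure_of[OF sub])
qed

lemmas space_M [simp] = sigma_opens(1)

lemma open_in_sets_M: "openin (boundary_topology E) U \<Longrightarrow> U \<in> sets M"
  by (simp add: sigma_opens sigma_sets.Basic)

definition coordinate_sets :: "('v, 'e) path set set" where
  "coordinate_sets = {edge_set i U | i U. openin (etop E) U} \<union> {range_set V | V. openin (vtop E) V}"

lemma edge_set_in_sets: "openin (etop E) U \<Longrightarrow> edge_set i U \<in> sets M"
  and range_set_in_sets: "openin (vtop E) V \<Longrightarrow> range_set V \<in> sets M"
  by (simp_all add: open_in_sets_M openin_edge_set openin_range_set)

lemma network_in_sigma_sets:
  assumes "B \<in> network"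
  shows "B \<in> sigma_sets (boundary_paths E) coordinate_sets"
proof -
  have sub: "coordinate_sets \<subseteq> Pow (boundary_paths E)"
    by (auto simp: coordinate_sets_def edge_set_def range_set_def)
  interpret S: sigma_algebra "boundary_paths E" "sigma_sets (boundary_paths E) coordinate_sets"
    by (rule sigma_algebra_sigma_sets[OF sub])
  have e: "edge_set i U \<in> sigma_sets (boundary_paths E) coordinate_sets" if "openin (etop E) U" for i U
    using that by (intro sigma_sets.Basic) (auto simp: coordinate_sets_def)
  have r: "range_set V \<in> sigma_sets (boundary_paths E) coordinate_sets" if "openin (vtop E) V" for V
    using that by (intro sigma_sets.Basic) (auto simp: coordinate_sets_def)
  have sn: "A \<in> sigma_sets (boundary_paths E) coordinate_sets" if "A \<in> subnetwork" for A
  proof -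
    have "boundary_paths E - edge_set i (topspace (etop E)) \<in> sigma_sets (boundary_paths E) coordinate_sets" for i
      by (intro S.Diff S.top e openin_topspace)
    then show ?thesis
      using that e[OF edge_base(2)] r[OF vertex_base(2)] by (auto simp: subnetwork_def)
  qed
  have "boundary_paths E \<inter> \<Inter>\<D> \<in> sigma_sets (boundary_paths E) coordinate_sets"
    if "finite \<D>" "\<D> \<subseteq> subnetwork" for \<D>
    using that
  proof (induction \<D> rule: finite_induct)
    case empty
    then show ?case by simp
  next
    case (insert A \<D>)
    have "boundary_paths E \<inter> \<Inter>(insert A \<D>) = A \<inter> (boundary_paths E \<inter> \<Inter>\<D>)" by auto
    then show ?case using insert sn by (auto simp del: Inter_insert intro!: S.Int)
  qed
  then show ?thesis using assms by (auto simp: network_def)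
qed

text \<open>Every open set is the union of the network members that it contains, and there are only
  countably many. Later measurability proofs can thus run by induction over conditions on a single
  coordinate.\<close>

lemma sets_M_eq: "sets M = sigma_sets (boundary_paths E) coordinate_sets"
proof -
  have sub: "coordinate_sets \<subseteq> Pow (boundary_paths E)"
    by (auto simp: coordinate_sets_def edge_set_def range_set_def)
  interpret S: sigma_algebra "boundary_paths E" "sigma_sets (boundary_paths E) coordinate_sets"
    by (rule sigma_algebra_sigma_sets[OF sub])
  have "U \<in> sigma_sets (boundary_paths E) coordinate_sets" if "openin (boundary_topology E) U" for U
  proof -
    have "U = \<Union>{B \<in> network. B \<subseteq> U}" using network_open[OF that] by blast
    moreover have "\<Union>{B \<in> network. B \<subseteq> U} \<in> sigma_sets (boundary_paths E) coordinate_sets"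
      using network_in_sigma_sets countable_network by (intro S.countable_Union) (auto intro: countable_subset)
    ultimately show ?thesis by simp
  qed
  then have "sigma_sets (boundary_paths E) {U. openin (boundary_topology E) U} \<subseteq>
      sigma_sets (boundary_paths E) coordinate_sets"
    by (intro sigma_sets_mono) auto
  moreover have "sigma_sets (boundary_paths E) coordinate_sets \<subseteq>
      sigma_sets (boundary_paths E) {U. openin (boundary_topology E) U}"
    by (intro sigma_sets_mono') (auto simp: coordinate_sets_def openin_edge_set openin_range_set)
  ultimately show ?thesis unfolding sigma_opens by blast
qed

lemma network_in_sets: "B \<in> network \<Longrightarrow> B \<in> sets M"
  using network_in_sigma_sets sets_M_eq by simp

end

section \<open>The shift in coordinates\<close>

lemma shift_coordinates:
  assumes "p \<in> all_paths E" "0 < plen p"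
  shows "enat i < plen (shift E p) \<longleftrightarrow> enat (Suc i) < plen p"
    "enat i < plen (shift E p) \<Longrightarrow> pedge i (shift E p) = pedge (Suc i) p"
    "rng E (shift E p) = smap E (pedge 0 p)"
proof -
  have *: "xs \<noteq> []" "smap E (hd xs) = rmap E (hd (tl xs))" if "p = Edges xs" "length xs \<noteq> 1" for xs
  proof -
    show "xs \<noteq> []" using assms that by (auto simp: zero_enat_def)
    then have "length xs > 1" using that by (cases xs) auto
    moreover have "Suc 0 < length xs \<longrightarrow> smap E (xs ! 0) = rmap E (xs ! Suc 0)"
      using assms(1) that by (auto simp: all_paths_def Edges_in_finite_paths)
    ultimately show "smap E (hd xs) = rmap E (hd (tl xs))"
      by (cases xs; cases "tl xs") auto
  qed
  show "enat i < plen (shift E p) \<longleftrightarrow> enat (Suc i) < plen p"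
    using assms by (cases p) (auto simp: zero_enat_def)
  show "enat i < plen (shift E p) \<Longrightarrow> pedge i (shift E p) = pedge (Suc i) p"
    using assms by (cases p) (auto simp: zero_enat_def nth_tl split: if_splits)
  show "rng E (shift E p) = smap E (pedge 0 p)"
  proof (cases p)
    case (Edges xs)
    then show ?thesis using *[of xs] assms(2)
      by (auto simp: hd_conv_nth zero_enat_def length_Suc_conv)
  next
    case (InfPath f)
    then show ?thesis using assms by (auto simp: all_paths_def InfPath_in_infinite_paths)
  qed (use assms in auto)
qed

lemma shift_in_infinite_paths: "p \<in> infinite_paths E \<Longrightarrow> shift E p \<in> infinite_paths E"
  by (auto simp: infinite_paths_def)

lemma plen_pos_iff: "p \<in> boundary_paths E \<Longrightarrow> p \<notin> paths_of_length E 0 \<longleftrightarrow> 0 < plen p"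
  by (cases p) (auto simp: boundary_paths_def paths_of_length_def Vertex_in_finite_paths
      Edges_in_finite_paths zero_enat_def)

lemma path_eqI:
  assumes p: "p \<in> all_paths E" "0 < plen p" and q: "q \<in> all_paths E" "0 < plen q"
    and e: "pedge 0 p = pedge 0 q" and s: "shift E p = shift E q"
  shows "p = q"
proof (cases p)
  case (Vertex v)
  then show ?thesis using p by simp
next
  case xs: (Edges xs)
  show ?thesis
  proof (cases q)
    case (Vertex v) then show ?thesis using q by simp
  next
    case (Edges ys)
    obtain x xs' y ys' where "xs = x # xs'" "ys = y # ys'"
      using xs Edges p q by (cases xs; cases ys) (auto simp: zero_enat_def)
    then show ?thesis using xs Edges e s by (auto split: if_splits)
  next
    case (InfPath f)
    then show ?thesis using xs s by (auto split: if_splits)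
  qed
next
  case (InfPath f)
  show ?thesis
  proof (cases q)
    case (Vertex v) then show ?thesis using q by simp
  next
    case (Edges ys)
    then show ?thesis using InfPath s by (auto split: if_splits)
  next
    case g: (InfPath g)
    have "f i = g i" for i using s e InfPath g by (cases i) (auto dest: fun_cong)
    then show ?thesis using InfPath g by auto
  qed
qed

context second_countable_topological_graph
begin

lemma shift_in_boundary_paths:
  assumes "p \<in> boundary_paths E" "0 < plen p"
  shows "shift E p \<in> boundary_paths E"
proof (cases p)
  case (Vertex v)
  then show ?thesis using assms by simp
next
  case (Edges xs)
  then have xs: "xs \<noteq> []" "set xs \<subseteq> topspace (etop E)" "smap E (last xs) \<in> singular_vertices E"
    "\<And>i. Suc i < length xs \<Longrightarrow> smap E (xs ! i) = rmap E (xs ! Suc i)"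
    using assms by (auto simp: boundary_paths_def Edges_in_finite_paths)
  show ?thesis
  proof (cases "length xs = 1")
    case True
    then obtain e where "xs = [e]" by (auto simp: length_Suc_conv)
    then show ?thesis using Edges xs smap_in_topspace[of e]
      by (auto simp: boundary_paths_def Vertex_in_finite_paths)
  next
    case False
    then have ne: "tl xs \<noteq> []" using xs(1) by (cases xs) auto
    have "Edges (tl xs) \<in> finite_paths E"
      using ne xs list.set_sel(2)[OF xs(1)] by (auto simp: Edges_in_finite_paths nth_tl)
    then show ?thesis using Edges False ne xs by (auto simp: boundary_paths_def last_tl)
  qed
next
  case (InfPath f)
  then show ?thesis using assms
    by (auto simp: boundary_paths_def InfPath_in_infinite_paths)
qed

text \<open>Together with \<open>path_eqI\<close>, this identifies the preimages of \<open>y\<close>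
  under the shift with the edges whose source is \<open>rng E y\<close>.\<close>

lemma shift_preimage_exists:
  assumes y: "y \<in> boundary_paths E" and e: "e \<in> topspace (etop E)" "smap E e = rng E y"
  shows "\<exists>x\<in>boundary_paths E. 0 < plen x \<and> pedge 0 x = e \<and> shift E x = y"
proof (cases y)
  case (Vertex v)
  then have "Edges [e] \<in> boundary_paths E"
    using y e by (auto simp: boundary_paths_def Edges_in_finite_paths)
  then show ?thesis using Vertex e by (intro bexI[of _ "Edges [e]"]) (auto simp: zero_enat_def)
next
  case (Edges ys)
  then have ys: "ys \<noteq> []" "set ys \<subseteq> topspace (etop E)" "smap E (last ys) \<in> singular_vertices E"
    "\<And>i. Suc i < length ys \<Longrightarrow> smap E (ys ! i) = rmap E (ys ! Suc i)"
    using y by (auto simp: boundary_paths_def Edges_in_finite_paths)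
  have "smap E ((e # ys) ! i) = rmap E ((e # ys) ! Suc i)" if "Suc i < length (e # ys)" for i
    using that ys e Edges by (cases i) (auto simp: hd_conv_nth)
  then have "Edges (e # ys) \<in> boundary_paths E"
    using ys e by (auto simp: boundary_paths_def Edges_in_finite_paths)
  then show ?thesis using Edges ys by (intro bexI[of _ "Edges (e # ys)"]) (auto simp: zero_enat_def)
next
  case (InfPath f)
  let ?g = "\<lambda>i. case i of 0 \<Rightarrow> e | Suc j \<Rightarrow> f j"
  have "InfPath ?g \<in> infinite_paths E"
    using y e InfPath by (auto simp: boundary_paths_def InfPath_in_infinite_paths split: nat.split)
  then show ?thesis using InfPath infinite_subset_boundary
    by (intro bexI[of _ "InfPath ?g"]) auto
qed

section \<open>Charts on which the shift is injective\<close>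

definition source_chart :: "'e set \<Rightarrow> bool" where
  "source_chart U \<longleftrightarrow> openin (etop E) U \<and> inj_on (smap E) U \<and>
     (\<forall>U'\<subseteq>U. openin (etop E) U' \<longrightarrow> openin (vtop E) (smap E ` U'))"

text \<open>Charts are taken from the countable base so that images and fibres of the shift split
  into countably many injective pieces.\<close>

definition chart_cover :: "'e set set" where
  "chart_cover = {U \<in> edge_base. source_chart U}"

lemma countable_chart_cover: "countable chart_cover"
  using edge_base(1) by (auto simp: chart_cover_def)

lemma chart_cover: "e \<in> topspace (etop E) \<Longrightarrow> \<exists>U\<in>chart_cover. e \<in> U"
proof -
  assume "e \<in> topspace (etop E)"
  then obtain W where W: "openin (etop E) W" "e \<in> W" "inj_on (smap E) W"
    "\<forall>U'\<subseteq>W. openin (etop E) U' \<longrightarrow> openin (vtop E) (smap E ` U')"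
    using smap_locally_injective_open by meson
  then obtain U where U: "U \<in> edge_base" "e \<in> U" "U \<subseteq> W" using edge_base(3)[OF W(1,2)] by blast
  then have "source_chart U"
    using W edge_base(2)[OF U(1)] inj_on_subset unfolding source_chart_def
    by (meson order_trans)
  then show ?thesis using U by (auto simp: chart_cover_def)
qed

lemma positive_length_in_edge_set:
  assumes "p \<in> boundary_paths E" "0 < plen p"
  shows "\<exists>U\<in>chart_cover. p \<in> edge_set 0 U"
proof -
  have "pedge 0 p \<in> topspace (etop E)"
    using pedge_in_topspace[OF boundary_all[OF assms(1)], of 0] assms(2) by (simp add: zero_enat_def)
  then show ?thesis using chart_cover assms by (auto simp: edge_set_def zero_enat_def)
qed

lemma edge_set_0D: "p \<in> edge_set 0 U \<Longrightarrow> p \<in> all_paths E \<and> 0 < plen p \<and> pedge 0 p \<in> U"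
  using boundary_all by (auto simp: edge_set_def zero_enat_def)

text \<open>The shift forgets only the first edge, and the source of that edge is the range of the
  shifted path; on a chart the source determines the edge.\<close>

lemma inj_on_shift_edge_set:
  assumes "source_chart U"
  shows "inj_on (shift E) (edge_set 0 U)"
proof (rule inj_onI)
  fix p q assume p: "p \<in> edge_set 0 U" and q: "q \<in> edge_set 0 U" and eq: "shift E p = shift E q"
  note pq = edge_set_0D[OF p] edge_set_0D[OF q]
  then have "smap E (pedge 0 p) = smap E (pedge 0 q)"
    using shift_coordinates(3)[of p E] shift_coordinates(3)[of q E] eq by simp
  then have "pedge 0 p = pedge 0 q"
    using assms pq by (auto simp: source_chart_def dest: inj_onD)
  then show "p = q" using pq eq path_eqI by blast
qed

lemma shift_image_edge_set_0:
  assumes "U \<subseteq> topspace (etop E)"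
  shows "shift E ` edge_set 0 U = range_set (smap E ` U)"
proof (rule set_eqI, rule iffI)
  fix y assume "y \<in> shift E ` edge_set 0 U"
  then obtain x where x: "x \<in> edge_set 0 U" "y = shift E x" by blast
  then show "y \<in> range_set (smap E ` U)"
    using shift_coordinates(3)[of x E] edge_set_0D[OF x(1)] shift_in_boundary_paths[of x]
    by (auto simp: range_set_def edge_set_def)
next
  fix y assume "y \<in> range_set (smap E ` U)"
  then obtain e where y: "y \<in> boundary_paths E" "e \<in> U" "smap E e = rng E y"
    by (auto simp: range_set_def)
  then obtain x where "x \<in> boundary_paths E" "0 < plen x" "pedge 0 x = e" "shift E x = y"
    using shift_preimage_exists[of y e] assms by blast
  then show "y \<in> shift E ` edge_set 0 U"
    using y by (intro image_eqI[of _ _ x]) (auto simp: edge_set_def zero_enat_def)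
qed

text \<open>Induction over the generating coordinate sets. It goes through because the shift is
  injective on the chart, so that images commute with complements.\<close>

lemma shift_image_chart_in_sets:
  assumes U: "source_chart U" and A: "A \<in> sets M"
  shows "shift E ` (A \<inter> edge_set 0 U) \<in> sets M"
proof -
  have oU: "openin (etop E) U" and Usub: "U \<subseteq> topspace (etop E)"
    using U openin_subset by (auto simp: source_chart_def)
  have inj: "inj_on (shift E) (edge_set 0 U)" by (rule inj_on_shift_edge_set[OF U])
  have os: "openin (vtop E) (smap E ` U')" if "U' \<subseteq> U" "openin (etop E) U'" for U'
    using U that by (auto simp: source_chart_def)
  have whole: "shift E ` edge_set 0 U \<in> sets M"
    unfolding shift_image_edge_set_0[OF Usub] by (rule range_set_in_sets[OF os[OF order_refl oU]])
  have "A \<in> sigma_sets (boundary_paths E) coordinate_sets" using A sets_M_eq by simp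
  then show ?thesis
  proof (induction A)
    case (Basic A)
    then consider i W where "A = edge_set i W" "openin (etop E) W"
      | V where "A = range_set V" "openin (vtop E) V"
      by (auto simp: coordinate_sets_def)
    then show ?case
    proof cases
      case 1
      show ?thesis
      proof (cases i)
        case 0
        \<comment> \<open>A condition on the first edge becomes a condition on the range of the
          shifted path, open because the source map is open on the chart.\<close>
        have "A \<inter> edge_set 0 U = edge_set 0 (W \<inter> U)" using 1 0 by (auto simp: edge_set_def)
        then have "shift E ` (A \<inter> edge_set 0 U) = range_set (smap E ` (W \<inter> U))"
          using shift_image_edge_set_0[of "W \<inter> U"] Usub by auto
        then show ?thesis using 1 oU by (simp add: range_set_in_sets os openin_Int)
      next
        case (Suc j)
        \<comment> \<open>A condition on a later edge is the same condition on the shifted path,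
          with the index lowered by one.\<close>
        have "shift E x \<in> edge_set j W \<longleftrightarrow> x \<in> A" if "x \<in> edge_set 0 U" for x
          using edge_set_0D[OF that] shift_coordinates(1,2)[of x E j] shift_in_boundary_paths[of x] that
          unfolding 1 Suc edge_set_def by auto
        then have "shift E ` (A \<inter> edge_set 0 U) = edge_set j W \<inter> shift E ` edge_set 0 U"
          by blast
        then show ?thesis using whole 1 by (simp add: edge_set_in_sets sets.Int)
      qed
    next
      case 2
      let ?W = "{e \<in> topspace (etop E). rmap E e \<in> V}"
      have oW: "openin (etop E) ?W"
        using continuous_rmap 2(2) by (simp add: continuous_map_def)
      \<comment> \<open>On paths of positive length, a condition on the range is one on the first
        edge.\<close>
      have "x \<in> A \<longleftrightarrow> pedge 0 x \<in> ?W" if "x \<in> edge_set 0 U" for x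
        using edge_set_0D[OF that] rng_eq_rmap_pedge[of x E] that Usub
        unfolding 2 range_set_def edge_set_def by auto
      then have "A \<inter> edge_set 0 U = edge_set 0 (?W \<inter> U)"
        by (auto simp: edge_set_def)
      then have "shift E ` (A \<inter> edge_set 0 U) = range_set (smap E ` (?W \<inter> U))"
        using shift_image_edge_set_0[of "?W \<inter> U"] Usub by auto
      then show ?thesis using oW oU by (simp add: range_set_in_sets os openin_Int)
    qed
  next
    case Empty
    then show ?case by simp
  next
    case (Compl A)
    have "shift E ` ((boundary_paths E - A) \<inter> edge_set 0 U) =
        shift E ` edge_set 0 U - shift E ` (A \<inter> edge_set 0 U)"
    proof -
      have "(boundary_paths E - A) \<inter> edge_set 0 U = edge_set 0 U - A \<inter> edge_set 0 U"
        by (auto simp: edge_set_def)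
      then show ?thesis using inj_on_image_set_diff[OF inj] by auto
    qed
    then show ?case using Compl.IH whole by (simp add: sets.Diff)
  next
    case (Union A)
    have "shift E ` (\<Union>(range A) \<inter> edge_set 0 U) = (\<Union>i. shift E ` (A i \<inter> edge_set 0 U))"
      by blast
    then show ?case using Union.IH by (auto intro!: sets.countable_UN)
  qed
qed

lemma shift_image_in_sets:
  assumes A: "A \<in> sets M" "A \<subseteq> boundary_paths E - paths_of_length E 0"
  shows "shift E ` A \<in> sets M"
proof -
  have "A = (\<Union>U\<in>chart_cover. A \<inter> edge_set 0 U)"
    using A(2) positive_length_in_edge_set plen_pos_iff by fastforce
  then have "shift E ` A = (\<Union>U\<in>chart_cover. shift E ` (A \<inter> edge_set 0 U))"
    by (metis image_UN)
  then show ?thesis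
    using shift_image_chart_in_sets[OF _ A(1)] countable_chart_cover
    by (auto simp: chart_cover_def intro!: sets.countable_UN')
qed

section \<open>Borel sets of infinite paths\<close>

lemma infinite_paths_in_sets: "infinite_paths E \<in> sets M"
proof -
  have "infinite_paths E = (\<Inter>i. edge_set i (topspace (etop E)))"
  proof (intro set_eqI iffI)
    fix p assume "p \<in> infinite_paths E"
    then show "p \<in> (\<Inter>i. edge_set i (topspace (etop E)))"
      using infinite_subset_boundary[of E]
      by (auto simp: edge_set_def infinite_paths_def)
  next
    fix p assume p: "p \<in> (\<Inter>i. edge_set i (topspace (etop E)))"
    then have "enat i < plen p" for i by (auto simp: edge_set_def)
    then have "plen p = \<infinity>" by (metis enat_iless less_irrefl not_infinity_eq)
    then show "p \<in> infinite_paths E"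
      using p infinite_iff_plen boundary_all by (auto simp: edge_set_def)
  qed
  then show ?thesis by (auto simp: edge_set_in_sets intro!: sets.countable_INT)
qed

text \<open>On infinite paths, a condition on an edge pulls back to the same condition on the next
  edge, and a condition on the range to one on the source of the first edge.\<close>

lemma shift_vimage_in_sets:
  assumes "Q \<in> sets M"
  shows "{x \<in> infinite_paths E. shift E x \<in> Q} \<in> sets M"
proof -
  have "Q \<in> sigma_sets (boundary_paths E) coordinate_sets" using assms sets_M_eq by simp
  then show ?thesis
  proof (induction Q)
    case (Basic Q)
    then consider i W where "Q = edge_set i W" "openin (etop E) W"
      | V where "Q = range_set V" "openin (vtop E) V"
      by (auto simp: coordinate_sets_def)
    then show ?case
    proof cases
      case 1
      have "{x \<in> infinite_paths E. shift E x \<in> Q} = infinite_paths E \<inter> edge_set (Suc i) W"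
        using infinite_subset_boundary[of E] by (auto simp: 1 edge_set_def infinite_paths_def)
      then show ?thesis using 1 by (simp add: infinite_paths_in_sets edge_set_in_sets sets.Int)
    next
      case 2
      let ?W = "{e \<in> topspace (etop E). smap E e \<in> V}"
      have oW: "openin (etop E) ?W"
        using continuous_smap 2(2) by (simp add: continuous_map_def)
      have "{x \<in> infinite_paths E. shift E x \<in> Q} = infinite_paths E \<inter> edge_set 0 ?W"
        using infinite_subset_boundary[of E] by (auto simp: 2 edge_set_def range_set_def infinite_paths_def)
      then show ?thesis using oW by (simp add: infinite_paths_in_sets edge_set_in_sets sets.Int)
    qed
  next
    case Empty
    then show ?case by simp
  next
    case (Compl A)
    have "{x \<in> infinite_paths E. shift E x \<in> boundary_paths E - A} =
        infinite_paths E - {x \<in> infinite_paths E. shift E x \<in> A}"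
      using shift_in_infinite_paths infinite_subset_boundary by blast
    then show ?case using Compl.IH by (simp add: infinite_paths_in_sets sets.Diff)
  next
    case (Union A)
    have "{x \<in> infinite_paths E. shift E x \<in> \<Union>(range A)} = (\<Union>i. {x \<in> infinite_paths E. shift E x \<in> A i})"
      by blast
    then show ?case using Union.IH by (auto intro!: sets.countable_UN)
  qed
qed

text \<open>Two edges differ exactly when disjoint members of the countable base separate them, so
  the complement is a countable union of coordinate conditions.\<close>

lemma periodic_in_sets:
  "{p \<in> infinite_paths E. pedge i p = pedge j p} \<in> sets M"
proof -
  define \<W> where "\<W> = {(U, V) \<in> edge_base \<times> edge_base. disjnt U V}"
  have "countable \<W>"
    by (rule countable_subset[of _ "edge_base \<times> edge_base"]) (use edge_base(1) in \<open>auto simp: \<W>_def\<close>)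
  have "{p \<in> infinite_paths E. pedge i p = pedge j p} =
    infinite_paths E - (\<Union>(U, V)\<in>\<W>. edge_set i U \<inter> edge_set j V)" (is "?L = ?R")
  proof (intro set_eqI iffI)
    fix p assume "p \<in> ?L"
    then show "p \<in> ?R" by (auto simp: \<W>_def edge_set_def disjnt_iff)
  next
    fix p assume p: "p \<in> ?R"
    have pi: "p \<in> infinite_paths E" using p by blast
    then have len: "enat k < plen p" for k by (auto simp: infinite_paths_def)
    have pb: "p \<in> boundary_paths E" using pi infinite_subset_boundary by blast
    have "pedge i p = pedge j p"
    proof (rule ccontr)
      assume ne: "pedge i p \<noteq> pedge j p"
      have "pedge i p \<in> topspace (etop E)" "pedge j p \<in> topspace (etop E)"
        using pedge_in_topspace[OF boundary_all[OF pb] len] by simp_all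
      then obtain U V where UV: "openin (etop E) U" "openin (etop E) V" "pedge i p \<in> U" "pedge j p \<in> V" "disjnt U V"
        using Hausdorff_spaceE[OF Hausdorff_etop _ _ ne] by metis
      obtain U' where U': "U' \<in> edge_base" "pedge i p \<in> U'" "U' \<subseteq> U" using edge_base(3)[OF UV(1,3)] by blast
      obtain V' where V': "V' \<in> edge_base" "pedge j p \<in> V'" "V' \<subseteq> V" using edge_base(3)[OF UV(2,4)] by blast
      have "(U', V') \<in> \<W>" using U' V' UV(5) by (auto simp: \<W>_def disjnt_iff)
      moreover have "p \<in> edge_set i U' \<inter> edge_set j V'"
        using U' V' pb len by (simp add: edge_set_def)
      ultimately show False using p by blast
    qed
    then show "p \<in> ?L" using pi by simp
  qed
  moreover have "edge_set i U \<inter> edge_set j V \<in> sets M" if "(U, V) \<in> \<W>" for U V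
    using that edge_base(2) by (auto simp: \<W>_def intro!: sets.Int edge_set_in_sets)
  ultimately show ?thesis
    using \<open>countable \<W>\<close> infinite_paths_in_sets by (auto intro!: sets.Diff sets.countable_UN')
qed

text \<open>Different infinite paths differ at some edge, where the base separates them. Finitely
  many points are treated at once because later a whole cycle has to be avoided.\<close>

lemma separate_finite:
  assumes y: "y \<in> infinite_paths E" and F: "finite F" "F \<subseteq> infinite_paths E" "y \<notin> F"
  shows "\<exists>B\<in>network. y \<in> B \<and> B \<inter> F = {}"
proof -
  have yb: "y \<in> boundary_paths E" using y infinite_subset_boundary by blast
  have "\<exists>B\<in>network. y \<in> B \<and> (\<forall>z\<in>B. z \<noteq> x)" if x: "x \<in> F" for x
  proof -
    obtain f g where fg: "y = InfPath f" "x = InfPath g"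
      using y subsetD[OF F(2) x] by (auto elim!: infinite_pathsE)
    then have "f \<noteq> g" using x F(3) by auto
    then obtain i where i: "f i \<noteq> g i" by (auto simp: fun_eq_iff)
    have "f i \<in> topspace (etop E)" "g i \<in> topspace (etop E)"
      using y x F(2) fg by (auto simp: InfPath_in_infinite_paths subset_iff)
    then obtain U V where UV: "openin (etop E) U" "openin (etop E) V" "f i \<in> U" "g i \<in> V" "disjnt U V"
      using Hausdorff_spaceE[OF Hausdorff_etop _ _ i] by metis
    obtain U' where U': "U' \<in> edge_base" "f i \<in> U'" "U' \<subseteq> U" using edge_base(3)[OF UV(1,3)] by blast
    have "edge_set i U' \<in> network" using U' by (intro subnetwork_in_network) (auto simp: subnetwork_def)
    moreover have "y \<in> edge_set i U'" using yb fg U' by (simp add: edge_set_def)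
    moreover have "x \<notin> edge_set i U'" using fg U' UV by (auto simp: edge_set_def disjnt_iff)
    ultimately show ?thesis by (intro bexI[of _ "edge_set i U'"]) auto
  qed
  then obtain B where "B \<in> network" "y \<in> B" "\<forall>z\<in>B. \<forall>x\<in>F. z \<noteq> x"
    using network_finite_INT[where P = "\<lambda>x z. z \<noteq> x", OF F(1) yb] by blast
  then show ?thesis by blast
qed

text \<open>By separation, the network members that miss \<open>y\<close> cover all other infinite
  paths.\<close>

lemma singleton_in_sets:
  assumes "y \<in> infinite_paths E"
  shows "{y} \<in> sets M"
proof -
  have "{y} = infinite_paths E - \<Union>{B \<in> network. y \<notin> B}"
  proof (intro set_eqI iffI)
    fix z assume z: "z \<in> infinite_paths E - \<Union>{B \<in> network. y \<notin> B}"
    show "z \<in> {y}"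
    proof (rule ccontr)
      assume "z \<notin> {y}"
      then obtain B where "B \<in> network" "z \<in> B" "B \<inter> {y} = {}"
        using separate_finite[of z "{y}"] z assms by blast
      then show False using z by blast
    qed
  qed (use assms in auto)
  moreover have "\<Union>{B \<in> network. y \<notin> B} \<in> sets M"
    using countable_network network_in_sets
    by (intro sets.countable_Union) (auto intro: countable_subset)
  ultimately show ?thesis using infinite_paths_in_sets by (simp add: sets.Diff)
qed

section \<open>Compactness of the boundary path space over compact vertex sets\<close>

lemma limitin_trunc:
  assumes bd: "eventually (\<lambda>x. x \<in> boundary_paths E) F"
    and len: "eventually (\<lambda>x. enat k \<le> plen x) F"
    and x0: "x0 \<in> boundary_paths E" "enat k \<le> plen x0"
    and rng: "limitin (vtop E) (rng E) (rng E x0) F"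
    and edge: "\<And>i. i < k \<Longrightarrow> limitin (etop E) (pedge i) (pedge i x0) F"
  shows "limitin (finite_path_topology E) (trunc E k) (trunc E k x0) F"
  unfolding limitin_def
proof (intro conjI allI impI, goal_cases)
  case 1
  show ?case using trunc_in_paths_of_length[OF boundary_all[OF x0(1)] x0(2)]
    by (auto simp: topspace_finite_path_topology finite_paths_def)
next
  case (2 U)
  then have Un: "openin (path_topology E k) (U \<inter> paths_of_length E k)"
    by (simp add: openin_finite_path_topology)
  have tn: "trunc E k x0 \<in> U \<inter> paths_of_length E k"
    using 2 trunc_in_paths_of_length[OF boundary_all[OF x0(1)] x0(2)] by simp
  show ?case
  proof (cases "k = 0")
    case True
    then obtain V where V: "openin (vtop E) V" "U \<inter> paths_of_length E k = Vertex ` V"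
      using Un openin_path_topology_0[of E "U \<inter> paths_of_length E k"] by auto
    have "rng E x0 \<in> V" using tn V(2) True by (auto simp: trunc_def)
    then have "eventually (\<lambda>x. rng E x \<in> V) F" using rng V(1) by (simp add: limitin_def)
    then show ?thesis
      by eventually_elim (use V True in \<open>auto simp: trunc_def\<close>)
  next
    case False
    obtain W where W: "\<forall>i<k. openin (etop E) (W i) \<and> pedge i (trunc E k x0) \<in> W i"
      "\<forall>q\<in>paths_of_length E k. (\<forall>i<k. pedge i q \<in> W i) \<longrightarrow> q \<in> U \<inter> paths_of_length E k"
      using bspec[OF conjunct2[OF Un[unfolded openin_path_topology_pos[OF False]]] tn]
      by (elim exE conjE)
    have "eventually (\<lambda>x. pedge i x \<in> W i) F" if "i < k" for i
      using W(1) that edge[OF that] x0(2) by (auto simp: limitin_def pedge_trunc)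
    then have "eventually (\<lambda>x. \<forall>i\<in>{..<k}. pedge i x \<in> W i) F"
      by (intro eventually_ball_finite) auto
    with bd len show ?thesis
    proof eventually_elim
      case (elim x)
      have "trunc E k x \<in> paths_of_length E k"
        using trunc_in_paths_of_length[OF boundary_all] elim by blast
      moreover have "\<forall>i<k. pedge i (trunc E k x) \<in> W i" using elim by (simp add: pedge_trunc)
      ultimately show ?case using W(2) by blast
    qed
  qed
qed

text \<open>Converse of \<open>limitin_trunc\<close>. Each length is open, so the limit of segments
  of length \<open>k\<close> has length \<open>k\<close> itself.\<close>

lemma limitin_truncD:
  assumes "F \<noteq> bot"
    and bd: "eventually (\<lambda>x. x \<in> boundary_paths E) F"
    and len: "eventually (\<lambda>x. enat k \<le> plen x) F"
    and lim: "limitin (finite_path_topology E) (trunc E k) q F"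
  shows "q \<in> paths_of_length E k" "\<And>i. i < k \<Longrightarrow> limitin (etop E) (pedge i) (pedge i q) F"
proof -
  have ev: "eventually (\<lambda>x. trunc E k x \<in> paths_of_length E k) F"
    using bd len by eventually_elim (auto intro: trunc_in_paths_of_length boundary_all)
  have evU: "eventually (\<lambda>x. trunc E k x \<in> U) F" if "openin (finite_path_topology E) U" "q \<in> U" for U
    using lim that by (simp add: limitin_def)
  have "q \<in> finite_paths E" using limitin_topspace[OF lim] by (simp add: topspace_finite_path_topology)
  then obtain m where m: "q \<in> paths_of_length E m" by (auto simp: finite_paths_def)
  have "eventually (\<lambda>x. m = k) F"
    using ev evU[OF openin_paths_of_length m]
    by eventually_elim (rule paths_of_length_disjoint)
  then have "m = k" using assms(1) by (simp add: eventually_const)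
  with m show q: "q \<in> paths_of_length E k" by simp
  fix i assume i: "i < k"
  have qa: "q \<in> all_paths E" using \<open>q \<in> finite_paths E\<close> by (simp add: all_paths_def)
  show "limitin (etop E) (pedge i) (pedge i q) F"
    unfolding limitin_def
  proof (intro conjI allI impI)
    show "pedge i q \<in> topspace (etop E)"
      using pedge_in_topspace[OF qa] plen_paths_of_length[OF q] i by simp
    fix U assume U: "openin (etop E) U \<and> pedge i q \<in> U"
    then have "eventually (\<lambda>x. trunc E k x \<in> {p \<in> paths_of_length E k. pedge i p \<in> U}) F"
      using q i by (intro evU openin_pedge) auto
    with len show "eventually (\<lambda>x. pedge i x \<in> U) F"
      by eventually_elim (use i in \<open>auto simp: pedge_trunc\<close>)
  qed
qed

text \<open>By continuity of \<open>smap E\<close> and of \<open>rmap E\<close>, the same vertices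
  converge to both sides, and limits of vertices are unique.\<close>

lemma limitin_smap_eq_rmap:
  assumes "F \<noteq> bot"
    and bd: "eventually (\<lambda>x. x \<in> boundary_paths E) F"
    and len: "eventually (\<lambda>x. enat (Suc i) < plen x) F"
    and lim: "limitin (etop E) (pedge i) e F" "limitin (etop E) (pedge (Suc i)) e' F"
  shows "smap E e = rmap E e'"
proof -
  have 1: "limitin (vtop E) (smap E \<circ> pedge i) (smap E e) F"
    by (rule continuous_map_limit[OF continuous_smap lim(1)])
  have 2: "limitin (vtop E) (rmap E \<circ> pedge (Suc i)) (rmap E e') F"
    by (rule continuous_map_limit[OF continuous_rmap lim(2)])
  have "eventually (\<lambda>x. (rmap E \<circ> pedge (Suc i)) x = (smap E \<circ> pedge i) x) F"
    using bd len by eventually_elim (simp add: smap_pedge boundary_all)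
  from limitin_transform_eventually[OF this 2] show ?thesis
    by (rule limitin_Hausdorff_unique[OF 1 _ assms(1) Hausdorff_vtop])
qed

lemma limitin_rng_eq_rmap:
  assumes "F \<noteq> bot"
    and bd: "eventually (\<lambda>x. x \<in> boundary_paths E) F"
    and len: "eventually (\<lambda>x. enat 0 < plen x) F"
    and lim: "limitin (vtop E) (rng E) v F" "limitin (etop E) (pedge 0) e F"
  shows "v = rmap E e"
proof -
  have 1: "limitin (vtop E) (rmap E \<circ> pedge 0) (rmap E e) F"
    by (rule continuous_map_limit[OF continuous_rmap lim(2)])
  have "eventually (\<lambda>x. (rmap E \<circ> pedge 0) x = rng E x) F"
    using bd len by eventually_elim (simp add: rng_eq_rmap_pedge boundary_all zero_enat_def)
  from limitin_transform_eventually[OF this 1] show ?thesis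
    by (rule limitin_Hausdorff_unique[OF lim(1) _ assms(1) Hausdorff_vtop])
qed

text \<open>A set \<open>W\<close> that witnesses regularity of \<open>v\<close> does so for each of
  its points, hence consists of regular vertices.\<close>

lemma regular_neighbourhood:
  assumes "v \<in> regular_vertices E"
  obtains W where "openin (vtop E) W" "v \<in> W" "W \<subseteq> regular_vertices E"
    "compactin (etop E) {e \<in> topspace (etop E). rmap E e \<in> vtop E closure_of W}"
    "W \<subseteq> vtop E closure_of W"
proof -
  obtain W where W: "openin (vtop E) W" "v \<in> W"
    "compactin (vtop E) (vtop E closure_of W)"
    "compactin (etop E) {e \<in> topspace (etop E). rmap E e \<in> vtop E closure_of W}"
    "rmap E ` {e \<in> topspace (etop E). rmap E e \<in> W} = W"
    using assms unfolding regular_vertices_def by blast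
  have "W \<subseteq> topspace (vtop E)" using openin_subset[OF W(1)] .
  then have "W \<subseteq> regular_vertices E" "W \<subseteq> vtop E closure_of W"
    using W closure_of_subset unfolding regular_vertices_def by blast+
  then show ?thesis using that W by blast
qed

text \<open>The limit of an ultrafilter of boundary paths: follow the edges as long as their coordinates
  converge. If the coordinate of index \<open>n\<close> is the first one that does not converge, the limit of
  the initial segments of length \<open>n\<close> ends in a singular vertex, since near a regular vertex
  the next edge would stay in a compact set.\<close>

lemma ultra_limit_path:
  assumes F: "ultra F"
    and bd: "eventually (\<lambda>x. x \<in> boundary_paths E) F"
    and v: "limitin (vtop E) (rng E) v F"
  defines "conv \<equiv> \<lambda>i. eventually (\<lambda>x. enat i < plen x) F \<and> (\<exists>e. limitin (etop E) (pedge i) e F)"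
  shows "\<exists>x0\<in>boundary_paths E. rng E x0 = v \<and>
    (\<forall>i. enat i < plen x0 \<longrightarrow> conv i \<and> limitin (etop E) (pedge i) (pedge i x0) F) \<and>
    (\<forall>i. enat i = plen x0 \<longrightarrow> \<not> conv i)"
proof -
  have nb: "F \<noteq> bot" using F by (simp add: ultra_def)
  define g where "g i = (SOME e. limitin (etop E) (pedge i) e F)" for i
  have g: "limitin (etop E) (pedge i) (g i) F" if "conv i" for i
    unfolding g_def by (rule someI_ex) (use that in \<open>auto simp: conv_def\<close>)
  have gt: "g i \<in> topspace (etop E)" if "conv i" for i using limitin_topspace[OF g[OF that]] .
  have gs: "smap E (g i) = rmap E (g (Suc i))" if "conv i" "conv (Suc i)" for i
    using limitin_smap_eq_rmap[OF nb bd _ g[OF that(1)] g[OF that(2)]] that by (simp add: conv_def)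
  have g0: "v = rmap E (g 0)" if "conv 0"
    using limitin_rng_eq_rmap[OF nb bd _ v g[OF that]] that by (simp add: conv_def)
  show ?thesis
  proof (cases "\<forall>i. conv i")
    case True
    then have "InfPath g \<in> boundary_paths E"
      using gt gs by (auto simp: boundary_paths_def InfPath_in_infinite_paths)
    then show ?thesis using True g g0 by (intro bexI[of _ "InfPath g"]) auto
  next
    case False
    define n where "n = (LEAST n. \<not> conv n)"
    have n: "\<not> conv n" using False LeastI_ex[of "\<lambda>n. \<not> conv n"] by (simp add: n_def)
    have less: "conv i" if "i < n" for i using not_less_Least[of i "\<lambda>n. \<not> conv n"] that by (auto simp: n_def)
    define x0 :: "('v, 'e) path" where "x0 = (if n = 0 then Vertex v else Edges (map g [0..<n]))"
    \<comment> \<open>The vertex that \<open>x\<close> reaches after \<open>n\<close> edges; along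
      the ultrafilter it converges to the source of the candidate limit.\<close>
    define terminal where "terminal x = (if n = 0 then rng E x else smap E (pedge (n - 1) x))" for x
    have plen: "plen x0 = enat n" by (simp add: x0_def zero_enat_def)
    have rng: "rng E x0 = v" using g0 less by (auto simp: x0_def hd_map upt_rec[of 0])
    have fin: "x0 \<in> finite_paths E"
      using limitin_topspace[OF v] gt gs less
      by (auto simp: x0_def Vertex_in_finite_paths Edges_in_finite_paths)
    have len: "eventually (\<lambda>x. enat n \<le> plen x) F"
    proof (cases n)
      case 0 then show ?thesis by (simp add: zero_enat_def[symmetric])
    next
      case (Suc m)
      then show ?thesis using less[of m] by (simp add: conv_def Suc_ile_eq)
    qed
    have lim_end: "limitin (vtop E) terminal (src E x0) F"
    proof (cases n)
      case 0 then show ?thesis using v by (simp add: terminal_def[abs_def] x0_def)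
    next
      case (Suc m)
      have "limitin (vtop E) (smap E \<circ> pedge m) (smap E (g m)) F"
        by (rule continuous_map_limit[OF continuous_smap g]) (use less Suc in simp)
      then show ?thesis using Suc by (simp add: terminal_def[abs_def] x0_def comp_def)
    qed
    have "src E x0 \<notin> regular_vertices E"
    proof
      assume "src E x0 \<in> regular_vertices E"
      then obtain W where W: "openin (vtop E) W" "src E x0 \<in> W" "W \<subseteq> regular_vertices E"
        "compactin (etop E) {e \<in> topspace (etop E). rmap E e \<in> vtop E closure_of W}"
        "W \<subseteq> vtop E closure_of W"
        by (rule regular_neighbourhood)
      have evW: "eventually (\<lambda>x. terminal x \<in> W) F" using lim_end W by (simp add: limitin_def)
      \<comment> \<open>A path stopping after \<open>n\<close> edges would end in a singular vertex,
        but \<open>W\<close> contains only regular ones. So an edge of index \<open>n\<close>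
        exists, and it starts from the terminal vertex.\<close>
      have step: "enat n < plen x \<and> pedge n x \<in> topspace (etop E) \<and> rmap E (pedge n x) = terminal x"
        if x: "x \<in> boundary_paths E" "enat n \<le> plen x" "terminal x \<in> W" for x
      proof -
        have lt: "enat n < plen x"
        proof (rule ccontr)
          assume "\<not> enat n < plen x"
          then have "plen x = enat n" using x(2) by simp
          then have "src E x = terminal x \<and> x \<in> finite_paths E" using x(1)
            by (cases x) (auto simp: terminal_def boundary_paths_def zero_enat_def last_conv_nth Edges_in_finite_paths)
          then have "src E x \<in> singular_vertices E" using x(1)
            by (auto simp: boundary_paths_def elim: infinite_pathsE)
          then show False using \<open>src E x = terminal x \<and> _\<close> x(3) W(3) by (auto simp: singular_vertices_def)
        qed
        moreover have "rmap E (pedge n x) = terminal x"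
        proof (cases n)
          case 0
          then show ?thesis using rng_eq_rmap_pedge[OF boundary_all[OF x(1)]] lt
            by (simp add: terminal_def zero_enat_def)
        next
          case (Suc m)
          then show ?thesis using smap_pedge[OF boundary_all[OF x(1)], of m] lt by (simp add: terminal_def)
        qed
        ultimately show ?thesis using pedge_in_topspace[OF boundary_all[OF x(1)]] by simp
      qed
      have "eventually (\<lambda>x. enat n < plen x) F"
        using bd len evW by eventually_elim (use step in blast)
      moreover have "eventually (\<lambda>x. pedge n x \<in> {e \<in> topspace (etop E). rmap E e \<in> vtop E closure_of W}) F"
        using bd len evW by eventually_elim (use step W(5) in auto)
      then have "\<exists>e. limitin (etop E) (pedge n) e F"
        using compactin_ultra_limit[OF W(4) F] by blast
      ultimately show False using n by (simp add: conv_def)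
    qed
    then have "src E x0 \<in> singular_vertices E"
      using limitin_topspace[OF lim_end] by (simp add: singular_vertices_def)
    then have "x0 \<in> boundary_paths E" using fin by (simp add: boundary_paths_def)
    moreover have "limitin (etop E) (pedge i) (pedge i x0) F" if "i < n" for i
      using g[OF less[OF that]] that by (simp add: x0_def)
    ultimately show ?thesis using rng plen less n by (intro bexI[of _ x0]) auto
  qed
qed

text \<open>Supplies the compact sets on which an invariant measure has to be finite. The path that
  follows the convergent coordinates is the limit: membership in the cylinder of an open set is
  inherited from its initial segments, and avoidance of the cylinder of a compact set comes from its
  maximality.\<close>

theorem compactin_range_set:
  assumes K: "compactin (vtop E) K"
  shows "compactin (boundary_topology E) (range_set K)"
proof (rule compactin_if_ultra_limits)
  show "range_set K \<subseteq> topspace (boundary_topology E)"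
    by (auto simp: range_set_def topspace_boundary_topology)
next
  fix F assume F: "ultra F" and evK: "eventually (\<lambda>x. x \<in> range_set K) F"
  have nb: "F \<noteq> bot" using F by (simp add: ultra_def)
  have bd: "eventually (\<lambda>x. x \<in> boundary_paths E) F" and rK: "eventually (\<lambda>x. rng E x \<in> K) F"
    using evK by (eventually_elim, simp add: range_set_def)+
  obtain v where v: "v \<in> K" "limitin (vtop E) (rng E) v F"
    using compactin_ultra_limit[OF K F rK] by blast
  obtain x0 where x0: "x0 \<in> boundary_paths E" "rng E x0 = v"
    and conv: "\<And>i. enat i < plen x0 \<Longrightarrow> eventually (\<lambda>x. enat i < plen x) F \<and>
        limitin (etop E) (pedge i) (pedge i x0) F"
    and nconv: "\<And>i. enat i = plen x0 \<Longrightarrow> \<not> (eventually (\<lambda>x. enat i < plen x) F \<and>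
        (\<exists>e. limitin (etop E) (pedge i) e F))"
    using ultra_limit_path[OF F bd v(2)] by blast
  have len: "eventually (\<lambda>x. enat k \<le> plen x) F" if "enat k \<le> plen x0" for k
  proof (cases k)
    case 0 then show ?thesis by (simp add: zero_enat_def[symmetric])
  next
    case (Suc m)
    then show ?thesis using conv[of m] that by (simp add: Suc_ile_eq)
  qed
  have trunc: "limitin (finite_path_topology E) (trunc E k) (trunc E k x0) F" if k: "enat k \<le> plen x0" for k
  proof (rule limitin_trunc[OF bd len[OF k] x0(1) k])
    fix i assume "i < k"
    then have "enat i < plen x0" using k by (metis enat_ord_simps(2) order_less_le_trans)
    then show "limitin (etop E) (pedge i) (pedge i x0) F" using conv by blast
  qed (use v x0 in simp)
  have basic: "eventually (\<lambda>x. x \<in> cylinder E U - cylinder E C) F"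
    if U: "openin (finite_path_topology E) U" and C: "compactin (finite_path_topology E) C"
      and x0UC: "x0 \<in> cylinder E U - cylinder E C" for U C
  proof -
    obtain k where k: "enat k \<le> plen x0" "trunc E k x0 \<in> U" using x0UC by (auto simp: cylinder_eq)
    then have "eventually (\<lambda>x. trunc E k x \<in> U) F" using trunc[OF k(1)] U by (simp add: limitin_def)
    with bd len[OF k(1)] have evU: "eventually (\<lambda>x. x \<in> cylinder E U) F"
      by eventually_elim (auto simp: cylinder_eq)
    have "\<not> eventually (\<lambda>x. x \<in> cylinder E C) F"
    proof
      assume evC: "eventually (\<lambda>x. x \<in> cylinder E C) F"
      obtain N where N: "\<forall>n. \<forall>q\<in>C. q \<in> paths_of_length E n \<longrightarrow> n < N"
        using compactin_bounded_length[OF C] by blast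
      \<comment> \<open>Lengths in \<open>C\<close> are bounded, so the ultrafilter selects a single
        length \<open>j\<close>, and the initial segments of that length converge inside
        \<open>C\<close>.\<close>
      have "eventually (\<lambda>x. \<exists>j\<in>{..<N}. enat j \<le> plen x \<and> trunc E j x \<in> C) F"
        using evC bd
      proof eventually_elim
        case (elim x)
        then obtain j where j: "enat j \<le> plen x" "trunc E j x \<in> C" by (auto simp: cylinder_eq)
        then have "j < N" using N trunc_in_paths_of_length[OF boundary_all[OF elim(2)] j(1)] by blast
        then show ?case using j by blast
      qed
      from ultra_disj_finite[OF F finite_lessThan this]
      obtain j where j: "eventually (\<lambda>x. enat j \<le> plen x \<and> trunc E j x \<in> C) F"
        by blast
      then have lenj: "eventually (\<lambda>x. enat j \<le> plen x) F" and "eventually (\<lambda>x. trunc E j x \<in> C) F"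
        by (eventually_elim, simp)+
      then obtain q where q: "q \<in> C" "limitin (finite_path_topology E) (trunc E j) q F"
        using compactin_ultra_limit[OF C F] by blast
      note qD = limitin_truncD[OF nb bd lenj q(2)]
      \<comment> \<open>If \<open>x0\<close> were shorter than \<open>j\<close>, the coordinate at
        its end would converge together with the segments of length \<open>j\<close>, contrary to
        the maximality of \<open>x0\<close>.\<close>
      have "enat j \<le> plen x0"
      proof (rule ccontr)
        assume "\<not> enat j \<le> plen x0"
        then obtain n where n: "plen x0 = enat n" "n < j" by (cases "plen x0") auto
        have "eventually (\<lambda>x. enat n < plen x) F"
          using lenj by eventually_elim (use n(2) in \<open>metis enat_ord_simps(2) order_less_le_trans\<close>)
        then show False using nconv[of n] n qD(2)[OF n(2)] by auto
      qed
      then have "q = trunc E j x0"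
        using limitin_Hausdorff_unique[OF q(2) trunc nb Hausdorff_finite_path_topology] by blast
      then have "x0 \<in> cylinder E C" using q(1) x0(1) \<open>enat j \<le> plen x0\<close> by (auto simp: cylinder_eq)
      then show False using x0UC by blast
    qed
    then have "eventually (\<lambda>x. x \<notin> cylinder E C) F" using ultra_not_eventually[OF F] by blast
    with evU show ?thesis by eventually_elim blast
  qed
  have "eventually (\<lambda>x. x \<in> W) F" if "openin (boundary_topology E) W" "x0 \<in> W" for W
  proof -
    have "generate_topology_on {cylinder E U - cylinder E K | U K.
          openin (finite_path_topology E) U \<and> compactin (finite_path_topology E) K} W"
      using that(1) unfolding boundary_topology_def by (simp add: openin_topology_generated_by_iff)
    then show ?thesis using that(2)
    proof (induction W)
      case Empty then show ?case by simp
    next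
      case (Int A B) then show ?case by (simp add: eventually_conj_iff)
    next
      case (UN \<A>)
      then obtain A where A: "A \<in> \<A>" "x0 \<in> A" by blast
      have "eventually (\<lambda>x. x \<in> A) F" by (rule UN.IH[OF A])
      then show ?case by eventually_elim (use A in blast)
    next
      case (Basis W) then show ?case using basic by blast
    qed
  qed
  then have "limitin (boundary_topology E) (\<lambda>x. x) x0 F"
    using x0(1) by (simp add: limitin_def topspace_boundary_topology)
  moreover have "x0 \<in> range_set K" using x0 v by (simp add: range_set_def)
  ultimately show "\<exists>l\<in>range_set K. limitin (boundary_topology E) (\<lambda>x. x) l F" by blast
qed

end

section \<open>Invariant measures\<close>

lemma shift_funpow_InfPath: "(shift E ^^ m) (InfPath g) = InfPath (\<lambda>i. g (i + m))"
  by (induction m) auto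

lemma shift_funpow_in_infinite_paths: "p \<in> infinite_paths E \<Longrightarrow> (shift E ^^ m) p \<in> infinite_paths E"
  by (induction m) (auto intro: shift_in_infinite_paths)

lemma shift_in_infinite_paths_iff:
  "p \<in> boundary_paths E \<Longrightarrow> 0 < plen p \<Longrightarrow> shift E p \<in> infinite_paths E \<longleftrightarrow> p \<in> infinite_paths E"
  by (cases p) (auto simp: boundary_paths_def infinite_paths_def)

lemma infinite_paths_positive_length: "p \<in> infinite_paths E \<Longrightarrow> 0 < plen p"
  by (auto simp: infinite_paths_def)

lemma infsum_one_eq_count: "(\<Sum>\<^sub>\<infinity>x\<in>S. (1::ennreal)) = emeasure (count_space UNIV) S"
proof (cases "finite S")
  case True
  then show ?thesis by (simp add: emeasure_count_space)
next
  case False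
  then have "(\<Sum>\<^sub>\<infinity>x\<in>S. (1::ennreal)) = \<infinity>"
    by (intro infsum_superconst_infinite_ennreal[of S 1]) auto
  then show ?thesis using False by (simp add: emeasure_count_space)
qed

lemma count_image_inj_on:
  "inj_on f A \<Longrightarrow> emeasure (count_space UNIV) (f ` A) = emeasure (count_space UNIV) A"
  by (simp add: emeasure_count_space card_image finite_image_iff)

lemma measure_ray_scale:
  assumes "c > 0"
  shows "measure_ray (scale_measure (ennreal c) \<mu>) = measure_ray \<mu>"
proof (rule set_eqI, rule iffI)
  fix \<nu> assume "\<nu> \<in> measure_ray (scale_measure (ennreal c) \<mu>)"
  then obtain r where r: "r > 0" "\<nu> = scale_measure (ennreal r) (scale_measure (ennreal c) \<mu>)"
    by (auto simp: measure_ray_def)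
  then have "\<nu> = scale_measure (ennreal (r * c)) \<mu>" using assms by (simp add: ennreal_mult)
  then show "\<nu> \<in> measure_ray \<mu>" using r assms unfolding measure_ray_def by auto
next
  fix \<nu> assume "\<nu> \<in> measure_ray \<mu>"
  then obtain r where r: "r > 0" "\<nu> = scale_measure (ennreal r) \<mu>" by (auto simp: measure_ray_def)
  then have "\<nu> = scale_measure (ennreal (r / c)) (scale_measure (ennreal c) \<mu>)"
    using assms by (simp add: ennreal_mult[symmetric])
  then show "\<nu> \<in> measure_ray (scale_measure (ennreal c) \<mu>)"
    using r assms unfolding measure_ray_def by (auto intro!: exI[of _ "r / c"])
qed

lemma loop_orbit_infinite: "loop_orbit E a \<subseteq> infinite_paths E"
  by (auto simp: loop_orbit_def seq_orbit_def split: path.splits)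

text \<open>Translates offsets of sequences into iterates of the shift, the form in which invariance
  applies.\<close>

lemma in_loop_orbit_iff:
  assumes "is_loop E a"
  shows "y \<in> loop_orbit E a \<longleftrightarrow>
    y \<in> infinite_paths E \<and> (\<exists>m k. (shift E ^^ m) y = (shift E ^^ k) (loop_infinity a))"
proof -
  obtain xs where a: "a = Edges xs" using assms is_loop_cases by blast
  have orb: "InfPath h \<in> seq_orbit E f \<longleftrightarrow>
      InfPath h \<in> infinite_paths E \<and> (\<exists>m k. \<forall>i. h (i + m) = f (i + k))" for h f
    by (auto simp: seq_orbit_def)
  show ?thesis
  proof (cases y)
    case (InfPath h)
    with orb show ?thesis by (simp add: a shift_funpow_InfPath fun_eq_iff)
  qed (auto simp: a seq_orbit_def)
qed

lemma shift_in_loop_orbit_iff: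
  assumes "is_loop E a" "p \<in> boundary_paths E" "0 < plen p"
  shows "shift E p \<in> loop_orbit E a \<longleftrightarrow> p \<in> loop_orbit E a"
proof
  assume "shift E p \<in> loop_orbit E a"
  then obtain m k where "shift E p \<in> infinite_paths E" "(shift E ^^ m) (shift E p) = (shift E ^^ k) (loop_infinity a)"
    using in_loop_orbit_iff[OF assms(1)] by blast
  moreover from this have "(shift E ^^ Suc m) p = (shift E ^^ k) (loop_infinity a)"
    by (simp add: funpow_swap1)
  ultimately show "p \<in> loop_orbit E a"
    using shift_in_infinite_paths_iff[OF assms(2,3)] in_loop_orbit_iff[OF assms(1)] by blast
next
  assume "p \<in> loop_orbit E a"
  then obtain m k where p: "p \<in> infinite_paths E" and mk: "(shift E ^^ m) p = (shift E ^^ k) (loop_infinity a)"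
    using in_loop_orbit_iff[OF assms(1)] by blast
  have "(shift E ^^ m) (shift E p) = (shift E ^^ Suc k) (loop_infinity a)"
    using arg_cong[OF mk, of "shift E"] by (simp add: funpow_swap1)
  then show "shift E p \<in> loop_orbit E a"
    using shift_in_infinite_paths[OF p] in_loop_orbit_iff[OF assms(1)] by blast
qed

text \<open>Intended for the mass of a point as a function of the point, which an invariant measure
  keeps constant under the shift.\<close>

lemma loop_orbit_constant:
  assumes "is_loop E a" and c: "\<And>p. p \<in> infinite_paths E \<Longrightarrow> c (shift E p) = c p"
    and y: "y \<in> loop_orbit E a"
  shows "c y = c (loop_infinity a)"
proof -
  have pow: "c ((shift E ^^ m) p) = c p" if "p \<in> infinite_paths E" for m p
    by (induction m) (simp_all add: c shift_funpow_in_infinite_paths[OF that])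
  obtain m k where "y \<in> infinite_paths E" "(shift E ^^ m) y = (shift E ^^ k) (loop_infinity a)"
    using y in_loop_orbit_iff[OF assms(1)] by blast
  then show ?thesis using pow loop_infinity_in_infinite_paths[OF assms(1)] by metis
qed

section \<open>Saturations of sets of periodic paths\<close>

definition saturation :: "('v, 'e) tgraph \<Rightarrow> ('v, 'e) path set \<Rightarrow> ('v, 'e) path set" where
  "saturation E Q = {p \<in> infinite_paths E. \<exists>n. (shift E ^^ n) p \<in> Q}"

definition periodic_paths :: "('v, 'e) tgraph \<Rightarrow> ('v, 'e) path set" where
  "periodic_paths E = {p \<in> infinite_paths E. \<exists>q>0. \<forall>i. pedge (i + q) p = pedge i p}"

lemma periodic_pathsE:
  assumes "p \<in> periodic_paths E"
  obtains f q where "p = InfPath f" "InfPath f \<in> infinite_paths E" "q > 0" "\<forall>i. f (i + q) = f i"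
  using assms by (auto simp: periodic_paths_def infinite_paths_def)

text \<open>That the shift does not leave the saturation rests on periodicity: a path may leave
  \<open>Q\<close> at the first step, but a periodic one comes back after a full period. For
  arbitrary \<open>Q\<close> only the passage to preimages is automatic.\<close>

lemma shift_in_saturation_iff:
  assumes Q: "Q \<subseteq> periodic_paths E" and p: "p \<in> boundary_paths E" "0 < plen p"
  shows "shift E p \<in> saturation E Q \<longleftrightarrow> p \<in> saturation E Q"
proof
  assume "shift E p \<in> saturation E Q"
  then obtain n where "shift E p \<in> infinite_paths E" "(shift E ^^ Suc n) p \<in> Q"
    by (auto simp: saturation_def funpow_swap1)
  then show "p \<in> saturation E Q"
    using shift_in_infinite_paths_iff[OF p] unfolding saturation_def by blast
next
  assume "p \<in> saturation E Q"
  then obtain n where pi: "p \<in> infinite_paths E" and n: "(shift E ^^ n) p \<in> Q"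
    by (auto simp: saturation_def)
  have "\<exists>m. (shift E ^^ Suc m) p \<in> Q"
  proof (cases n)
    case 0
    then have "p \<in> periodic_paths E" using n Q by auto
    then obtain f q where "p = InfPath f" "InfPath f \<in> infinite_paths E" "q > 0" "\<forall>i. f (i + q) = f i"
      by (rule periodic_pathsE)
    then have "(shift E ^^ Suc (q - 1)) p = p" by (simp add: shift_funpow_InfPath del: funpow.simps)
    then show ?thesis using n 0 by (metis funpow_0)
  next
    case (Suc m)
    then show ?thesis using n by blast
  qed
  then show "shift E p \<in> saturation E Q"
    using shift_in_infinite_paths[OF pi] by (auto simp: saturation_def funpow_swap1)
qed

lemma shift_funpow_in_saturation_iff:
  assumes Q: "Q \<subseteq> periodic_paths E" and p: "p \<in> infinite_paths E"
  shows "(shift E ^^ n) p \<in> saturation E Q \<longleftrightarrow> p \<in> saturation E Q"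
proof (induction n)
  case (Suc n)
  have "(shift E ^^ n) p \<in> infinite_paths E" by (rule shift_funpow_in_infinite_paths[OF p])
  then show ?case
    using shift_in_saturation_iff[OF Q] infinite_subset_boundary[of E] infinite_paths_positive_length[of _ E] Suc
    by auto
qed simp

context second_countable_topological_graph
begin

lemma in_eventually_cyclic_iff:
  "p \<in> eventually_cyclic E \<longleftrightarrow>
    (\<exists>g m q. p = InfPath g \<and> InfPath g \<in> infinite_paths E \<and> q > 0 \<and> (\<forall>i\<ge>m. g (i + q) = g i))"
  by (rule eventually_cyclic_iff) (rule rmap_in_topspace)

text \<open>Reads eventual cyclicity as reaching a periodic path, from which its Borel property
  follows.\<close>

lemma eventually_cyclic_eq_saturation: "eventually_cyclic E = saturation E (periodic_paths E)"
proof (rule set_eqI)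
  fix p
  show "p \<in> eventually_cyclic E \<longleftrightarrow> p \<in> saturation E (periodic_paths E)"
  proof (cases "p \<in> infinite_paths E")
    case True
    then obtain g where g: "p = InfPath g" by (auto simp: infinite_paths_def)
    have *: "(\<forall>i\<ge>m. g (i + q) = g i) \<longleftrightarrow> (\<forall>i. g (i + q + m) = g (i + m))" for m q
    proof
      assume "\<forall>i\<ge>m. g (i + q) = g i"
      then have "g (i + m + q) = g (i + m)" for i by simp
      then show "\<forall>i. g (i + q + m) = g (i + m)" by (simp add: ac_simps)
    next
      assume R: "\<forall>i. g (i + q + m) = g (i + m)"
      show "\<forall>i\<ge>m. g (i + q) = g i"
      proof (intro allI impI)
        fix i assume "i \<ge> m"
        then show "g (i + q) = g i" using R[rule_format, of "i - m"] by simp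
      qed
    qed
    show ?thesis
      unfolding in_eventually_cyclic_iff saturation_def periodic_paths_def
      using True shift_funpow_in_infinite_paths[OF True]
      by (auto simp: g shift_funpow_InfPath *)
  next
    case False
    then show ?thesis
      using in_eventually_cyclic_iff by (auto simp: saturation_def)
  qed
qed

lemma periodic_paths_in_sets: "periodic_paths E \<in> sets M"
proof -
  have "periodic_paths E = (\<Union>q\<in>{0<..}. \<Inter>i. {p \<in> infinite_paths E. pedge (i + q) p = pedge i p})"
    by (auto simp: periodic_paths_def)
  then show ?thesis
    by (auto intro!: sets.countable_UN' sets.countable_INT periodic_in_sets)
qed

lemma saturation_in_sets:
  assumes "Q \<in> sets M"
  shows "saturation E Q \<in> sets M"
proof -
  have "{p \<in> infinite_paths E. (shift E ^^ n) p \<in> Q} \<in> sets M" for n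
  proof (induction n)
    case 0
    have "{p \<in> infinite_paths E. (shift E ^^ 0) p \<in> Q} = infinite_paths E \<inter> Q" by auto
    then show ?case using assms infinite_paths_in_sets by (simp add: sets.Int)
  next
    case (Suc n)
    have "{p \<in> infinite_paths E. (shift E ^^ Suc n) p \<in> Q} =
      {p \<in> infinite_paths E. shift E p \<in> {p \<in> infinite_paths E. (shift E ^^ n) p \<in> Q}}"
      using shift_in_infinite_paths[of _ E] by (auto simp: funpow_swap1)
    then show ?case using shift_vimage_in_sets[OF Suc] by simp
  qed
  moreover have "saturation E Q = (\<Union>n. {p \<in> infinite_paths E. (shift E ^^ n) p \<in> Q})"
    by (auto simp: saturation_def)
  ultimately show ?thesis by auto
qed

text \<open>Each chart contains at most one preimage, and countably many charts cover the paths of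
  positive length.\<close>

lemma countable_shift_fibre: "countable {y \<in> infinite_paths E. shift E y = z}"
proof -
  have "finite {y \<in> edge_set 0 U. shift E y = z}" if "U \<in> chart_cover" for U
  proof -
    have "inj_on (shift E) (edge_set 0 U)"
      using that by (intro inj_on_shift_edge_set) (simp add: chart_cover_def)
    then have "inj_on (shift E) {y \<in> edge_set 0 U. shift E y = z}"
      by (rule inj_on_subset) auto
    moreover have "shift E ` {y \<in> edge_set 0 U. shift E y = z} \<subseteq> {z}" by auto
    ultimately show ?thesis by (meson finite.emptyI finite.insertI inj_on_finite)
  qed
  then have "countable (\<Union>U\<in>chart_cover. {y \<in> edge_set 0 U. shift E y = z})"
    using countable_chart_cover by (intro countable_UN) (auto intro: countable_finite)
  moreover have "{y \<in> infinite_paths E. shift E y = z} \<subseteq> (\<Union>U\<in>chart_cover. {y \<in> edge_set 0 U. shift E y = z})"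
    using positive_length_in_edge_set infinite_subset_boundary[of E] infinite_paths_positive_length[of _ E]
    by blast
  ultimately show ?thesis by (rule countable_subset[rotated])
qed

lemma countable_shift_funpow_fibre: "countable {y \<in> infinite_paths E. (shift E ^^ m) y = z}"
proof (induction m)
  case 0
  have "{y \<in> infinite_paths E. (shift E ^^ 0) y = z} \<subseteq> {z}" by auto
  then show ?case by (rule countable_subset) simp
next
  case (Suc m)
  have "{y \<in> infinite_paths E. (shift E ^^ Suc m) y = z} \<subseteq>
    (\<Union>w\<in>{w \<in> infinite_paths E. (shift E ^^ m) w = z}. {y \<in> infinite_paths E. shift E y = w})"
    using shift_in_infinite_paths[of _ E] by (auto simp: funpow_swap1)
  then show ?case
    by (rule countable_subset) (intro countable_UN Suc countable_shift_fibre)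
qed

lemma countable_loop_orbit:
  assumes "is_loop E a"
  shows "countable (loop_orbit E a)"
proof -
  have "loop_orbit E a \<subseteq> (\<Union>(m, k). {y \<in> infinite_paths E. (shift E ^^ m) y = (shift E ^^ k) (loop_infinity a)})"
    using in_loop_orbit_iff[OF assms] by auto
  moreover have "countable (\<Union>(m, k). {y \<in> infinite_paths E. (shift E ^^ m) y = (shift E ^^ k) (loop_infinity a)})"
    by (intro countable_UN) (auto simp: countable_shift_funpow_fibre)
  ultimately show ?thesis by (rule countable_subset)
qed

lemma loop_orbit_in_sets:
  assumes "is_loop E a"
  shows "loop_orbit E a \<in> sets M"
proof -
  have "(\<Union>y\<in>loop_orbit E a. {y}) \<in> sets M"
    using countable_loop_orbit[OF assms] loop_orbit_infinite[of E a] singleton_in_sets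
    by (intro sets.countable_UN') auto
  then show ?thesis by simp
qed

lemma loop_orbit_subset_cyclic: "is_loop E a \<Longrightarrow> loop_orbit E a \<subseteq> eventually_cyclic E"
proof
  fix y assume a: "is_loop E a" and y: "y \<in> loop_orbit E a"
  obtain xs where xs: "a = Edges xs" "xs \<noteq> []" using a is_loop_cases by blast
  obtain m k where "y \<in> infinite_paths E" "(shift E ^^ m) y = (shift E ^^ k) (loop_infinity a)"
    using y in_loop_orbit_iff[OF a] by blast
  moreover have "(shift E ^^ k) (loop_infinity a) \<in> periodic_paths E"
    using xs shift_funpow_in_infinite_paths[OF loop_infinity_in_infinite_paths[OF a], of k]
    by (auto simp: periodic_paths_def shift_funpow_InfPath intro!: exI[of _ "length xs"] arg_cong[of _ _ "(!) xs"])
      (metis add.assoc add.commute mod_add_self2)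
  ultimately show "y \<in> eventually_cyclic E"
    unfolding eventually_cyclic_eq_saturation saturation_def by (auto intro!: exI[of _ m])
qed

section \<open>The measure attached to a loop\<close>

lemma sets_loop_measure [simp]: "sets (loop_measure E a) = sets M"
  unfolding loop_measure_def dirac_sum_def by (rule sets.sets_measure_of_eq)

lemma primitive_loopE:
  assumes "primitive_loop E a"
  obtains xs where "a = Edges xs" "xs \<noteq> []" "is_loop E (Edges xs)"
    "\<forall>c n. is_loop E c \<and> n \<ge> 2 \<longrightarrow> Edges xs \<noteq> loop_power E c n"
proof -
  obtain xs where "a = Edges xs" "xs \<noteq> []"
    using assms is_loop_cases unfolding primitive_loop_def by metis
  then show ?thesis using assms that unfolding primitive_loop_def by simp
qed

lemma bij_betw_approach_loop_orbit:
  assumes "primitive_loop E a"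
  shows "bij_betw (\<lambda>b. pconcat b (loop_infinity a)) (approach_paths E a) (loop_orbit E a)"
proof -
  obtain xs where a: "a = Edges xs" and *: "is_loop E (Edges xs)"
    "\<forall>c n. is_loop E c \<and> n \<ge> 2 \<longrightarrow> Edges xs \<noteq> loop_power E c n"
    using assms by (rule primitive_loopE)
  show ?thesis
    unfolding a loop_orbit_Edges loop_infinity.simps
    by (rule bij_betw_approach_paths[OF *]) (rule rmap_in_topspace)
qed

text \<open>The sum over approach paths is reindexed along the bijection with the orbit, whose
  injectivity excludes multiplicities.\<close>

lemma emeasure_loop_measure:
  assumes a: "primitive_loop E a" and A: "A \<in> sets M"
  shows "emeasure (loop_measure E a) A = emeasure (count_space UNIV) (A \<inter> loop_orbit E a)"
proof -
  have "emeasure (loop_measure E a) A = (\<Sum>\<^sub>\<infinity>b\<in>approach_paths E a. indicator A (pconcat b (loop_infinity a)))"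
    unfolding loop_measure_def using A by (simp add: emeasure_dirac_sum)
  also have "\<dots> = (\<Sum>\<^sub>\<infinity>y\<in>loop_orbit E a. indicator A y)"
    by (rule infsum_reindex_bij_betw[OF bij_betw_approach_loop_orbit[OF a]])
  also have "\<dots> = (\<Sum>\<^sub>\<infinity>y\<in>A \<inter> loop_orbit E a. 1)"
    by (rule infsum_cong_neutral) auto
  finally show ?thesis by (simp add: infsum_one_eq_count)
qed

text \<open>An approach path has the same range as the infinite path that it begins, so local
  finiteness can be counted on the orbit.\<close>

lemma summable_loop_iff:
  "summable_loop E a \<longleftrightarrow> primitive_loop E a \<and>
     (\<forall>w\<in>topspace (vtop E). \<exists>V. openin (vtop E) V \<and> w \<in> V \<and> finite (range_set V \<inter> loop_orbit E a))"
proof (cases "primitive_loop E a")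
  case True
  let ?h = "\<lambda>b. pconcat b (loop_infinity a)"
  have bij: "bij_betw ?h (approach_paths E a) (loop_orbit E a)"
    by (rule bij_betw_approach_loop_orbit[OF True])
  obtain xs where xs: "a = Edges xs" "xs \<noteq> []" using True by (rule primitive_loopE)
  have rng: "rng E (?h b) = rng E b" if "b \<in> approach_paths E a" for b
    using that xs by (cases b) (auto simp: approach_paths_def Edges_in_finite_paths hd_conv_nth)
  have "finite {b \<in> approach_paths E a. rng E b \<in> V} \<longleftrightarrow> finite (range_set V \<inter> loop_orbit E a)" for V
  proof -
    have "range_set V \<inter> loop_orbit E a = ?h ` {b \<in> approach_paths E a. rng E b \<in> V}"
    proof -
      have img: "loop_orbit E a = ?h ` approach_paths E a" using bij by (simp add: bij_betw_def)
      have "range_set V \<inter> loop_orbit E a = {y \<in> loop_orbit E a. rng E y \<in> V}"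
        using loop_orbit_infinite[of E a] infinite_subset_boundary[of E] by (auto simp: range_set_def)
      also have "\<dots> = ?h ` {b \<in> approach_paths E a. rng E b \<in> V}"
        unfolding img using rng by auto
      finally show ?thesis .
    qed
    moreover have "inj_on ?h {b \<in> approach_paths E a. rng E b \<in> V}"
      using bij unfolding bij_betw_def by (auto intro: inj_on_subset)
    ultimately show ?thesis by (simp add: finite_image_iff)
  qed
  then show ?thesis using True by (simp add: summable_loop_def primitive_loop_def)
next
  case False
  then show ?thesis by (auto simp: summable_loop_def primitive_loop_def)
qed

lemma space_invariant_measure: "invariant_measure E \<nu> \<Longrightarrow> space \<nu> = boundary_paths E"
  and sets_invariant_measure: "invariant_measure E \<nu> \<Longrightarrow> sets \<nu> = sets M"
  using sets_eq_imp_space_eq[of \<nu> M] by (auto simp: invariant_measure_def)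

text \<open>A compact set is covered by finitely many open sets \<open>range_set (V w)\<close>, each
  meeting the orbit in a finite set. Invariance holds because injections preserve cardinality and a
  path lies in the orbit exactly when its shift does.\<close>

lemma loop_measure_invariant:
  assumes a: "summable_loop E a"
  shows "invariant_measure E (loop_measure E a)"
proof -
  let ?O = "loop_orbit E a"
  have prim: "primitive_loop E a" and loop: "is_loop E a"
    using a by (auto simp: summable_loop_iff primitive_loop_def)
  have "emeasure (loop_measure E a) K < \<infinity>" if K: "compactin (boundary_topology E) K" for K
  \<comment> \<open>By convention \<open>emeasure\<close> is 0 outside the sigma-algebra, which
    settles the first case.\<close>
  proof (cases "K \<in> sets M")
    case False
    then show ?thesis by (simp add: emeasure_notin_sets)
  next
    case True
    obtain V where V: "\<And>w. w \<in> topspace (vtop E) \<Longrightarrow> openin (vtop E) (V w) \<and> w \<in> V w \<and> finite (range_set (V w) \<inter> ?O)"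
      using a unfolding summable_loop_iff by metis
    have Kb: "K \<subseteq> boundary_paths E"
      using compactin_subset_topspace[OF K] by (simp add: topspace_boundary_topology)
    let ?\<C> = "(\<lambda>w. range_set (V w)) ` topspace (vtop E)"
    have "Ball ?\<C> (openin (boundary_topology E))" using V openin_range_set by auto
    moreover have "K \<subseteq> \<Union>?\<C>"
      using Kb V rng_in_topspace boundary_all by (fastforce simp: range_set_def)
    ultimately obtain \<F> where F: "finite \<F>" "\<F> \<subseteq> ?\<C>" "K \<subseteq> \<Union>\<F>"
      using K unfolding compactin_def by meson
    have "finite (\<Union>C\<in>\<F>. C \<inter> ?O)" using F V by (intro finite_UN_I) auto
    then have "finite (K \<inter> ?O)" by (rule finite_subset[rotated]) (use F in auto)
    then show ?thesis using True by (simp add: emeasure_loop_measure[OF prim] emeasure_count_space of_nat_less_top)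
  qed
  moreover have "emeasure (loop_measure E a) (shift E ` A) = emeasure (loop_measure E a) A"
    if A: "A \<in> sets M" "A \<subseteq> boundary_paths E - paths_of_length E 0" "inj_on (shift E) A" for A
  proof -
    have "shift E p \<in> ?O \<longleftrightarrow> p \<in> ?O" if "p \<in> A" for p
      using that A(2) plen_pos_iff[of p E] by (intro shift_in_loop_orbit_iff[OF loop]) auto
    then have "shift E ` A \<inter> ?O = shift E ` (A \<inter> ?O)" by blast
    then show ?thesis
      using A shift_image_in_sets[OF A(1,2)]
      by (simp add: emeasure_loop_measure[OF prim] count_image_inj_on inj_on_Int)
  qed
  ultimately show ?thesis unfolding invariant_measure_def by simp
qed

section \<open>Invariant measures living on one orbit\<close>

lemma emeasure_shift_image:
  assumes "invariant_measure E \<nu>" "A \<in> sets M" "A \<subseteq> boundary_paths E - paths_of_length E 0"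
    "inj_on (shift E) A"
  shows "emeasure \<nu> (shift E ` A) = emeasure \<nu> A"
  using assms by (simp add: invariant_measure_def)

lemma invariant_measure_singleton:
  assumes "invariant_measure E \<nu>" "p \<in> infinite_paths E"
  shows "emeasure \<nu> {shift E p} = emeasure \<nu> {p}"
proof -
  have "p \<in> boundary_paths E" using assms(2) infinite_subset_boundary by blast
  then have "{p} \<subseteq> boundary_paths E - paths_of_length E 0"
    using plen_pos_iff[of p E] infinite_paths_positive_length[OF assms(2)] by auto
  then have "emeasure \<nu> (shift E ` {p}) = emeasure \<nu> {p}"
    by (intro emeasure_shift_image assms singleton_in_sets) auto
  then show ?thesis by simp
qed

text \<open>Countability of the orbit reduces the measure to a sum of point masses, and these are
  equal by invariance.\<close>

lemma emeasure_orbit_concentrated: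
  assumes inv: "invariant_measure E \<nu>" and a: "is_loop E a"
    and null: "emeasure \<nu> (boundary_paths E - loop_orbit E a) = 0" and A: "A \<in> sets M"
  shows "emeasure \<nu> A = emeasure \<nu> {loop_infinity a} * emeasure (count_space UNIV) (A \<inter> loop_orbit E a)"
proof -
  let ?O = "loop_orbit E a"
  have sets: "sets \<nu> = sets M" by (rule sets_invariant_measure[OF inv])
  have O: "?O \<in> sets \<nu>" using loop_orbit_in_sets[OF a] sets by simp
  have "A - ?O \<subseteq> boundary_paths E - ?O" using sets.sets_into_space[OF A] by auto
  then have "emeasure \<nu> (A - ?O) \<le> 0"
    using null O A sets by (metis emeasure_mono sets.Diff sets.top space_invariant_measure[OF inv])
  moreover have "emeasure \<nu> A = emeasure \<nu> (A \<inter> ?O) + emeasure \<nu> (A - ?O)"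
    using A O sets by (subst plus_emeasure) (auto intro!: arg_cong[of _ _ "emeasure \<nu>"])
  ultimately have "emeasure \<nu> A = emeasure \<nu> (A \<inter> ?O)" by simp
  also have "\<dots> = (\<integral>\<^sup>+y. emeasure \<nu> {y} \<partial>count_space (A \<inter> ?O))"
    using countable_loop_orbit[OF a] loop_orbit_infinite[of E a] singleton_in_sets sets
    by (intro emeasure_countable_singleton) auto
  also have "\<dots> = (\<integral>\<^sup>+y. emeasure \<nu> {loop_infinity a} \<partial>count_space (A \<inter> ?O))"
    using loop_orbit_constant[OF a, of "\<lambda>y. emeasure \<nu> {y}"] invariant_measure_singleton[OF inv]
    by (intro nn_integral_cong) auto
  also have "\<dots> = emeasure \<nu> {loop_infinity a} * emeasure (count_space UNIV) (A \<inter> ?O)"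
    by (simp add: emeasure_count_space)
  finally show ?thesis .
qed

lemma orbit_concentrated_eq_scale:
  assumes inv: "invariant_measure E \<nu>" and a: "primitive_loop E a"
    and null: "emeasure \<nu> (boundary_paths E - loop_orbit E a) = 0"
    and c: "emeasure \<nu> {loop_infinity a} = ennreal c"
  shows "\<nu> = scale_measure (ennreal c) (loop_measure E a)"
proof (rule measure_eqI)
  show "sets \<nu> = sets (scale_measure (ennreal c) (loop_measure E a))"
    using sets_invariant_measure[OF inv] by simp
  fix A assume "A \<in> sets \<nu>"
  then have A: "A \<in> sets M" using sets_invariant_measure[OF inv] by simp
  then show "emeasure \<nu> A = emeasure (scale_measure (ennreal c) (loop_measure E a)) A"
    using emeasure_orbit_concentrated[OF inv _ null A] a c
    by (simp add: emeasure_loop_measure[OF a A] primitive_loop_def)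
qed

lemma loop_measure_off_orbit:
  assumes "primitive_loop E a"
  shows "emeasure (loop_measure E a) (boundary_paths E - loop_orbit E a) = 0"
proof -
  have "boundary_paths E - loop_orbit E a \<in> sets M"
    using loop_orbit_in_sets[of a] assms sets.top[of M] by (auto simp: primitive_loop_def)
  then show ?thesis using assms by (simp add: emeasure_loop_measure Diff_Int2 Int_commute)
qed

text \<open>Both summands of a decomposition are dominated by the measure of the loop: they vanish
  off the orbit, and the mass of the point \<open>loop_infinity a\<close> is at most 1, which makes
  the factor finite.\<close>

lemma loop_measure_extremal:
  assumes a: "summable_loop E a"
  shows "extremal_measure E (loop_measure E a)"
proof -
  let ?\<mu> = "loop_measure E a"
  have prim: "primitive_loop E a" and loop: "is_loop E a"
    using a by (auto simp: summable_loop_iff primitive_loop_def)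
  have N: "boundary_paths E - loop_orbit E a \<in> sets M"
    using loop_orbit_in_sets[OF loop] sets.top[of M] by auto
  have S: "{loop_infinity a} \<in> sets M"
    by (intro singleton_in_sets loop_infinity_in_infinite_paths[OF loop])
  have one: "emeasure ?\<mu> {loop_infinity a} = 1"
    using loop_infinity_in_loop_orbit[OF loop] S by (simp add: emeasure_loop_measure[OF prim] emeasure_count_space)
  have key: "\<exists>c\<ge>0. \<nu> = scale_measure (ennreal c) ?\<mu>"
    if inv: "invariant_measure E \<nu>" and le: "\<And>A. A \<in> sets M \<Longrightarrow> emeasure \<nu> A \<le> emeasure ?\<mu> A" for \<nu>
  proof -
    have "emeasure \<nu> {loop_infinity a} \<le> 1" using le[OF S] one by simp
    then obtain c where c: "c \<ge> 0" "emeasure \<nu> {loop_infinity a} = ennreal c"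
      by (metis ennreal_cases ennreal_one_less_top leD infinity_ennreal_def)
    have "emeasure \<nu> (boundary_paths E - loop_orbit E a) = 0"
      using le[OF N] loop_measure_off_orbit[OF prim] by simp
    then show ?thesis using orbit_concentrated_eq_scale[OF inv prim _ c(2)] c(1) by blast
  qed
  show ?thesis
    unfolding extremal_measure_def
  proof (intro conjI allI impI, goal_cases)
    case 1
    show ?case by (rule loop_measure_invariant[OF a])
  next
    case (2 \<nu>1 \<nu>2)
    then have sum: "emeasure ?\<mu> A = emeasure \<nu>1 A + emeasure \<nu>2 A" if "A \<in> sets M" for A
      using that by simp
    have "\<exists>c\<ge>0. \<nu>1 = scale_measure (ennreal c) ?\<mu>" "\<exists>c\<ge>0. \<nu>2 = scale_measure (ennreal c) ?\<mu>"
      using 2 by (auto intro!: key simp: sum)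
    then show ?case by blast
  qed
qed

lemma loop_measure_ray_in_cyclic_extremal_rays:
  assumes a: "summable_loop E a"
  shows "measure_ray (loop_measure E a) \<in> cyclic_extremal_rays E"
proof -
  let ?\<mu> = "loop_measure E a"
  have prim: "primitive_loop E a" and loop: "is_loop E a"
    using a by (auto simp: summable_loop_iff primitive_loop_def)
  have inv: "invariant_measure E ?\<mu>" by (rule loop_measure_invariant[OF a])
  have sp: "space ?\<mu> = boundary_paths E" by (rule space_invariant_measure[OF inv])
  have N: "boundary_paths E - loop_orbit E a \<in> sets M"
    using loop_orbit_in_sets[OF loop] sets.top[of M] by auto
  have conc: "concentrated_on ?\<mu> B" if "loop_orbit E a \<subseteq> B" "B \<in> sets M" for B
  proof -
    have "emeasure ?\<mu> (boundary_paths E - B) \<le> emeasure ?\<mu> (boundary_paths E - loop_orbit E a)"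
      using that N by (intro emeasure_mono) auto
    then show ?thesis using that loop_measure_off_orbit[OF prim] by (simp add: concentrated_on_def sp)
  qed
  have "emeasure ?\<mu> (space ?\<mu>) \<noteq> 0"
  proof -
    have "boundary_paths E \<inter> loop_orbit E a \<noteq> {}"
      using loop_infinity_in_loop_orbit[OF loop] loop_orbit_infinite[of E a] infinite_subset_boundary[of E] by blast
    then show ?thesis
      using sets.top[of M] by (simp add: sp emeasure_loop_measure[OF prim] emeasure_count_space card_eq_0_iff)
  qed
  moreover have "harmonic_measure E ?\<mu>"
    unfolding harmonic_measure_def using inv conc loop_orbit_infinite infinite_paths_in_sets by blast
  moreover have "eventually_cyclic E \<in> sets M"
    unfolding eventually_cyclic_eq_saturation by (intro saturation_in_sets periodic_paths_in_sets)
  then have "concentrated_on ?\<mu> (eventually_cyclic E)"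
    using conc loop_orbit_subset_cyclic[OF loop] by blast
  ultimately show ?thesis
    using loop_measure_extremal[OF a] unfolding cyclic_extremal_rays_def by blast
qed

section \<open>The zero-one law and the support of an extremal measure\<close>

lemma invariant_measure_restrict:
  assumes inv: "invariant_measure E \<nu>" and B: "B \<in> sets M"
    and shift_B: "\<And>p. p \<in> boundary_paths E \<Longrightarrow> 0 < plen p \<Longrightarrow> shift E p \<in> B \<longleftrightarrow> p \<in> B"
  shows "invariant_measure E (density \<nu> (indicator B))"
proof -
  have sets: "sets \<nu> = sets M" by (rule sets_invariant_measure[OF inv])
  have em: "emeasure (density \<nu> (indicator B)) A = emeasure \<nu> (B \<inter> A)" if "A \<in> sets M" for A
    using that B sets by (intro emeasure_restricted) auto
  have "emeasure (density \<nu> (indicator B)) K < \<infinity>" if K: "compactin (boundary_topology E) K" for K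
  proof (cases "K \<in> sets M")
    case False
    then show ?thesis using sets by (simp add: emeasure_notin_sets)
  next
    case True
    have "emeasure \<nu> (B \<inter> K) \<le> emeasure \<nu> K" using True sets by (intro emeasure_mono) auto
    also have "\<dots> < \<infinity>" using inv K by (simp add: invariant_measure_def)
    finally show ?thesis using em[OF True] by simp
  qed
  moreover have "emeasure (density \<nu> (indicator B)) (shift E ` A) = emeasure (density \<nu> (indicator B)) A"
    if A: "A \<in> sets M" "A \<subseteq> boundary_paths E - paths_of_length E 0" "inj_on (shift E) A" for A
  proof -
    have "shift E p \<in> B \<longleftrightarrow> p \<in> B" if "p \<in> A" for p
      using that A(2) plen_pos_iff[of p E] by (intro shift_B) auto
    \<comment> \<open>Invariance of \<open>B\<close> lets the restriction commute with the
      shift.\<close>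
    then have "B \<inter> shift E ` A = shift E ` (B \<inter> A)" by blast
    moreover have "emeasure \<nu> (shift E ` (B \<inter> A)) = emeasure \<nu> (B \<inter> A)"
      using A B by (intro emeasure_shift_image[OF inv]) (auto intro: inj_on_subset)
    ultimately show ?thesis using em A shift_image_in_sets[OF A(1,2)] by simp
  qed
  ultimately show ?thesis unfolding invariant_measure_def using sets by simp
qed

text \<open>The measure splits into its restrictions to \<open>B\<close> and to the complement. Both
  are invariant, so extremality makes the first a multiple of the whole.\<close>

lemma extremal_zero_one:
  assumes ext: "extremal_measure E \<nu>" and B: "B \<in> sets M"
    and shift_B: "\<And>p. p \<in> boundary_paths E \<Longrightarrow> 0 < plen p \<Longrightarrow> shift E p \<in> B \<longleftrightarrow> p \<in> B"
  shows "emeasure \<nu> B = 0 \<or> emeasure \<nu> (boundary_paths E - B) = 0"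
proof -
  have inv: "invariant_measure E \<nu>" using ext by (simp add: extremal_measure_def)
  have sets: "sets \<nu> = sets M" by (rule sets_invariant_measure[OF inv])
  let ?C = "boundary_paths E - B"
  have C: "?C \<in> sets M" using B sets.top[of M] by auto
  let ?\<nu>1 = "density \<nu> (indicator B)" and ?\<nu>2 = "density \<nu> (indicator ?C)"
  have em1: "emeasure ?\<nu>1 A = emeasure \<nu> (B \<inter> A)" if "A \<in> sets M" for A
    using that B sets by (intro emeasure_restricted) auto
  have em2: "emeasure ?\<nu>2 A = emeasure \<nu> (?C \<inter> A)" if "A \<in> sets M" for A
    using that C sets by (intro emeasure_restricted) auto
  have inv12: "invariant_measure E ?\<nu>1" "invariant_measure E ?\<nu>2"
    using inv B C shift_B shift_in_boundary_paths by (auto intro!: invariant_measure_restrict)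
  have sum: "\<forall>A\<in>sets \<nu>. emeasure \<nu> A = emeasure ?\<nu>1 A + emeasure ?\<nu>2 A"
  proof
    fix A assume A: "A \<in> sets \<nu>"
    have "A = (B \<inter> A) \<union> (?C \<inter> A)" using sets.sets_into_space[of A M] A sets by auto
    moreover have "emeasure \<nu> ((B \<inter> A) \<union> (?C \<inter> A)) = emeasure \<nu> (B \<inter> A) + emeasure \<nu> (?C \<inter> A)"
      using A B C sets by (intro plus_emeasure[symmetric]) auto
    ultimately show "emeasure \<nu> A = emeasure ?\<nu>1 A + emeasure ?\<nu>2 A"
      using A sets em1 em2 by simp
  qed
  have "?\<nu>1 \<in> {scale_measure (ennreal c) \<nu> | c. c \<ge> 0}"
    using ext inv12 sum unfolding extremal_measure_def by blast
  then obtain c where c: "?\<nu>1 = scale_measure (ennreal c) \<nu>" by blast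
  \<comment> \<open>Evaluating on \<open>B\<close> and on its complement: either the factor is 0,
    and \<open>B\<close> is null, or the complement is null. Infinite masses cause no trouble
    here.\<close>
  have "ennreal c * emeasure \<nu> B = emeasure \<nu> B"
    using em1[OF B] unfolding c by simp
  moreover have "ennreal c * emeasure \<nu> ?C = 0"
    using em1[OF C] unfolding c by simp
  ultimately show ?thesis by (metis mult_eq_0_iff mult_zero_left)
qed

text \<open>Each \<open>S B\<close> is null or has a null complement, and countably many exceptional
  sets can be discarded. A surviving path \<open>z\<close> ends in a finite cycle \<open>F\<close>;
  any other surviving path must end in \<open>F\<close> too, or some member of the network would
  tell them apart.\<close>

lemma extremal_cyclic_concentrated_on_orbit:
  assumes ext: "extremal_measure E \<nu>" and nz: "emeasure \<nu> (space \<nu>) \<noteq> 0"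
    and conc: "concentrated_on \<nu> (eventually_cyclic E)"
  shows "\<exists>a. primitive_loop E a \<and> emeasure \<nu> (boundary_paths E - loop_orbit E a) = 0"
proof -
  have inv: "invariant_measure E \<nu>" using ext by (simp add: extremal_measure_def)
  have sets: "sets \<nu> = sets M" by (rule sets_invariant_measure[OF inv])
  have space: "space \<nu> = boundary_paths E" by (rule space_invariant_measure[OF inv])
  \<comment> \<open>Intersecting with the periodic paths makes the saturation shift-invariant, so
    that the zero-one law applies to it.\<close>
  define S where "S B = saturation E (periodic_paths E \<inter> B)" for B
  have S_sets: "S B \<in> sets \<nu>" if "B \<in> network" for B
    unfolding S_def sets using network_in_sets[OF that] periodic_paths_in_sets
    by (intro saturation_in_sets sets.Int)
  have S01: "S B \<in> null_sets \<nu> \<or> boundary_paths E - S B \<in> null_sets \<nu>" if B: "B \<in> network" for B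
  proof -
    have "emeasure \<nu> (S B) = 0 \<or> emeasure \<nu> (boundary_paths E - S B) = 0"
    proof (rule extremal_zero_one[OF ext])
      show "S B \<in> sets M" using S_sets[OF B] sets by simp
      show "shift E p \<in> S B \<longleftrightarrow> p \<in> S B" if "p \<in> boundary_paths E" "0 < plen p" for p
        unfolding S_def by (rule shift_in_saturation_iff[OF _ that]) simp
    qed
    moreover have "boundary_paths E - S B \<in> sets \<nu>"
      using S_sets[OF B] sets.compl_sets[of "S B" \<nu>] space by simp
    ultimately show ?thesis using S_sets[OF B] by (auto simp: null_sets_def)
  qed
  define N where "N = (\<Union>B\<in>{B \<in> network. S B \<in> null_sets \<nu>}. S B)"
  define N' where "N' = (\<Union>B\<in>{B \<in> network. boundary_paths E - S B \<in> null_sets \<nu>}. boundary_paths E - S B)"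
  define N'' where "N'' = boundary_paths E - eventually_cyclic E"
  have count: "countable {B \<in> network. P B}" for P
    using countable_network by (rule countable_subset[rotated]) auto
  have "N \<in> null_sets \<nu>" unfolding N_def by (intro null_sets_UN' count) auto
  moreover have "N' \<in> null_sets \<nu>" unfolding N'_def by (intro null_sets_UN' count) auto
  moreover have "N'' \<in> null_sets \<nu>"
    using conc sets.compl_sets[of "eventually_cyclic E" \<nu>] space
    by (auto simp: N''_def concentrated_on_def null_sets_def)
  ultimately have null: "N \<union> N' \<union> N'' \<in> null_sets \<nu>" by (intro null_sets.Un)
  then have "boundary_paths E \<noteq> N \<union> N' \<union> N''" using nz space by (metis null_setsD1)
  moreover have "N \<union> N' \<union> N'' \<subseteq> boundary_paths E"
    using null sets.sets_into_space space by blast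
  \<comment> \<open>Such a path exists because the measure is not zero; its cycle determines the
    orbit.\<close>
  ultimately obtain z where z: "z \<in> boundary_paths E" "z \<notin> N" "z \<notin> N'" "z \<notin> N''" by blast
  have "z \<in> eventually_cyclic E" using z by (simp add: N''_def)
  then obtain n where zi: "z \<in> infinite_paths E" and n: "(shift E ^^ n) z \<in> periodic_paths E"
    unfolding eventually_cyclic_eq_saturation saturation_def by blast
  define x where "x = (shift E ^^ n) z"
  obtain f q where x: "x = InfPath f" and fi: "InfPath f \<in> infinite_paths E" and q: "q > 0" "\<forall>i. f (i + q) = f i"
    using n unfolding x_def[symmetric] by (rule periodic_pathsE)
  obtain a where a: "primitive_loop E a" "loop_infinity a = x"
    using periodic_path_primitive_loop[OF fi q(1)] q(2) x by blast
  \<comment> \<open>The whole cycle of \<open>x\<close> has to be avoided at once, since the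
    saturation of \<open>B\<close> is sensitive to every shift of \<open>x\<close>.\<close>
  define F where "F = (\<lambda>i. (shift E ^^ i) x) ` {..<q}"
  have F: "finite F" "F \<subseteq> infinite_paths E"
    using shift_funpow_in_infinite_paths fi x by (auto simp: F_def)
  have xF: "(shift E ^^ i) x \<in> F" for i
  proof -
    have "f (j + i) = f (j + i mod q)" for j
      using periodic_mult[of f q "j + i mod q" "i div q"] q(2) by (simp add: add.assoc)
    then have "(shift E ^^ i) x = (shift E ^^ (i mod q)) x" by (simp add: x shift_funpow_InfPath)
    then show ?thesis using q(1) by (simp add: F_def)
  qed
  have "y \<in> loop_orbit E a" if y: "y \<in> boundary_paths E" "y \<notin> N" "y \<notin> N''" for y
  proof -
    have "y \<in> eventually_cyclic E" using y by (simp add: N''_def)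
    then obtain m where yi: "y \<in> infinite_paths E" and m: "(shift E ^^ m) y \<in> periodic_paths E"
      unfolding eventually_cyclic_eq_saturation saturation_def by blast
    have "(shift E ^^ m) y \<in> F"
    proof (rule ccontr)
      assume "(shift E ^^ m) y \<notin> F"
      then obtain B where B: "B \<in> network" "(shift E ^^ m) y \<in> B" "B \<inter> F = {}"
        using separate_finite[OF shift_funpow_in_infinite_paths[OF yi] F] by blast
      \<comment> \<open>As \<open>y\<close> survives, \<open>S B\<close> is not null, hence conull,
        and contains the surviving \<open>z\<close>. Then some shift of \<open>x\<close> lies in
        \<open>B\<close>, which was chosen disjoint from the cycle.\<close>
      have "y \<in> S B" using yi m B(2) by (auto simp: S_def saturation_def)
      then have "S B \<notin> null_sets \<nu>" using y(2) B(1) by (auto simp: N_def)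
      then have "boundary_paths E - S B \<in> null_sets \<nu>" using S01[OF B(1)] by blast
      then have "z \<in> S B" using z(1,3) B(1) by (auto simp: N'_def)
      then have "x \<in> S B"
        unfolding S_def x_def using shift_funpow_in_saturation_iff[OF _ zi] by blast
      then obtain i where "(shift E ^^ i) x \<in> B" by (auto simp: S_def saturation_def)
      then show False using xF[of i] B(3) by blast
    qed
    then obtain i where "(shift E ^^ m) y = (shift E ^^ i) x" by (auto simp: F_def)
    then show ?thesis
      using in_loop_orbit_iff[of E a y] a yi by (auto simp: primitive_loop_def)
  qed
  then have "boundary_paths E - loop_orbit E a \<subseteq> N \<union> N' \<union> N''" by blast
  moreover have "boundary_paths E - loop_orbit E a \<in> sets \<nu>"
    using loop_orbit_in_sets[of a] a sets.top[of M] sets by (auto simp: primitive_loop_def)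
  ultimately have "boundary_paths E - loop_orbit E a \<in> null_sets \<nu>"
    using null null_sets_subset by blast
  then show ?thesis using a(1) by (auto simp: null_sets_def)
qed

section \<open>Summability of the loop and the correspondence with rays\<close>

lemma range_set_compact_in_sets:
  assumes "compactin (vtop E) K"
  shows "range_set K \<in> sets M"
proof -
  have "openin (vtop E) (topspace (vtop E) - K)"
    using compactin_imp_closedin[OF Hausdorff_vtop assms] by (simp add: closedin_def)
  moreover have "range_set K = space M - range_set (topspace (vtop E) - K)"
    using rng_in_topspace boundary_all by (auto simp: range_set_def)
  ultimately show ?thesis using range_set_in_sets by (simp only: sets.compl_sets)
qed

text \<open>The point mass \<open>c\<close> is finite because a singleton is compact, and positive
  because the measure is not zero. Finiteness on the compact set \<open>range_set K\<close> then
  bounds the number of orbit points whose range is near \<open>w\<close>.\<close>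

lemma extremal_cyclic_eq_loop_measure:
  assumes ext: "extremal_measure E \<nu>" and nz: "emeasure \<nu> (space \<nu>) \<noteq> 0"
    and conc: "concentrated_on \<nu> (eventually_cyclic E)"
  shows "\<exists>a. summable_loop E a \<and> measure_ray \<nu> = measure_ray (loop_measure E a)"
proof -
  have inv: "invariant_measure E \<nu>" using ext by (simp add: extremal_measure_def)
  obtain a where a: "primitive_loop E a" and null: "emeasure \<nu> (boundary_paths E - loop_orbit E a) = 0"
    using extremal_cyclic_concentrated_on_orbit[OF assms] by blast
  then have loop: "is_loop E a" by (simp add: primitive_loop_def)
  have ainf: "loop_infinity a \<in> boundary_paths E"
    using loop_infinity_in_infinite_paths[OF loop] infinite_subset_boundary by blast
  have "compactin (boundary_topology E) {loop_infinity a}"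
    using ainf by (simp add: topspace_boundary_topology)
  then have "emeasure \<nu> {loop_infinity a} < \<infinity>" using inv unfolding invariant_measure_def by blast
  then obtain c where c0: "c \<ge> 0" and c: "emeasure \<nu> {loop_infinity a} = ennreal c"
    by (metis ennreal_cases infinity_ennreal_def less_irrefl)
  have em: "emeasure \<nu> A = ennreal c * emeasure (count_space UNIV) (A \<inter> loop_orbit E a)" if "A \<in> sets M" for A
    using emeasure_orbit_concentrated[OF inv loop null that] c by simp
  have "c \<noteq> 0"
  proof
    assume "c = 0"
    then have "emeasure \<nu> (space M) = 0" using em[OF sets.top] by simp
    then show False using nz space_invariant_measure[OF inv] by simp
  qed
  then have cpos: "c > 0" using c0 by simp
  have "\<exists>V. openin (vtop E) V \<and> w \<in> V \<and> finite (range_set V \<inter> loop_orbit E a)"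
    if w: "w \<in> topspace (vtop E)" for w
  proof -
    obtain V K where VK: "openin (vtop E) V" "compactin (vtop E) K" "w \<in> V" "V \<subseteq> K"
      using topological w unfolding topological_graph_def locally_compact_space_def by metis
    have "emeasure \<nu> (range_set K) < \<infinity>"
      using compactin_range_set[OF VK(2)] inv unfolding invariant_measure_def by blast
    \<comment> \<open>A positive \<open>c\<close> times the number of orbit points is finite, hence
      so is the number.\<close>
    then have "finite (range_set K \<inter> loop_orbit E a)"
      using em[OF range_set_compact_in_sets[OF VK(2)]] cpos
      by (auto simp: emeasure_count_space ennreal_mult_eq_top_iff split: if_splits)
    then have "finite (range_set V \<inter> loop_orbit E a)"
      by (rule finite_subset[rotated]) (use VK(4) in \<open>auto simp: range_set_def\<close>)
    then show ?thesis using VK by blast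
  qed
  then have "summable_loop E a" using a by (simp add: summable_loop_iff)
  moreover have "measure_ray \<nu> = measure_ray (loop_measure E a)"
    unfolding orbit_concentrated_eq_scale[OF inv a null c] by (rule measure_ray_scale[OF cpos])
  ultimately show ?thesis by blast
qed

lemma loop_measure_cong:
  assumes "primitive_loop E a" "primitive_loop E b" "loop_orbit E a = loop_orbit E b"
  shows "loop_measure E a = loop_measure E b"
  by (rule measure_eqI) (simp_all add: emeasure_loop_measure assms)

text \<open>The orbit is recovered from the ray as the set of infinite paths with non-zero mass,
  which positive factors do not change.\<close>

lemma measure_ray_loop_measure_inj:
  assumes a: "primitive_loop E a" and b: "primitive_loop E b"
    and eq: "measure_ray (loop_measure E a) = measure_ray (loop_measure E b)"
  shows "loop_orbit E a = loop_orbit E b"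
proof -
  have "loop_measure E a \<in> measure_ray (loop_measure E a)"
    unfolding measure_ray_def by (rule CollectI, rule exI[of _ 1]) (simp add: scale_measure_1)
  then obtain c where c: "c > 0" "loop_measure E a = scale_measure (ennreal c) (loop_measure E b)"
    unfolding eq by (auto simp: measure_ray_def)
  have nz: "y \<in> loop_orbit E d \<longleftrightarrow> emeasure (loop_measure E d) {y} \<noteq> 0"
    if "primitive_loop E d" "y \<in> infinite_paths E" for y d
    using that by (simp add: emeasure_loop_measure singleton_in_sets emeasure_count_space)
  have "y \<in> loop_orbit E a \<longleftrightarrow> y \<in> loop_orbit E b" if "y \<in> infinite_paths E" for y
    using nz[OF a that] nz[OF b that] c by simp
  then show ?thesis using loop_orbit_infinite[of E] by blast
qed

end

theorem theorem5p2:
  fixes E :: "('v, 'e) tgraph"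
  assumes "topological_graph E" and "second_countable_graph E"
  shows "\<exists>\<Phi>. bij_betw \<Phi> ({a. summable_loop E a} // loop_equiv E) (cyclic_extremal_rays E) \<and>
           (\<forall>a. summable_loop E a \<longrightarrow>
              \<Phi> (loop_equiv E `` {a}) = measure_ray (loop_measure E a))"
proof -
  interpret second_countable_topological_graph E
    using assms by unfold_locales
  have prim: "primitive_loop E a" if "summable_loop E a" for a
    using that by (simp add: summable_loop_iff)
  have loop: "is_loop E a" if "summable_loop E a" for a
    using that by (simp add: summable_loop_def)
  \<comment> \<open>Classes of summable loops correspond to orbits, so the measure depends only on
    the class and the choice by \<open>SOME\<close> below may pick any representative.\<close>
  have class_iff: "loop_equiv E `` {a} = loop_equiv E `` {b} \<longleftrightarrow> loop_orbit E a = loop_orbit E b"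
    if "summable_loop E a" "summable_loop E b" for a b
    using loop_equiv_Image_eq_iff[OF loop loop, OF that] loop_orbit_cong[of a b E]
      loop_orbit_eq_imp_equiv[OF prim prim, OF that]
    by blast
  define \<Phi> where "\<Phi> X = measure_ray (loop_measure E (SOME a. summable_loop E a \<and> X = loop_equiv E `` {a}))" for X
  have \<Phi>: "\<Phi> (loop_equiv E `` {a}) = measure_ray (loop_measure E a)" if a: "summable_loop E a" for a
  proof -
    define b where "b = (SOME b. summable_loop E b \<and> loop_equiv E `` {a} = loop_equiv E `` {b})"
    have "summable_loop E b \<and> loop_equiv E `` {a} = loop_equiv E `` {b}"
      unfolding b_def by (rule someI[of _ a]) (simp add: a)
    then have "loop_measure E b = loop_measure E a"
      using class_iff[OF a] prim a by (intro loop_measure_cong) auto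
    then show ?thesis by (simp add: \<Phi>_def b_def)
  qed
  have "bij_betw \<Phi> ({a. summable_loop E a} // loop_equiv E) (cyclic_extremal_rays E)"
  proof (rule bij_betw_imageI)
    show "inj_on \<Phi> ({a. summable_loop E a} // loop_equiv E)"
    proof (rule inj_onI)
      fix X Y assume "X \<in> {a. summable_loop E a} // loop_equiv E" "Y \<in> {a. summable_loop E a} // loop_equiv E"
        and eq: "\<Phi> X = \<Phi> Y"
      then obtain a b where ab: "summable_loop E a" "X = loop_equiv E `` {a}"
        "summable_loop E b" "Y = loop_equiv E `` {b}"
        by (auto elim!: quotientE)
      have "measure_ray (loop_measure E a) = measure_ray (loop_measure E b)"
        using eq unfolding ab(2,4) \<Phi>[OF ab(1)] \<Phi>[OF ab(3)] .
      then have "loop_orbit E a = loop_orbit E b"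
        by (rule measure_ray_loop_measure_inj[OF prim[OF ab(1)] prim[OF ab(3)]])
      then show "X = Y" unfolding ab(2,4) using class_iff[OF ab(1,3)] by simp
    qed
    show "\<Phi> ` ({a. summable_loop E a} // loop_equiv E) = cyclic_extremal_rays E"
    proof (intro set_eqI iffI)
      fix R assume "R \<in> \<Phi> ` ({a. summable_loop E a} // loop_equiv E)"
      then obtain a where "summable_loop E a" "R = \<Phi> (loop_equiv E `` {a})"
        by (auto elim!: quotientE)
      then show "R \<in> cyclic_extremal_rays E"
        using loop_measure_ray_in_cyclic_extremal_rays \<Phi> by metis
    next
      fix R assume "R \<in> cyclic_extremal_rays E"
      then obtain \<nu> where "R = measure_ray \<nu>" "emeasure \<nu> (space \<nu>) \<noteq> 0" "extremal_measure E \<nu>"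
        "concentrated_on \<nu> (eventually_cyclic E)"
        unfolding cyclic_extremal_rays_def by blast
      then obtain a where "summable_loop E a" "R = measure_ray (loop_measure E a)"
        using extremal_cyclic_eq_loop_measure by blast
      then show "R \<in> \<Phi> ` ({a. summable_loop E a} // loop_equiv E)"
        using \<Phi> by (intro image_eqI[of _ _ "loop_equiv E `` {a}"]) (auto intro: quotientI)
    qed
  qed
  with \<Phi> show ?thesis by blast
qed

end
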